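(* Let $\Lambda\ge\lambda>0$ and $\epsilon_0>0$ be constants. Let $u_0\in C^2(\mathbb{R}^n)$ and let $u(x,t)\in C^{\infty}(\mathbb{R}^{n}\times(0,+\infty))\cap C(\mathbb{R}^{n}\times[0,+\infty))$ be a strictly convex (in $x$) solution of the logarithmic Monge-Ampère flow $$\frac{\partial u}{\partial t}-\frac{1}{n}\ln\det D^{2}u=0\quad (t>0,\ x\in\mathbb{R}^{n}),\qquad u=u_{0}(x)\quad (t=0,\ x\in\mathbb{R}^{n}),$$ such that $u(\cdot,t)$ satisfies Condition A with the constants $\lambda,\Lambda$ for every $t\ge 0$. Then there exists a positive constant $C$ depending only on $n,\lambda,\Lambda,\frac{1}{\epsilon_0}$ such that $$\sup_{x\in\mathbb{R}^{n}}|D^{3}u(x,t)|^{2}\leq\frac{C}{t},\qquad\forall t\geq\epsilon_{0}.$$ More generally, for every $l\in\{3,4,5,\dots\}$ there is a positive constant $C$ depending only on $l,n,\lambda,\Lambda,\frac{1}{\epsilon_0}$ such that $$\sup_{x\in\mathbb{R}^{n}}|D^{l}u(x,t)|^{2}\leq\frac{C}{t^{l-2}},\qquad\forall t\geq\epsilon_{0}.$$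
   Context: $D$, $D^2$, $D^l$ denote derivatives with respect to the space variable $x$ only. A function $v\in C^2(\mathbb{R}^n)$ satisfies Condition A (with positive constants $\lambda,\Lambda$) if $\Lambda I\ge D^2v(x)\ge\lambda I$ for all $x\in\mathbb{R}^n$, where $I$ is the identity matrix. *)

theory Defs
  imports "HOL-Analysis.Analysis"
begin

text \<open>
  \<open>C_k_on k f S\<close> says that \<open>f\<close> is of class \<open>C^k\<close> on the open set \<open>S\<close>. In finite dimension,
  continuity of the derivative in operator norm is the same as continuity of all its directional
  components, which is what the recursion asks for.
\<close>

primrec C_k_on ::
  "nat \<Rightarrow> ('a::euclidean_space \<Rightarrow> 'b::real_normed_vector) \<Rightarrow> 'a set \<Rightarrow> bool" where
  "C_k_on 0 f S \<longleftrightarrow> continuous_on S f"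
| "C_k_on (Suc k) f S \<longleftrightarrow>
     (\<forall>x\<in>S. f differentiable (at x)) \<and>
     (\<forall>v. C_k_on k (\<lambda>x. frechet_derivative f (at x) v) S)"

definition smooth_fun_on ::
  "('a::euclidean_space \<Rightarrow> 'b::real_normed_vector) \<Rightarrow> 'a set \<Rightarrow> bool" where
  "smooth_fun_on f S \<longleftrightarrow> (\<forall>k. C_k_on k f S)"

primrec partial_deriv :: "'n::finite list \<Rightarrow> (real^'n \<Rightarrow> real) \<Rightarrow> real^'n \<Rightarrow> real" where
  "partial_deriv [] f = f"
| "partial_deriv (i # js) f = (\<lambda>x. frechet_derivative (partial_deriv js f) (at x) (axis i 1))"

definition hessian :: "(real^'n \<Rightarrow> real) \<Rightarrow> real^'n \<Rightarrow> real^'n^'n" where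
  "hessian f x = (\<chi> i j. partial_deriv [i, j] f x)"

text \<open>
  \<open>|D^l f(x)|\<close> is the Euclidean norm of the tensor of all \<open>l\<close>-th order partial derivatives, so its
  square is the sum over all \<open>i\<^sub>1, \<dots>, i\<^sub>l\<close> of \<open>(\<partial>\<^bsub>i1\<^esub> \<dots> \<partial>\<^bsub>il\<^esub> f(x))\<^sup>2\<close>.
\<close>

definition norm_D :: "nat \<Rightarrow> (real^'n \<Rightarrow> real) \<Rightarrow> real^'n \<Rightarrow> real" where
  "norm_D l f x = sqrt (\<Sum>js | length js = l. (partial_deriv js f x)\<^sup>2)"

definition matrix_le :: "real^'n^'n \<Rightarrow> real^'n^'n \<Rightarrow> bool" where
  "matrix_le A B \<longleftrightarrow> (\<forall>v. v \<bullet> (A *v v) \<le> v \<bullet> (B *v v))"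

definition condition_A :: "real \<Rightarrow> real \<Rightarrow> (real^'n \<Rightarrow> real) \<Rightarrow> bool" where
  "condition_A lam Lam v \<longleftrightarrow>
     C_k_on 2 v UNIV \<and>
     (\<forall>x. matrix_le (lam *\<^sub>R mat 1) (hessian v x) \<and> matrix_le (hessian v x) (Lam *\<^sub>R mat 1))"

definition strictly_convex_fun :: "('a::real_vector \<Rightarrow> real) \<Rightarrow> bool" where
  "strictly_convex_fun f \<longleftrightarrow>
     (\<forall>x y s. x \<noteq> y \<longrightarrow> 0 < s \<longrightarrow> s < 1 \<longrightarrow>
        f ((1 - s) *\<^sub>R x + s *\<^sub>R y) < (1 - s) * f x + s * f y)"

text \<open>
  Only the values \<open>u x t\<close> with \<open>t \<ge> 0\<close> matter. The determinant is required to be positive because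
  \<open>ln\<close> in HOL is total (\<open>ln x = ln \<bar>x\<bar>\<close>), whereas the equation presupposes that the logarithm is
  defined.
\<close>

definition log_MA_flow_solution ::
  "(real^'n \<Rightarrow> real) \<Rightarrow> (real^'n \<Rightarrow> real \<Rightarrow> real) \<Rightarrow> bool" where
  "log_MA_flow_solution u0 u \<longleftrightarrow>
     smooth_fun_on (\<lambda>(x, t). u x t) (UNIV \<times> {0<..}) \<and>
     continuous_on (UNIV \<times> {0..}) (\<lambda>(x, t). u x t) \<and>
     (\<forall>t\<ge>0. strictly_convex_fun (\<lambda>x. u x t)) \<and>
     (\<forall>t>0. \<forall>x. 0 < det (hessian (\<lambda>y. u y t) x) \<and>
        deriv (\<lambda>s. u x s) t - 1 / real CARD('n) * ln (det (hessian (\<lambda>y. u y t) x)) = 0) \<and>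
     (\<forall>x. u x 0 = u0 x)"

end

theory Submission
  imports Defs
begin

text \<open>
  Let \<open>n\<close> be the dimension, \<open>g = D\<^sup>2 u\<close>, and let \<open>L = n \<partial>\<^sub>t - g\<^sup>a\<^sup>b \<partial>\<^sub>a \<partial>\<^sub>b\<close> be \<open>n\<close> times the
  linearisation of the equation at \<open>u\<close>. The bounds \<open>\<lambda> I \<le> g \<le> \<Lambda> I\<close> make \<open>L\<close> uniformly
  parabolic. All estimates are proved at time 1 only, with a constant that serves every solution
  with these bounds. This suffices: \<open>\<mu>\<^sup>-\<^sup>2 u (\<mu> x, \<mu>\<^sup>2 t)\<close> is a solution with the same bounds,
  and its derivatives of order \<open>l\<close> at time 1 are those of \<open>u\<close> at time \<open>\<mu>\<^sup>2\<close> multiplied by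
  \<open>\<mu>\<^sup>l\<^sup>-\<^sup>2\<close>, which is exactly the decay asserted (lemma \<open>jet_sq_scaling\<close>).

  Nothing is known beforehand about the size of the derivatives of order three and more near
  infinity, so the maximum principle has to be localised. The tool is theorem \<open>interior_maximum_bound\<close>: a smooth
  function \<open>G\<close> with \<open>L G \<le> b - c G\<^sup>2\<close> wherever it is positive and \<open>t \<ge> 1/2\<close> is bounded at time 1 by a constant
  depending on \<open>n\<close>, \<open>b\<close>, \<open>c\<close> alone. The quadratic term allows a comparison with an explicit
  supersolution that is infinite on the lateral boundary of a cylinder and at its bottom; the
  radius of the cylinder then tends to infinity.

  For the third derivatives, \<open>G\<close> is Calabi's quantity
  \<open>S = g\<^sup>i\<^sup>a g\<^sup>j\<^sup>b g\<^sup>k\<^sup>c u\<^sub>i\<^sub>j\<^sub>k u\<^sub>a\<^sub>b\<^sub>c\<close>. Up to the time scale the flow is the Kaehler-Ricci flow for metrics invariant in the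
  imaginary directions, and as there \<open>L S\<close> has a sign. At a point where \<open>g = I\<close> a computation gives
  \<open>L S = - 2 |Q|\<^sup>2 + 6 X - 3 |R|\<^sup>2 - 2 W\<close> with \<open>Q\<close> the fourth derivatives and contractions \<open>X\<close>, \<open>R\<close>, \<open>W\<close>
  of \<open>Q\<close> and \<open>D\<^sup>3 u\<close>; completing the square in \<open>Q\<close> leaves at most \<open>- |R|\<^sup>2 / 2 \<le> - S\<^sup>2 / (2 n)\<close> (lemma
  \<open>calabi_inequality\<close>). Since \<open>S\<close> is invariant under linear changes of the space variable, the
  inequality holds at every point (lemma \<open>heat_calabi\<close>).

  For order \<open>m + 1\<close> with \<open>m \<ge> 3\<close>, assume that the orders 3 to \<open>m\<close> are bounded. Then \<open>L |D\<^sup>m u|\<^sup>2\<close>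
  contains a good term \<open>- c |D\<^sup>m\<^sup>+\<^sup>1 u|\<^sup>2\<close>, and \<open>L |D\<^sup>m\<^sup>+\<^sup>1 u|\<^sup>2\<close> contains a good term
  \<open>- c |D\<^sup>m\<^sup>+\<^sup>2 u|\<^sup>2\<close> and errors that are at most quadratic in \<open>D\<^sup>m\<^sup>+\<^sup>1 u\<close> and linear in \<open>D\<^sup>m\<^sup>+\<^sup>2 u\<close>, times
  \<open>|D\<^sup>m\<^sup>+\<^sup>1 u|\<close>. For a large constant \<open>k\<close> the product
  \<open>G = (k + |D\<^sup>m u|\<^sup>2) |D\<^sup>m\<^sup>+\<^sup>1 u|\<^sup>2\<close> then satisfies \<open>L G \<le> b - c G\<^sup>2\<close> (lemma \<open>heat_product_inequality\<close>).
  The shape of the errors is read off from the algebraic form of \<open>L \<partial>\<^sup>J u\<close>, a polynomial in the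
  entries of \<open>g\<^sup>-\<^sup>1\<close> and the derivatives of \<open>u\<close> (lemma \<open>heat_DJ_quasi_linear\<close>).

  The solution is treated as one function on space-time, so that its smoothness makes all partial
  derivatives, including the one in time, commute. The equation only enters through its spatial
  derivatives; it is therefore required up to an additive constant (definition \<open>MA_flow\<close>), which makes
  it stable under all invertible linear changes of the space variable.
\<close>

section \<open>Directional derivatives and smooth functions\<close>

definition dd :: "'a::euclidean_space \<Rightarrow> ('a \<Rightarrow> real) \<Rightarrow> 'a \<Rightarrow> real" where
  "dd v f = (\<lambda>z. frechet_derivative f (at z) v)"

lemma dd_eq: "(f has_derivative f') (at z) \<Longrightarrow> dd v f z = f' v"
  unfolding dd_def by (metis frechet_derivative_at)

lemma has_derivative_dd: "f differentiable (at z) \<Longrightarrow> (f has_derivative (\<lambda>v. dd v f z)) (at z)"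
  unfolding dd_def using frechet_derivative_works by (metis eta_contract_eq)

lemma dd_cong:
  assumes "open S" "z \<in> S" "\<And>y. y \<in> S \<Longrightarrow> f y = g y"
  shows "dd v f z = dd v g z"
proof -
  have "(f has_derivative f') (at z) \<longleftrightarrow> (g has_derivative f') (at z)" for f'
    using has_derivative_transform_within_open[OF _ assms(1,2)] assms(3) by metis
  then show ?thesis unfolding dd_def frechet_derivative_def by simp
qed

lemma differentiable_cong_open:
  fixes f g :: "'a::real_normed_vector \<Rightarrow> 'b::real_normed_vector"
  assumes "open S" "z \<in> S" "\<And>y. y \<in> S \<Longrightarrow> f y = g y" "f differentiable (at z)"
  shows "g differentiable (at z)"
  using has_derivative_transform_within_open[OF _ assms(1,2)] assms(3,4)
  unfolding differentiable_def by metis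

lemma dd_const [simp]: "dd v (\<lambda>z. c) z = 0"
  by (rule dd_eq[where f' = "\<lambda>_. 0", simplified]) simp

lemma dd_add: "f differentiable (at z) \<Longrightarrow> g differentiable (at z) \<Longrightarrow>
   dd v (\<lambda>y. f y + g y) z = dd v f z + dd v g z"
  by (rule dd_eq[OF has_derivative_add[OF has_derivative_dd has_derivative_dd]])

lemma dd_diff: "f differentiable (at z) \<Longrightarrow> g differentiable (at z) \<Longrightarrow>
   dd v (\<lambda>y. f y - g y) z = dd v f z - dd v g z"
  by (rule dd_eq[OF has_derivative_diff[OF has_derivative_dd has_derivative_dd]])

lemma dd_mult: "f differentiable (at z) \<Longrightarrow> g differentiable (at z) \<Longrightarrow>
   dd v (\<lambda>y. f y * g y) z = f z * dd v g z + dd v f z * g z"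
  by (rule dd_eq[OF has_derivative_mult[OF has_derivative_dd has_derivative_dd]])

lemma dd_cmult: "f differentiable (at z) \<Longrightarrow> dd v (\<lambda>y. c * f y) z = c * dd v f z"
  by (simp add: dd_mult)

lemma dd_sum: "(\<And>i. i \<in> I \<Longrightarrow> f i differentiable (at z)) \<Longrightarrow>
   dd v (\<lambda>y. \<Sum>i\<in>I. f i y) z = (\<Sum>i\<in>I. dd v (f i) z)"
  by (rule dd_eq[OF has_derivative_sum[OF has_derivative_dd]])

lemma dd_linear: "f differentiable (at z) \<Longrightarrow> linear (\<lambda>v. dd v f z)"
  unfolding dd_def by (simp add: linear_frechet_derivative)

lemma dd_ln_comp:
  assumes "f differentiable (at z)" "0 < f z"
  shows "dd v (\<lambda>y. ln (f y)) z = dd v f z / f z"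
  using dd_eq[OF has_derivative_ln[OF assms(2) has_derivative_dd[OF assms(1)]]] assms(2)
  by (simp add: field_simps)

lemma dd_comp_linear:
  assumes "bounded_linear L" "f differentiable (at (L z))"
  shows "dd v (\<lambda>y. f (L y)) z = dd (L v) f (L z)"
  using dd_eq[OF has_derivative_compose[OF bounded_linear_imp_has_derivative[OF assms(1)]
      has_derivative_dd[OF assms(2)]]] by simp

lemma DERIV_along_line:
  assumes "f differentiable (at (z + s *\<^sub>R v))"
  shows "((\<lambda>r. f (z + r *\<^sub>R v)) has_real_derivative dd v f (z + s *\<^sub>R v)) (at s)"
proof -
  have "((\<lambda>r. z + r *\<^sub>R v) has_derivative (\<lambda>r. r *\<^sub>R v)) (at s)"
    by (auto intro!: derivative_eq_intros)
  from has_derivative_compose[OF this has_derivative_dd[OF assms]]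
  have "((\<lambda>r. f (z + r *\<^sub>R v)) has_derivative (\<lambda>r. dd (r *\<^sub>R v) f (z + s *\<^sub>R v))) (at s)" .
  moreover have "dd (r *\<^sub>R v) f (z + s *\<^sub>R v) = r * dd v f (z + s *\<^sub>R v)" for r
    using linear_cmul[OF dd_linear[OF assms]] by simp
  ultimately show ?thesis unfolding has_field_derivative_def
    by (simp add: mult_commute_abs)
qed

lemma smooth_fun_on_differentiable:
  "smooth_fun_on f S \<Longrightarrow> z \<in> S \<Longrightarrow> f differentiable (at z)"
  unfolding smooth_fun_on_def by (metis C_k_on.simps(2))

lemma smooth_fun_on_continuous: "smooth_fun_on f S \<Longrightarrow> continuous_on S f"
  unfolding smooth_fun_on_def by (metis C_k_on.simps(1))

lemma smooth_fun_on_dd: "smooth_fun_on f S \<Longrightarrow> smooth_fun_on (dd v f) S"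
  unfolding smooth_fun_on_def dd_def by (metis C_k_on.simps(2))

lemma C_k_on_cong:
  fixes f g :: "'a::euclidean_space \<Rightarrow> real"
  assumes "open S"
  shows "(\<And>y. y \<in> S \<Longrightarrow> f y = g y) \<Longrightarrow> C_k_on k f S \<Longrightarrow> C_k_on k g S"
proof (induction k arbitrary: f g)
  case 0
  then show ?case using continuous_on_cong by (metis C_k_on.simps(1))
next
  case (Suc k)
  have 1: "\<forall>x\<in>S. g differentiable (at x)"
    using Suc.prems differentiable_cong_open[OF assms] by (metis C_k_on.simps(2))
  have 2: "C_k_on k (\<lambda>x. frechet_derivative g (at x) v) S" for v
  proof (rule Suc.IH[of "\<lambda>x. frechet_derivative f (at x) v"])
    show "frechet_derivative f (at y) v = frechet_derivative g (at y) v" if "y \<in> S" for y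
      using dd_cong[OF assms that Suc.prems(1)] by (simp add: dd_def)
    show "C_k_on k (\<lambda>x. frechet_derivative f (at x) v) S" using Suc.prems by simp
  qed
  show ?case using 1 2 by simp
qed

lemma C_k_on_dd: "C_k_on (Suc k) f S \<Longrightarrow> C_k_on k (dd v f) S"
  by (simp add: dd_def)

lemma C_k_on_Suc_D:
  fixes f :: "'a::euclidean_space \<Rightarrow> real"
  shows "C_k_on (Suc k) f S \<Longrightarrow> C_k_on k f S"
proof (induction k arbitrary: f)
  case 0
  then show ?case
    by (auto intro!: continuous_at_imp_continuous_on differentiable_imp_continuous_within)
next
  case (Suc k)
  then show ?case by (metis C_k_on.simps(2))
qed

lemma C_k_on_SucI:
  fixes f :: "'a::euclidean_space \<Rightarrow> real"
  assumes "\<And>x. x \<in> S \<Longrightarrow> f differentiable (at x)" "\<And>v. C_k_on k (dd v f) S"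
  shows "C_k_on (Suc k) f S"
  using assms by (simp add: dd_def)

lemma C_k_on_const: "C_k_on k (\<lambda>z::'a::euclidean_space. c::real) S"
proof (induction k arbitrary: c)
  case (Suc k)
  show ?case using Suc[of 0] by simp
qed simp

lemma C_k_on_add:
  fixes f g :: "'a::euclidean_space \<Rightarrow> real"
  assumes "open S"
  shows "C_k_on k f S \<Longrightarrow> C_k_on k g S \<Longrightarrow> C_k_on k (\<lambda>y. f y + g y) S"
proof (induction k arbitrary: f g)
  case 0 then show ?case by (simp add: continuous_on_add)
next
  case (Suc k)
  have d: "f differentiable (at x)" "g differentiable (at x)" if "x \<in> S" for x
    using Suc.prems that by simp_all
  show ?case
  proof (rule C_k_on_SucI)
    show "(\<lambda>y. f y + g y) differentiable (at x)" if "x \<in> S" for x using d[OF that] by simp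
    show "C_k_on k (dd v (\<lambda>y. f y + g y)) S" for v
      by (rule C_k_on_cong[OF assms _ Suc.IH[OF C_k_on_dd[OF Suc.prems(1)] C_k_on_dd[OF Suc.prems(2)]]])
         (simp add: dd_add d)
  qed
qed

lemma C_k_on_mult:
  fixes f g :: "'a::euclidean_space \<Rightarrow> real"
  assumes "open S"
  shows "C_k_on k f S \<Longrightarrow> C_k_on k g S \<Longrightarrow> C_k_on k (\<lambda>y. f y * g y) S"
proof (induction k arbitrary: f g)
  case 0 then show ?case by (simp add: continuous_on_mult)
next
  case (Suc k)
  have d: "f differentiable (at x)" "g differentiable (at x)" if "x \<in> S" for x
    using Suc.prems that by simp_all
  have c: "C_k_on k f S" "C_k_on k g S" using Suc.prems C_k_on_Suc_D by blast+
  show ?case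
  proof (rule C_k_on_SucI)
    show "(\<lambda>y. f y * g y) differentiable (at x)" if "x \<in> S" for x using d[OF that] by simp
    show "C_k_on k (dd v (\<lambda>y. f y * g y)) S" for v
      by (rule C_k_on_cong[OF assms _ C_k_on_add[OF assms Suc.IH[OF c(1) C_k_on_dd[OF Suc.prems(2)]]
             Suc.IH[OF C_k_on_dd[OF Suc.prems(1)] c(2)]]])
         (simp add: dd_mult d)
  qed
qed

lemma C_k_on_comp_linear:
  fixes f :: "'a::euclidean_space \<Rightarrow> real" and L :: "'b::euclidean_space \<Rightarrow> 'a"
  assumes "bounded_linear L" "open S" "\<And>y. y \<in> S \<Longrightarrow> L y \<in> T"
  shows "C_k_on k f T \<Longrightarrow> C_k_on k (\<lambda>y. f (L y)) S"
proof (induction k arbitrary: f)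
  case 0
  then have "continuous_on T f" by simp
  from continuous_on_compose2[OF this linear_continuous_on[OF assms(1)], of S] assms(3)
  show ?case by auto
next
  case (Suc k)
  have d: "f differentiable (at x)" if "x \<in> T" for x
    using Suc.prems that by simp_all
  show ?case
  proof (rule C_k_on_SucI)
    show "(\<lambda>y. f (L y)) differentiable (at x)" if "x \<in> S" for x
      using d[OF assms(3)[OF that]]
      by (metis has_derivative_compose bounded_linear_imp_has_derivative[OF assms(1)] differentiable_def)
    show "C_k_on k (dd v (\<lambda>y. f (L y))) S" for v
      by (rule C_k_on_cong[OF assms(2) _ Suc.IH[OF C_k_on_dd[OF Suc.prems(1), of "L v"]]])
         (simp add: dd_comp_linear[OF assms(1)] d assms(3))
  qed
qed

lemma smooth_fun_on_const: "smooth_fun_on (\<lambda>z::'a::euclidean_space. c::real) S"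
  by (simp add: smooth_fun_on_def C_k_on_const)

lemma smooth_fun_on_add:
  fixes f g :: "'a::euclidean_space \<Rightarrow> real"
  shows "open S \<Longrightarrow> smooth_fun_on f S \<Longrightarrow> smooth_fun_on g S \<Longrightarrow> smooth_fun_on (\<lambda>y. f y + g y) S"
  by (simp add: smooth_fun_on_def C_k_on_add)

lemma smooth_fun_on_mult:
  fixes f g :: "'a::euclidean_space \<Rightarrow> real"
  shows "open S \<Longrightarrow> smooth_fun_on f S \<Longrightarrow> smooth_fun_on g S \<Longrightarrow> smooth_fun_on (\<lambda>y. f y * g y) S"
  by (simp add: smooth_fun_on_def C_k_on_mult)

lemma smooth_fun_on_power2:
  fixes f :: "'a::euclidean_space \<Rightarrow> real"
  shows "open S \<Longrightarrow> smooth_fun_on f S \<Longrightarrow> smooth_fun_on (\<lambda>y. (f y)\<^sup>2) S"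
  by (simp add: power2_eq_square smooth_fun_on_mult)

lemma smooth_fun_on_sum:
  fixes f :: "'i \<Rightarrow> 'a::euclidean_space \<Rightarrow> real"
  assumes "open S" "\<And>i. i \<in> I \<Longrightarrow> smooth_fun_on (f i) S"
  shows "smooth_fun_on (\<lambda>y. \<Sum>i\<in>I. f i y) S"
proof (cases "finite I")
  case True
  then show ?thesis using assms(2)
    by (induction I rule: finite_induct) (auto intro: smooth_fun_on_const smooth_fun_on_add[OF assms(1)])
qed (simp add: smooth_fun_on_const)

lemma smooth_fun_on_cong:
  fixes f g :: "'a::euclidean_space \<Rightarrow> real"
  shows "open S \<Longrightarrow> smooth_fun_on f S \<Longrightarrow> (\<And>y. y \<in> S \<Longrightarrow> f y = g y) \<Longrightarrow> smooth_fun_on g S"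
  unfolding smooth_fun_on_def using C_k_on_cong by blast

lemma smooth_fun_on_comp_linear:
  fixes f :: "'a::euclidean_space \<Rightarrow> real" and L :: "'b::euclidean_space \<Rightarrow> 'a"
  assumes "bounded_linear L" "open S" "\<And>y. y \<in> S \<Longrightarrow> L y \<in> T" "smooth_fun_on f T"
  shows "smooth_fun_on (\<lambda>y. f (L y)) S"
  using assms C_k_on_comp_linear unfolding smooth_fun_on_def by blast

text \<open>
  Two applications of the mean value theorem write the second difference as a mixed second
  derivative at a nearby point. The difference is symmetric in \<open>v\<close> and \<open>w\<close>, so that letting
  \<open>s\<close> tend to 0 shows that mixed derivatives commute.
\<close>

lemma second_difference_mean_value:
  assumes "open S" "ball z e \<subseteq> S" "smooth_fun_on f S" "0 < s" "s * (norm v + norm w) < e"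
  obtains p where "dist z p \<le> s * (norm v + norm w)"
    "f (z + s *\<^sub>R v + s *\<^sub>R w) - f (z + s *\<^sub>R v) - f (z + s *\<^sub>R w) + f z = s * s * dd w (dd v f) p"
proof -
  have inb: "z + a *\<^sub>R v + b *\<^sub>R w \<in> S \<and> dist z (z + a *\<^sub>R v + b *\<^sub>R w) \<le> s * (norm v + norm w)"
    if "0 \<le> a" "a \<le> s" "0 \<le> b" "b \<le> s" for a b
  proof -
    have "norm (a *\<^sub>R v + b *\<^sub>R w) \<le> a * norm v + b * norm w"
      using norm_triangle_ineq[of "a *\<^sub>R v" "b *\<^sub>R w"] that by simp
    also have "\<dots> \<le> s * norm v + s * norm w"
      using that by (intro add_mono mult_right_mono) auto
    finally have "norm (a *\<^sub>R v + b *\<^sub>R w) \<le> s * (norm v + norm w)" by (simp add: algebra_simps)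
    moreover have "dist z (z + a *\<^sub>R v + b *\<^sub>R w) = norm (a *\<^sub>R v + b *\<^sub>R w)"
      by (metis add.assoc add_diff_cancel_left' dist_norm norm_minus_commute)
    ultimately show ?thesis using assms(2,5) by (auto simp: subset_iff)
  qed
  note d = smooth_fun_on_differentiable[OF assms(3)]
    smooth_fun_on_differentiable[OF smooth_fun_on_dd[OF assms(3)]]
  define phi where "phi r = f ((z + s *\<^sub>R w) + r *\<^sub>R v) - f (z + r *\<^sub>R v)" for r
  have "\<exists>r>0. r < s \<and> phi s - phi 0 = (s - 0) * (dd v f ((z + s *\<^sub>R w) + r *\<^sub>R v) - dd v f (z + r *\<^sub>R v))"
  proof (rule MVT2[OF assms(4)])
    fix r assume "0 \<le> r" "r \<le> s"
    then have "(z + s *\<^sub>R w) + r *\<^sub>R v \<in> S" "z + r *\<^sub>R v \<in> S"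
      using inb[of r s] inb[of r 0] assms(4) by (simp_all add: algebra_simps)
    then show "(phi has_real_derivative dd v f ((z + s *\<^sub>R w) + r *\<^sub>R v) - dd v f (z + r *\<^sub>R v)) (at r)"
      unfolding phi_def by (intro DERIV_diff DERIV_along_line d)
  qed
  then obtain r where r: "0 < r" "r < s"
    "phi s - phi 0 = s * (dd v f ((z + s *\<^sub>R w) + r *\<^sub>R v) - dd v f (z + r *\<^sub>R v))" by auto
  have "\<exists>q>0. q < s \<and> dd v f ((z + r *\<^sub>R v) + s *\<^sub>R w) - dd v f ((z + r *\<^sub>R v) + 0 *\<^sub>R w)
     = (s - 0) * dd w (dd v f) ((z + r *\<^sub>R v) + q *\<^sub>R w)"
  proof (rule MVT2[OF assms(4)])
    fix q assume "0 \<le> q" "q \<le> s"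
    then have "(z + r *\<^sub>R v) + q *\<^sub>R w \<in> S" using inb[of r q] r by simp
    then show "((\<lambda>q. dd v f ((z + r *\<^sub>R v) + q *\<^sub>R w)) has_real_derivative
        dd w (dd v f) ((z + r *\<^sub>R v) + q *\<^sub>R w)) (at q)"
      by (intro DERIV_along_line d)
  qed
  then obtain q where q: "0 < q" "q < s"
    "dd v f ((z + s *\<^sub>R w) + r *\<^sub>R v) - dd v f (z + r *\<^sub>R v) = s * dd w (dd v f) ((z + r *\<^sub>R v) + q *\<^sub>R w)"
    by (auto simp: algebra_simps)
  show thesis
  proof (rule that)
    show "dist z ((z + r *\<^sub>R v) + q *\<^sub>R w) \<le> s * (norm v + norm w)" using inb[of r q] r q by simp
    show "f (z + s *\<^sub>R v + s *\<^sub>R w) - f (z + s *\<^sub>R v) - f (z + s *\<^sub>R w) + f z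
      = s * s * dd w (dd v f) ((z + r *\<^sub>R v) + q *\<^sub>R w)"
      using r(3) q(3) unfolding phi_def by (simp add: algebra_simps)
  qed
qed

lemma dd_commute:
  assumes "open S" "z \<in> S" "smooth_fun_on f S"
  shows "dd v (dd w f) z = dd w (dd v f) z"
proof (rule ccontr)
  let ?X = "dd w (dd v f)" and ?Y = "dd v (dd w f)"
  assume ne: "?Y z \<noteq> ?X z"
  define h where "h = \<bar>?Y z - ?X z\<bar> / 2"
  have h: "0 < h" using ne by (simp add: h_def)
  have "continuous_on S ?X" "continuous_on S ?Y"
    by (intro smooth_fun_on_continuous smooth_fun_on_dd assms(3))+
  then have "isCont ?X z" "isCont ?Y z"
    using assms(1,2) continuous_on_eq_continuous_at by blast+
  then obtain d1 d2 where d: "0 < d1" "0 < d2"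
     "\<And>y. dist y z < d1 \<Longrightarrow> dist (?X y) (?X z) < h" "\<And>y. dist y z < d2 \<Longrightarrow> dist (?Y y) (?Y z) < h"
    using h unfolding continuous_at_eps_delta by metis
  obtain e where e: "0 < e" "ball z e \<subseteq> S" using assms openE by blast
  define m where "m = min e (min d1 d2)"
  have m: "0 < m" using d e by (simp add: m_def)
  define s where "s = m / (2 * (norm v + norm w + 1))"
  have s: "0 < s" using m by (simp add: s_def add_nonneg_pos)
  have "s * (norm v + norm w) < s * (2 * (norm v + norm w + 1))"
    using s by (intro mult_strict_left_mono) (auto simp: add_nonneg_pos add_pos_nonneg)
  also have "\<dots> = m"
  proof -
    have "2 * (norm v + norm w + 1) \<noteq> 0" by (smt (verit) norm_ge_zero)
    then show ?thesis by (simp add: s_def)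
  qed
  finally have sm: "s * (norm v + norm w) < m" .
  have sm': "s * (norm w + norm v) < m" using sm by (simp add: add.commute)
  obtain p where p: "dist z p \<le> s * (norm v + norm w)"
    "f (z + s *\<^sub>R v + s *\<^sub>R w) - f (z + s *\<^sub>R v) - f (z + s *\<^sub>R w) + f z = s * s * ?X p"
    using second_difference_mean_value[OF assms(1) e(2) assms(3) s] sm m_def by (metis min_less_iff_conj)
  obtain q where q: "dist z q \<le> s * (norm w + norm v)"
    "f (z + s *\<^sub>R w + s *\<^sub>R v) - f (z + s *\<^sub>R w) - f (z + s *\<^sub>R v) + f z = s * s * ?Y q"
    using second_difference_mean_value[OF assms(1) e(2) assms(3) s] sm' m_def by (metis min_less_iff_conj)
  have "s * s * ?X p = s * s * ?Y q" using p(2) q(2) by (simp add: algebra_simps)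
  then have "?X p = ?Y q" using s by simp
  moreover have "dist (?X p) (?X z) < h" "dist (?Y q) (?Y z) < h"
    using p(1) q(1) sm sm' m_def d by (simp_all add: dist_commute)
  ultimately show False unfolding h_def dist_real_def by (smt (verit) field_sum_of_halves)
qed

section \<open>Positive definite matrices and orthonormal frames\<close>

text \<open>
  Orthonormality is meant for the inner product \<open>v \<bullet> (A *v w)\<close>. The matrix \<open>P\<close> with columns \<open>p k\<close>
  satisfies \<open>P P\<^sup>T = A\<^sup>-\<^sup>1\<close>, a factorisation that replaces the spectral theorem below.
\<close>

definition orthonormal_frame :: "real^'n^'n \<Rightarrow> ('n::finite \<Rightarrow> real^'n) \<Rightarrow> bool" where
  "orthonormal_frame A p \<longleftrightarrow> (\<forall>i j. p i \<bullet> (A *v p j) = (if i = j then 1 else 0))"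

lemma delta_mult: "(if P then 1 else 0) * x = (if P then x else (0::real))"
  by simp

text \<open>
  Gram-Schmidt: fewer than \<open>n\<close> vectors \<open>A *v p i\<close> have a common orthogonal vector.
\<close>

lemma orthonormal_frame_exists:
  fixes A :: "real^'n^'n"
  assumes sym: "transpose A = A" and pos: "\<And>v. v \<noteq> 0 \<Longrightarrow> 0 < v \<bullet> (A *v v)"
  obtains p where "orthonormal_frame A p"
proof -
  have symA: "v \<bullet> (A *v w) = w \<bullet> (A *v v)" for v w
    by (metis dot_lmul_matrix inner_commute sym transpose_matrix_vector)
  have "\<exists>p. \<forall>i\<in>S. \<forall>j\<in>S. p i \<bullet> (A *v p j) = (if i = j then 1 else 0)" if "finite S" for S :: "'n set"
    using that
  proof (induction S rule: finite_induct)
    case (insert k S)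
    then obtain p where p: "\<And>i j. i \<in> S \<Longrightarrow> j \<in> S \<Longrightarrow> p i \<bullet> (A *v p j) = (if i = j then 1 else 0)"
      by blast
    define W where "W = span ((\<lambda>i. A *v p i) ` S)"
    have "dim W \<le> card ((\<lambda>i. A *v p i) ` S)"
      unfolding W_def by (simp add: dim_le_card' insert.hyps(1))
    also have "\<dots> \<le> card S" using insert.hyps(1) by (rule card_image_le)
    also have "\<dots> < CARD('n)" using insert.hyps by (metis UNIV_I finite psubset_card_mono psubsetI subset_UNIV)
    finally have "dim W < DIM(real^'n)" by simp
    then obtain x where x: "x \<noteq> 0" "\<And>y. y \<in> span W \<Longrightarrow> orthogonal x y"
      using orthogonal_to_subspace_exists by blast
    have xA: "x \<bullet> (A *v p i) = 0" if "i \<in> S" for i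
      using x(2)[of "A *v p i"] that unfolding W_def orthogonal_def by (simp add: span_base span_span)
    define q where "q = (1 / sqrt (x \<bullet> (A *v x))) *\<^sub>R x"
    have q1: "q \<bullet> (A *v q) = 1"
      using pos[OF x(1)] unfolding q_def by (simp add: matrix_vector_mult_scaleR field_simps)
    have q2: "q \<bullet> (A *v p i) = 0" if "i \<in> S" for i
      using xA[OF that] unfolding q_def by simp
    have q3: "p i \<bullet> (A *v q) = 0" if "i \<in> S" for i
      using q2[OF that] symA by metis
    show ?case
      by (rule exI[of _ "p(k := q)"]) (use insert.hyps(2) p q1 q2 q3 in auto)
  qed simp
  from this[of UNIV] show thesis using that unfolding orthonormal_frame_def by auto
qed

lemma matrix_inv_eqI:
  fixes A :: "real^'n^'n"
  assumes "A ** X = mat 1"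
  shows "matrix_inv A = X"
proof -
  have XA: "X ** A = mat 1" using assms matrix_left_right_inverse by blast
  have "A ** matrix_inv A = mat 1 \<and> matrix_inv A ** A = mat 1"
    unfolding matrix_inv_def by (rule someI[of _ X]) (simp add: assms XA)
  then show ?thesis by (metis XA matrix_mul_assoc matrix_mul_lid matrix_mul_rid)
qed

lemma matrix_inv_mult:
  fixes A :: "real^'n^'n"
  assumes "det A \<noteq> 0"
  shows "A ** matrix_inv A = mat 1" "matrix_inv A ** A = mat 1"
proof -
  obtain X where X: "A ** X = mat 1" using assms invertible_det_nz invertible_def by metis
  show "A ** matrix_inv A = mat 1" using matrix_inv_eqI[OF X] X by simp
  then show "matrix_inv A ** A = mat 1" using matrix_left_right_inverse by blast
qed

lemma matrix_inv_sum:
  fixes A :: "real^'n^'n"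
  assumes "det A \<noteq> 0"
  shows "(\<Sum>b\<in>UNIV. A$a$b * matrix_inv A$b$c) = (if a = c then 1 else 0)"
    and "(\<Sum>b\<in>UNIV. matrix_inv A$a$b * A$b$c) = (if a = c then 1 else 0)"
  using matrix_inv_mult[OF assms] unfolding matrix_matrix_mult_def mat_def vec_eq_iff by simp_all

context
  fixes A :: "real^'n^'n" and p :: "'n \<Rightarrow> real^'n"
  assumes fr: "orthonormal_frame A p" and sym: "transpose A = A"
begin

lemma orthonormal_frame_matrix_inv:
  "matrix_inv A $ a $ b = (\<Sum>k\<in>UNIV. p k $ a * p k $ b)" "det A \<noteq> 0"
  "(\<Sum>k\<in>UNIV. (p k \<bullet> (A *v x)) *\<^sub>R p k) = x"
proof -
  define P :: "real^'n^'n" where "P = (\<chi> i j. p j $ i)"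
  have "transpose P ** (A ** P) = mat 1"
    using fr unfolding orthonormal_frame_def vec_eq_iff inner_vec_def
    by (simp add: P_def transpose_def matrix_matrix_mult_def mat_def matrix_vector_mult_def)
  then have 1: "A ** (P ** transpose P) = mat 1"
    using matrix_left_right_inverse matrix_mul_assoc by metis
  show "matrix_inv A $ a $ b = (\<Sum>k\<in>UNIV. p k $ a * p k $ b)"
    unfolding matrix_inv_eqI[OF 1] by (simp add: P_def transpose_def matrix_matrix_mult_def)
  show "det A \<noteq> 0" using 1 invertible_det_nz[of A] invertible_right_inverse by blast
  have "(P ** transpose P) ** A = mat 1" using 1 matrix_left_right_inverse by blast
  then have "(P ** transpose P) *v (A *v x) = x" by (simp add: matrix_vector_mul_assoc)
  then have "P *v (transpose P *v (A *v x)) = x" by (simp only: matrix_vector_mul_assoc[symmetric])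
  moreover have "P *v (transpose P *v y) = (\<Sum>k\<in>UNIV. (p k \<bullet> y) *\<^sub>R p k)" for y
    by (simp add: P_def transpose_def matrix_vector_mult_def vec_eq_iff inner_vec_def mult.commute)
  ultimately show "(\<Sum>k\<in>UNIV. (p k \<bullet> (A *v x)) *\<^sub>R p k) = x" by simp
qed

text \<open>
  A contraction with the inverse matrix is a sum of pure second-order terms along the frame. This
  reduces the maximum principle to second derivatives along lines.
\<close>

lemma orthonormal_frame_quadratic:
  "(\<Sum>a\<in>UNIV. \<Sum>b\<in>UNIV. matrix_inv A$a$b * M a b) = (\<Sum>k\<in>UNIV. \<Sum>a\<in>UNIV. \<Sum>b\<in>UNIV. p k$a * p k$b * M a b)"
proof -
  have "(\<Sum>a\<in>UNIV. \<Sum>b\<in>UNIV. matrix_inv A$a$b * M a b)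
     = (\<Sum>a\<in>UNIV. \<Sum>b\<in>UNIV. \<Sum>k\<in>UNIV. p k$a * p k$b * M a b)"
    by (simp add: orthonormal_frame_matrix_inv(1) sum_distrib_right)
  also have "\<dots> = (\<Sum>a\<in>UNIV. \<Sum>k\<in>UNIV. \<Sum>b\<in>UNIV. p k$a * p k$b * M a b)"
    by (subst sum.swap) (rule refl)
  also have "\<dots> = (\<Sum>k\<in>UNIV. \<Sum>a\<in>UNIV. \<Sum>b\<in>UNIV. p k$a * p k$b * M a b)"
    by (rule sum.swap)
  finally show ?thesis .
qed

lemma matrix_inv_quadratic_squares:
  "(\<Sum>a\<in>UNIV. \<Sum>b\<in>UNIV. matrix_inv A$a$b * (x a * x b)) = (\<Sum>k\<in>UNIV. (p k \<bullet> (\<chi> a. x a))\<^sup>2)"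
  unfolding orthonormal_frame_quadratic
  by (rule sum.cong) (simp_all add: inner_vec_def power2_eq_square sum_product mult_ac)

lemma orthonormal_frame_norm_le:
  assumes "0 < lam" "\<And>v. lam * (v \<bullet> v) \<le> v \<bullet> (A *v v)"
  shows "p k \<bullet> p k \<le> 1 / lam"
  using assms(2)[of "p k"] fr assms(1) unfolding orthonormal_frame_def by (simp add: field_simps)

lemma matrix_inv_entry_le:
  assumes "0 < lam" "\<And>v. lam * (v \<bullet> v) \<le> v \<bullet> (A *v v)"
  shows "\<bar>matrix_inv A$a$b\<bar> \<le> real CARD('n) / lam"
proof -
  have "\<bar>p k $ a * p k $ b\<bar> \<le> 1 / lam" for k
  proof -
    have "\<bar>p k $ a * p k $ b\<bar> \<le> norm (p k) * norm (p k)"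
      unfolding abs_mult by (intro mult_mono component_le_norm_cart) auto
    also have "\<dots> = p k \<bullet> p k" by (simp add: dot_square_norm power2_eq_square)
    finally show ?thesis using orthonormal_frame_norm_le[OF assms, of k] by simp
  qed
  then have "\<bar>\<Sum>k\<in>UNIV. p k $ a * p k $ b\<bar> \<le> (\<Sum>k\<in>(UNIV::'n set). 1 / lam)"
    by (intro order_trans[OF sum_abs] sum_mono)
  then show ?thesis by (simp add: orthonormal_frame_matrix_inv(1))
qed

text \<open>
  With \<open>c\<close> the coefficients of a vector \<open>X\<close> in the dual frame and \<open>d\<close> those of \<open>A *v X\<close>, one has
  \<open>|X|\<^sup>2 = \<Sum> d c\<close>, and \<open>\<Sum> d\<^sup>2\<close> is the quadratic form of \<open>A\<close> at \<open>X\<close>; the bound is then the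
  Cauchy-Schwarz inequality.
\<close>

lemma matrix_inv_quadratic_ge:
  assumes "0 < Lam" "\<And>v. v \<bullet> (A *v v) \<le> Lam * (v \<bullet> v)"
  shows "(\<Sum>a\<in>UNIV. (x a)\<^sup>2) / Lam \<le> (\<Sum>a\<in>UNIV. \<Sum>b\<in>UNIV. matrix_inv A$a$b * (x a * x b))"
proof -
  define X :: "real^'n" where "X = (\<chi> a. x a)"
  define c where "c k = p k \<bullet> X" for k
  define d where "d k = p k \<bullet> (A *v X)" for k
  have X: "X = (\<Sum>k\<in>UNIV. d k *\<^sub>R p k)"
    unfolding d_def by (rule orthonormal_frame_matrix_inv(3)[symmetric])
  have dd: "(\<Sum>k\<in>UNIV. (d k)\<^sup>2) = X \<bullet> (A *v X)"
    by (subst X) (simp add: inner_sum_left power2_eq_square flip: d_def)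
  have XX: "X \<bullet> X = (\<Sum>k\<in>UNIV. d k * c k)"
    by (subst X) (simp add: inner_sum_left c_def)
  have sq: "(X \<bullet> X)\<^sup>2 \<le> (\<Sum>k\<in>UNIV. (c k)\<^sup>2) * (Lam * (X \<bullet> X))"
  proof -
    have "(X \<bullet> X)\<^sup>2 \<le> (\<Sum>k\<in>UNIV. (d k)\<^sup>2) * (\<Sum>k\<in>UNIV. (c k)\<^sup>2)"
      unfolding XX by (rule Cauchy_Schwarz_ineq_sum)
    also have "\<dots> \<le> (Lam * (X \<bullet> X)) * (\<Sum>k\<in>UNIV. (c k)\<^sup>2)"
      unfolding dd by (intro mult_right_mono assms sum_nonneg) auto
    finally show ?thesis by (simp add: mult_ac)
  qed
  have "X \<bullet> X / Lam \<le> (\<Sum>k\<in>UNIV. (c k)\<^sup>2)"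
  proof (cases "X \<bullet> X = 0")
    case False
    then have "0 < X \<bullet> X" by simp
    then show ?thesis using sq assms(1) by (simp add: power2_eq_square field_simps)
  qed (simp add: sum_nonneg)
  moreover have "X \<bullet> X = (\<Sum>a\<in>UNIV. (x a)\<^sup>2)" by (simp add: X_def inner_vec_def power2_eq_square)
  ultimately show ?thesis unfolding matrix_inv_quadratic_squares c_def X_def by simp
qed

end

lemma matrix_inv_symmetric:
  fixes A :: "real^'n^'n"
  assumes "transpose A = A" "det A \<noteq> 0"
  shows "matrix_inv A $ a $ b = matrix_inv A $ b $ a"
proof -
  have "transpose (matrix_inv A ** A) = mat 1" by (simp add: matrix_inv_mult[OF assms(2)] transpose_mat)
  then have "A ** transpose (matrix_inv A) = mat 1" by (simp add: matrix_transpose_mul assms(1))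
  then have "matrix_inv A = transpose (matrix_inv A)" by (rule matrix_inv_eqI)
  then have "matrix_inv A $ a $ b = transpose (matrix_inv A) $ a $ b"
    by (rule arg_cong[where f = "\<lambda>X. X $ a $ b"])
  also have "\<dots> = matrix_inv A $ b $ a" by (simp add: transpose_def)
  finally show ?thesis .
qed

section \<open>The derivative of the determinant and of the inverse matrix\<close>

lemma has_derivative_det:
  fixes M :: "'a::euclidean_space \<Rightarrow> real^'n^'n"
  assumes "\<And>i j. (\<lambda>y. M y $ i $ j) differentiable (at z)"
  shows "((\<lambda>y. det (M y)) has_derivative (\<lambda>v. \<Sum>q | q permutes UNIV. of_int (sign q) *
    (\<Sum>i\<in>UNIV. dd v (\<lambda>y. M y $ i $ q i) z * (\<Prod>j\<in>UNIV - {i}. M z $ j $ q j)))) (at z)"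
  unfolding det_def
  by (intro has_derivative_sum has_derivative_mult_right has_derivative_prod has_derivative_dd assms)

text \<open>
  At the identity matrix every permutation other than the identity moves two indices, so that its
  product keeps a vanishing off-diagonal factor after differentiation.
\<close>

lemma dd_det_identity:
  fixes M :: "'a::euclidean_space \<Rightarrow> real^'n^'n"
  assumes "\<And>i j. (\<lambda>y. M y $ i $ j) differentiable (at z)" "M z = mat 1"
  shows "dd v (\<lambda>y. det (M y)) z = (\<Sum>i\<in>UNIV. dd v (\<lambda>y. M y $ i $ i) z)"
proof -
  let ?t = "\<lambda>q. of_int (sign q) *
    (\<Sum>i\<in>UNIV. dd v (\<lambda>y. M y $ i $ q i) z * (\<Prod>j\<in>UNIV - {i}. M z $ j $ q j))"
  have 0: "?t q = 0" if q: "q permutes UNIV" "q \<noteq> id" for q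
  proof -
    have pz: "(\<Prod>j\<in>UNIV - {i}. M z $ j $ q j) = 0" for i
    proof -
      have "\<exists>j. j \<noteq> i \<and> q j \<noteq> j"
      proof (rule ccontr)
        assume "\<not> ?thesis"
        then have "\<And>j. j \<noteq> i \<Longrightarrow> q j = j" by blast
        moreover have "q i = i"
          using q(1) calculation by (metis permutes_inj injD)
        ultimately show False using q(2) by (metis eq_id_iff)
      qed
      then obtain j where "j \<noteq> i" "q j \<noteq> j" by blast
      then show ?thesis using assms(2) by (intro prod_zero) (auto simp: mat_def intro!: bexI[of _ j])
    qed
    then show ?thesis by (simp only: pz mult_zero_right sum.neutral_const)
  qed
  have "dd v (\<lambda>y. det (M y)) z = (\<Sum>q | q permutes UNIV. ?t q)"
    by (rule dd_eq[OF has_derivative_det[OF assms(1)]])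
  also have "\<dots> = (\<Sum>q\<in>{id}. ?t q)"
    by (rule sum.mono_neutral_right) (auto simp: permutes_id finite_permutations 0)
  also have "\<dots> = (\<Sum>i\<in>UNIV. dd v (\<lambda>y. M y $ i $ i) z)"
    by (simp add: assms(2) mat_def)
  finally show ?thesis .
qed

text \<open>
  Jacobi's formula follows from the case of the identity matrix, applied to the product with the
  fixed inverse of \<open>M z\<close>.
\<close>

lemma dd_det:
  fixes M :: "'a::euclidean_space \<Rightarrow> real^'n^'n"
  assumes "\<And>i j. (\<lambda>y. M y $ i $ j) differentiable (at z)" "det (M z) \<noteq> 0"
  shows "dd v (\<lambda>y. det (M y)) z = det (M z) *
    (\<Sum>a\<in>UNIV. \<Sum>b\<in>UNIV. matrix_inv (M z) $ a $ b * dd v (\<lambda>y. M y $ b $ a) z)"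
proof -
  let ?B = "matrix_inv (M z)"
  have entry: "(?B ** M y) $ i $ j = (\<Sum>b\<in>UNIV. ?B $ i $ b * M y $ b $ j)" for y i j
    by (simp add: matrix_matrix_mult_def)
  have d: "(\<lambda>y. (?B ** M y) $ i $ j) differentiable (at z)" for i j
    unfolding entry using assms(1) by (intro differentiable_sum differentiable_mult) auto
  have "det (M y) = det (M z) * det (?B ** M y)" for y
  proof -
    have "det (M z) * det ?B = 1" by (metis det_I det_mul matrix_inv_mult(1)[OF assms(2)])
    then show ?thesis by (simp add: det_mul)
  qed
  then have "dd v (\<lambda>y. det (M y)) z = dd v (\<lambda>y. det (M z) * det (?B ** M y)) z"
    by (intro dd_cong[OF open_UNIV UNIV_I])
  also have "\<dots> = det (M z) * dd v (\<lambda>y. det (?B ** M y)) z"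
    by (rule dd_cmult) (use has_derivative_det[OF d] in \<open>auto simp: differentiable_def\<close>)
  also have "dd v (\<lambda>y. det (?B ** M y)) z = (\<Sum>i\<in>UNIV. dd v (\<lambda>y. (?B ** M y) $ i $ i) z)"
    by (rule dd_det_identity[OF d]) (simp add: matrix_inv_mult[OF assms(2)])
  also have "\<dots> = (\<Sum>a\<in>UNIV. \<Sum>b\<in>UNIV. ?B $ a $ b * dd v (\<lambda>y. M y $ b $ a) z)"
    unfolding entry using assms(1) by (simp add: dd_sum dd_mult)
  finally show ?thesis .
qed

text \<open>
  Cramer's rule expresses the entries of the inverse by determinants and so transfers
  differentiability to them; their derivative is then found by differentiating \<open>M ** M\<^sup>-\<^sup>1 = 1\<close>.
\<close>

lemma matrix_inv_cramer:
  fixes A :: "real^'n^'n"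
  assumes "det A \<noteq> 0"
  shows "matrix_inv A $ a $ b = det (\<chi> i j. if j = a then axis b 1 $ i else A $ i $ j) / det A"
proof -
  have "A *v (matrix_inv A *v axis b 1) = axis b 1"
    by (simp add: matrix_vector_mul_assoc matrix_inv_mult[OF assms])
  then have "(matrix_inv A *v axis b 1) $ a = det (\<chi> i j. if j = a then axis b 1 $ i else A $ i $ j) / det A"
    using cramer[OF assms] by auto
  then show ?thesis by (simp add: matrix_vector_mult_basis column_def)
qed

context
  fixes M :: "'a::euclidean_space \<Rightarrow> real^'n^'n" and S z
  assumes S: "open S" "z \<in> S" and nz: "\<And>y. y \<in> S \<Longrightarrow> det (M y) \<noteq> 0"
    and d: "\<And>i j. (\<lambda>y. M y $ i $ j) differentiable (at z)"
begin

lemma differentiable_matrix_inv: "(\<lambda>y. matrix_inv (M y) $ a $ b) differentiable (at z)"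
proof (rule differentiable_cong_open[OF S])
  let ?N = "\<lambda>y. (\<chi> i j. if j = a then axis b 1 $ i else M y $ i $ j) :: real^'n^'n"
  show "det (?N y) / det (M y) = matrix_inv (M y) $ a $ b" if "y \<in> S" for y
    by (simp add: matrix_inv_cramer[OF nz[OF that]])
  have "(\<lambda>y. ?N y $ i $ j) differentiable (at z)" for i j
    using d by (cases "j = a") auto
  then have "(\<lambda>y. det (?N y)) differentiable (at z)"
    using has_derivative_det[of ?N z] unfolding differentiable_def by blast
  moreover have "(\<lambda>y. det (M y)) differentiable (at z)"
    using has_derivative_det[of M z] d unfolding differentiable_def by blast
  ultimately show "(\<lambda>y. det (?N y) / det (M y)) differentiable (at z)"
    using nz[OF S(2)] by (intro differentiable_divide)
qed

lemma dd_matrix_inv: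
  "dd v (\<lambda>y. matrix_inv (M y) $ a $ b) z =
   - (\<Sum>s\<in>UNIV. \<Sum>t\<in>UNIV. matrix_inv (M z) $ a $ s * dd v (\<lambda>y. M y $ s $ t) z * matrix_inv (M z) $ t $ b)"
proof -
  let ?B = "\<lambda>y. matrix_inv (M y)"
  have e: "(\<Sum>t\<in>UNIV. M z $ s $ t * dd v (\<lambda>y. ?B y $ t $ b) z)
      = - (\<Sum>t\<in>UNIV. dd v (\<lambda>y. M y $ s $ t) z * ?B z $ t $ b)" for s
  proof -
    have "dd v (\<lambda>y. \<Sum>t\<in>UNIV. M y $ s $ t * ?B y $ t $ b) z = dd v (\<lambda>y. if s = b then 1 else 0) z"
      by (rule dd_cong[OF S]) (simp add: matrix_inv_sum[OF nz])
    moreover have "dd v (\<lambda>y. \<Sum>t\<in>UNIV. M y $ s $ t * ?B y $ t $ b) z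
      = (\<Sum>t\<in>UNIV. M z $ s $ t * dd v (\<lambda>y. ?B y $ t $ b) z + dd v (\<lambda>y. M y $ s $ t) z * ?B z $ t $ b)"
      using d differentiable_matrix_inv by (simp add: dd_sum dd_mult)
    ultimately show ?thesis by (simp add: sum.distrib)
  qed
  have "dd v (\<lambda>y. ?B y $ a $ b) z = (\<Sum>t\<in>UNIV. (if a = t then 1 else 0) * dd v (\<lambda>y. ?B y $ t $ b) z)"
    by (simp add: delta_mult)
  also have "\<dots> = (\<Sum>t\<in>UNIV. (\<Sum>s\<in>UNIV. ?B z $ a $ s * M z $ s $ t) * dd v (\<lambda>y. ?B y $ t $ b) z)"
    by (simp add: matrix_inv_sum[OF nz[OF S(2)]])
  also have "\<dots> = (\<Sum>s\<in>UNIV. ?B z $ a $ s * (\<Sum>t\<in>UNIV. M z $ s $ t * dd v (\<lambda>y. ?B y $ t $ b) z))"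
    unfolding sum_distrib_right sum_distrib_left by (subst sum.swap) (simp add: mult_ac)
  also have "\<dots> = - (\<Sum>s\<in>UNIV. \<Sum>t\<in>UNIV. ?B z $ a $ s * dd v (\<lambda>y. M y $ s $ t) z * ?B z $ t $ b)"
    unfolding e by (simp add: sum_distrib_left sum_negf mult_ac)
  finally show ?thesis .
qed

end

section \<open>The flow on space-time\<close>

type_synonym 'n spacetime = "(real^'n) \<times> real"
type_synonym 'n field = "'n spacetime \<Rightarrow> real"
type_synonym 'n functional = "'n field \<Rightarrow> 'n field"

abbreviation Om :: "'n::finite spacetime set" where "Om \<equiv> UNIV \<times> {0<..}"

lemma open_Om: "open Om"
  by (intro open_Times) auto

definition dX :: "'n::finite \<Rightarrow> 'n field \<Rightarrow> 'n field" where
  "dX i = dd (axis i 1, 0)"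

definition dT :: "'n::finite field \<Rightarrow> 'n field" where
  "dT = dd (0, 1)"

primrec DJ :: "'n::finite list \<Rightarrow> 'n field \<Rightarrow> 'n field" where
  "DJ [] U = U"
| "DJ (i # js) U = dX i (DJ js U)"

definition hess :: "'n::finite field \<Rightarrow> 'n spacetime \<Rightarrow> real^'n^'n" where
  "hess U z = (\<chi> i j. DJ [i, j] U z)"

definition ihess :: "'n::finite field \<Rightarrow> 'n \<Rightarrow> 'n \<Rightarrow> 'n field" where
  "ihess U a b z = matrix_inv (hess U z) $ a $ b"

text \<open>
  The equation is multiplied by \<open>n\<close> and required up to a constant. A linear change of the space
  variable multiplies the determinant of the Hessian by a constant factor and so adds a constant to
  its logarithm.
\<close>

definition MA_flow :: "'n::finite field \<Rightarrow> bool" where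
  "MA_flow U \<longleftrightarrow> smooth_fun_on U Om \<and>
     (\<exists>c. \<forall>z\<in>Om. real CARD('n) * dT U z = ln (det (hess U z)) + c) \<and>
     (\<forall>z\<in>Om. 0 < det (hess U z) \<and> (\<forall>v. v \<noteq> 0 \<longrightarrow> 0 < v \<bullet> (hess U z *v v)))"

definition pinched :: "real \<Rightarrow> real \<Rightarrow> 'n::finite field \<Rightarrow> bool" where
  "pinched lam Lam U \<longleftrightarrow> (\<forall>z\<in>Om. \<forall>v. lam * (v \<bullet> v) \<le> v \<bullet> (hess U z *v v) \<and> v \<bullet> (hess U z *v v) \<le> Lam * (v \<bullet> v))"

abbreviation smooth :: "'n::finite field \<Rightarrow> bool" where
  "smooth f \<equiv> smooth_fun_on f Om"

lemma smooth_dX: "smooth f \<Longrightarrow> smooth (dX i f)"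
  and smooth_dT: "smooth f \<Longrightarrow> smooth (dT f)"
  unfolding dX_def dT_def by (auto intro: smooth_fun_on_dd)

lemma smooth_DJ: "smooth U \<Longrightarrow> smooth (DJ js U)"
  by (induction js) (auto intro: smooth_dX)

lemmas smooth_differentiable = smooth_fun_on_differentiable[of _ Om]

lemma dX_commute: "smooth f \<Longrightarrow> z \<in> Om \<Longrightarrow> dX i (dX j f) z = dX j (dX i f) z"
  unfolding dX_def by (rule dd_commute[OF open_Om])

lemma dX_dT_commute: "smooth f \<Longrightarrow> z \<in> Om \<Longrightarrow> dX i (dT f) z = dT (dX i f) z"
  unfolding dX_def dT_def by (rule dd_commute[OF open_Om])

lemma dX_cong: "z \<in> Om \<Longrightarrow> (\<And>y. y \<in> Om \<Longrightarrow> f y = g y) \<Longrightarrow> dX i f z = dX i g z"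
  unfolding dX_def by (rule dd_cong[OF open_Om])

lemma dT_cong: "z \<in> Om \<Longrightarrow> (\<And>y. y \<in> Om \<Longrightarrow> f y = g y) \<Longrightarrow> dT f z = dT g z"
  unfolding dT_def by (rule dd_cong[OF open_Om])

lemma dd_space_direction:
  fixes f :: "'n::finite field"
  assumes "f differentiable (at z)"
  shows "dd (v, 0) f z = (\<Sum>a\<in>UNIV. v$a * dX a f z)"
proof -
  have "(v, 0::real) = (\<Sum>a\<in>UNIV. (v$a) *\<^sub>R (axis a 1, 0))"
  proof (rule prod_eqI)
    show "fst (v, 0::real) = fst (\<Sum>a\<in>UNIV. (v$a) *\<^sub>R (axis a 1 :: real^'n, 0::real))"
      by (simp add: fst_sum vec_eq_iff axis_def if_distrib cong: if_cong)
    show "snd (v, 0::real) = snd (\<Sum>a\<in>UNIV. (v$a) *\<^sub>R (axis a 1 :: real^'n, 0::real))"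
      by (simp add: snd_sum)
  qed
  then have "dd (v, 0) f z = dd (\<Sum>a\<in>UNIV. (v$a) *\<^sub>R (axis a 1, 0)) f z" by simp
  also have "\<dots> = (\<Sum>a\<in>UNIV. v$a * dX a f z)"
    by (simp add: linear_sum[OF dd_linear[OF assms]] linear_cmul[OF dd_linear[OF assms]] dX_def
        del: scaleR_Pair)
  finally show ?thesis .
qed

lemma dd_dd_space_direction:
  assumes "smooth f" "z \<in> Om"
  shows "dd (v, 0) (dd (w, 0) f) z = (\<Sum>a\<in>UNIV. \<Sum>b\<in>UNIV. v$a * w$b * dX a (dX b f) z)"
proof -
  have 1: "dd (v, 0) (dd (w, 0) f) z = (\<Sum>a\<in>UNIV. v$a * dX a (dd (w, 0) f) z)"
    by (rule dd_space_direction[OF smooth_differentiable[OF smooth_fun_on_dd[OF assms(1)] assms(2)]])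
  have 2: "dX a (dd (w, 0) f) z = (\<Sum>b\<in>UNIV. w$b * dX a (dX b f) z)" for a
  proof -
    have "dX a (dd (w, 0) f) z = dX a (\<lambda>y. \<Sum>b\<in>UNIV. w$b * dX b f y) z"
      by (rule dX_cong[OF assms(2)]) (rule dd_space_direction[OF smooth_differentiable[OF assms(1)]])
    also have "\<dots> = (\<Sum>b\<in>UNIV. w$b * dX a (dX b f) z)"
      unfolding dX_def[of a]
      by (subst dd_sum) (auto intro!: sum.cong dd_cmult differentiable_mult smooth_differentiable assms smooth_dX)
    finally show ?thesis .
  qed
  show ?thesis unfolding 1 2 by (simp add: sum_distrib_left mult_ac)
qed

lemma hess_symmetric: "smooth U \<Longrightarrow> z \<in> Om \<Longrightarrow> transpose (hess U z) = hess U z"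
  by (simp add: hess_def transpose_def vec_eq_iff dX_commute)

lemma MA_flowD:
  assumes "MA_flow U" "z \<in> Om"
  shows "smooth U" "det (hess U z) \<noteq> 0" "0 < det (hess U z)" "transpose (hess U z) = hess U z"
    "v \<noteq> 0 \<Longrightarrow> 0 < v \<bullet> (hess U z *v v)"
proof -
  show s: "smooth U" and p: "0 < det (hess U z)" and "v \<noteq> 0 \<Longrightarrow> 0 < v \<bullet> (hess U z *v v)"
    using assms unfolding MA_flow_def by blast+
  show "det (hess U z) \<noteq> 0" using p by simp
  show "transpose (hess U z) = hess U z" by (rule hess_symmetric[OF s assms(2)])
qed

lemma MA_flow_frame:
  assumes "MA_flow U" "z \<in> Om"
  obtains p where "orthonormal_frame (hess U z) p"
  using orthonormal_frame_exists MA_flowD[OF assms] by metis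

lemma hess_entry_differentiable:
  "smooth U \<Longrightarrow> z \<in> Om \<Longrightarrow> (\<lambda>y. hess U y $ i $ j) differentiable (at z)"
  unfolding hess_def using smooth_differentiable[OF smooth_DJ[of U "[i, j]"]] by simp

lemma ihess_symmetric: "MA_flow U \<Longrightarrow> z \<in> Om \<Longrightarrow> ihess U a b z = ihess U b a z"
  unfolding ihess_def by (intro matrix_inv_symmetric MA_flowD)

lemma dd_ihess:
  assumes "MA_flow U" "z \<in> Om"
  shows "(ihess U a b) differentiable (at z)"
    "dd v (ihess U a b) z = - (\<Sum>s\<in>UNIV. \<Sum>t\<in>UNIV. ihess U a s z * dd v (DJ [s, t] U) z * ihess U t b z)"
proof -
  have e: "(\<lambda>y. hess U y $ s $ t) = DJ [s, t] U" for s t by (simp add: hess_def fun_eq_iff)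
  have nz: "\<And>y. y \<in> Om \<Longrightarrow> det (hess U y) \<noteq> 0" using MA_flowD[OF assms(1)] by blast
  have d: "\<And>i j. (\<lambda>y. hess U y $ i $ j) differentiable (at z)"
    by (intro hess_entry_differentiable MA_flowD(1)[OF assms] assms)
  show "(ihess U a b) differentiable (at z)"
    using differentiable_matrix_inv[where M = "hess U", OF open_Om assms(2) nz d]
    unfolding ihess_def[abs_def] by blast
  show "dd v (ihess U a b) z = - (\<Sum>s\<in>UNIV. \<Sum>t\<in>UNIV. ihess U a s z * dd v (DJ [s, t] U) z * ihess U t b z)"
    using dd_matrix_inv[where M = "hess U", OF open_Om assms(2) nz d]
    unfolding ihess_def[abs_def] e by blast
qed

lemma C_k_on_sum:
  fixes f :: "'i \<Rightarrow> 'a::euclidean_space \<Rightarrow> real"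
  assumes "open S" "\<And>i. i \<in> I \<Longrightarrow> C_k_on k (f i) S"
  shows "C_k_on k (\<lambda>y. \<Sum>i\<in>I. f i y) S"
proof (cases "finite I")
  case True
  then show ?thesis using assms(2)
    by (induction I rule: finite_induct) (auto intro: C_k_on_const C_k_on_add[OF assms(1)])
qed (simp add: C_k_on_const)

text \<open>
  The derivative of an entry of the inverse is a polynomial in such entries and in third derivatives
  of \<open>U\<close>, so that regularity can be bootstrapped.
\<close>

lemma smooth_ihess:
  assumes "MA_flow U"
  shows "smooth (ihess U a b)"
proof -
  have "C_k_on k (ihess U a b) Om" for k
  proof (induction k arbitrary: a b)
    case 0
    have "continuous_on Om (ihess U a b)"
      by (intro continuous_at_imp_continuous_on ballI differentiable_imp_continuous_within dd_ihess[OF assms])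
    then show ?case by simp
  next
    case (Suc k)
    show ?case
    proof (rule C_k_on_SucI)
      show "ihess U a b differentiable (at x)" if "x \<in> Om" for x by (rule dd_ihess[OF assms that])
      fix v
      have s: "C_k_on k (dd v (DJ [s, t] U)) Om" for s t
        using smooth_fun_on_dd[OF smooth_DJ[of U "[s, t]"], of v] MA_flowD(1)[OF assms, of "(0,1)"]
        unfolding smooth_fun_on_def by auto
      have "C_k_on k (\<lambda>z. (-1) * (\<Sum>s\<in>UNIV. \<Sum>t\<in>UNIV. ihess U a s z * dd v (DJ [s, t] U) z * ihess U t b z)) Om"
        by (intro C_k_on_mult C_k_on_sum C_k_on_const open_Om Suc.IH s)
      then show "C_k_on k (dd v (ihess U a b)) Om"
        by (rule C_k_on_cong[OF open_Om, rotated]) (simp add: dd_ihess[OF assms])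
    qed
  qed
  then show ?thesis unfolding smooth_fun_on_def by blast
qed

section \<open>The linearised operator\<close>

text \<open>
  \<open>g\<^sup>a\<^sup>b \<partial>\<^sub>a f \<partial>\<^sub>b h\<close>, the inner product of the gradients in the metric \<open>g\<close>.
\<close>

definition grad_inner :: "'n::finite field \<Rightarrow> 'n field \<Rightarrow> 'n field \<Rightarrow> 'n field" where
  "grad_inner U f g z = (\<Sum>a\<in>UNIV. \<Sum>b\<in>UNIV. ihess U a b z * (dX a f z * dX b g z))"

text \<open>
  The operator called \<open>L\<close> in the introduction.
\<close>

definition heat :: "'n::finite field \<Rightarrow> 'n field \<Rightarrow> 'n field" where
  "heat U f z = real CARD('n) * dT f z - (\<Sum>a\<in>UNIV. \<Sum>b\<in>UNIV. ihess U a b z * dX a (dX b f) z)"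

lemma heat_const [simp]: "heat U (\<lambda>z. c) z = 0"
proof -
  have "dX b (\<lambda>z. c) = (\<lambda>z. 0)" for b :: 'a and c :: real by (simp add: dX_def fun_eq_iff)
  then show ?thesis by (simp add: heat_def dT_def)
qed

lemma heat_add:
  assumes "smooth f" "smooth g" "z \<in> Om"
  shows "heat U (\<lambda>y. f y + g y) z = heat U f z + heat U g z"
proof -
  note d = smooth_differentiable[OF assms(1)] smooth_differentiable[OF assms(2)]
    smooth_differentiable[OF smooth_dX[OF assms(1)]] smooth_differentiable[OF smooth_dX[OF assms(2)]]
  have "dX a (dX b (\<lambda>y. f y + g y)) z = dX a (dX b f) z + dX a (dX b g) z" for a b
  proof -
    have "dX a (dX b (\<lambda>y. f y + g y)) z = dX a (\<lambda>y. dX b f y + dX b g y) z"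
      by (rule dX_cong[OF assms(3)]) (simp add: dX_def dd_add d)
    also have "\<dots> = dX a (dX b f) z + dX a (dX b g) z"
      unfolding dX_def[of a] using d assms(3) by (subst dd_add) auto
    finally show ?thesis .
  qed
  then show ?thesis by (simp add: heat_def dT_def dd_add d assms(3) algebra_simps sum.distrib)
qed

lemma heat_mult:
  assumes "MA_flow U" "smooth f" "smooth g" "z \<in> Om"
  shows "heat U (\<lambda>y. f y * g y) z = f z * heat U g z + g z * heat U f z - 2 * grad_inner U f g z"
proof -
  note d = smooth_differentiable[OF assms(2)] smooth_differentiable[OF assms(3)]
    smooth_differentiable[OF smooth_dX[OF assms(2)]] smooth_differentiable[OF smooth_dX[OF assms(3)]]
  have e: "dX a (dX b (\<lambda>y. f y * g y)) z =
      f z * dX a (dX b g) z + g z * dX a (dX b f) z + dX a f z * dX b g z + dX b f z * dX a g z" for a b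
  proof -
    have "dX a (dX b (\<lambda>y. f y * g y)) z = dX a (\<lambda>y. f y * dX b g y + dX b f y * g y) z"
      by (rule dX_cong[OF assms(4)]) (simp add: dX_def dd_mult d)
    also have "\<dots> = f z * dX a (dX b g) z + g z * dX a (dX b f) z + dX a f z * dX b g z + dX b f z * dX a g z"
      unfolding dX_def[of a] using d assms(4) by (subst dd_add) (auto simp: dd_mult)
    finally show ?thesis .
  qed
  have sw: "(\<Sum>a\<in>UNIV. \<Sum>b\<in>UNIV. ihess U a b z * (dX b f z * dX a g z)) = grad_inner U f g z"
    unfolding grad_inner_def by (subst sum.swap) (simp add: ihess_symmetric[OF assms(1,4)])
  have "(\<Sum>a\<in>UNIV. \<Sum>b\<in>UNIV. ihess U a b z * dX a (dX b (\<lambda>y. f y * g y)) z)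
    = f z * (\<Sum>a\<in>UNIV. \<Sum>b\<in>UNIV. ihess U a b z * dX a (dX b g) z)
    + g z * (\<Sum>a\<in>UNIV. \<Sum>b\<in>UNIV. ihess U a b z * dX a (dX b f) z)
    + (\<Sum>a\<in>UNIV. \<Sum>b\<in>UNIV. ihess U a b z * (dX a f z * dX b g z))
    + (\<Sum>a\<in>UNIV. \<Sum>b\<in>UNIV. ihess U a b z * (dX b f z * dX a g z))"
    unfolding e sum_distrib_left sum.distrib[symmetric]
    by (intro sum.cong refl) (simp add: algebra_simps)
  then have "(\<Sum>a\<in>UNIV. \<Sum>b\<in>UNIV. ihess U a b z * dX a (dX b (\<lambda>y. f y * g y)) z)
    = f z * (\<Sum>a\<in>UNIV. \<Sum>b\<in>UNIV. ihess U a b z * dX a (dX b g) z)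
    + g z * (\<Sum>a\<in>UNIV. \<Sum>b\<in>UNIV. ihess U a b z * dX a (dX b f) z) + 2 * grad_inner U f g z"
    unfolding sw grad_inner_def[symmetric] by simp
  moreover have "dT (\<lambda>y. f y * g y) z = f z * dT g z + g z * dT f z"
    by (simp add: dT_def dd_mult d assms(4))
  ultimately show ?thesis unfolding heat_def by (simp add: algebra_simps)
qed

lemma heat_sum:
  assumes "\<And>i. i \<in> I \<Longrightarrow> smooth (f i)" "z \<in> Om" "finite I"
  shows "heat U (\<lambda>y. \<Sum>i\<in>I. f i y) z = (\<Sum>i\<in>I. heat U (f i) z)"
  using assms(3,1)
proof (induction I rule: finite_induct)
  case (insert i I)
  have "heat U (\<lambda>y. f i y + (\<Sum>j\<in>I. f j y)) z = heat U (f i) z + heat U (\<lambda>y. \<Sum>j\<in>I. f j y) z"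
    by (rule heat_add) (auto intro: insert.prems smooth_fun_on_sum[OF open_Om] assms(2))
  then show ?case using insert by simp
qed simp

lemma heat_frame:
  fixes U f :: "'n::finite field"
  assumes "MA_flow U" "smooth f" "z \<in> Om" "orthonormal_frame (hess U z) p"
  shows "heat U f z = real CARD('n) * dT f z - (\<Sum>k\<in>UNIV. dd (p k, 0) (dd (p k, 0) f) z)"
  unfolding heat_def ihess_def dd_dd_space_direction[OF assms(2,3)]
  by (simp add: orthonormal_frame_quadratic[OF assms(4) MA_flowD(4)[OF assms(1,3)]])

section \<open>A blow-up barrier and the interior bound\<close>

lemma second_derivative_nonpos_at_max:
  fixes f f' :: "real \<Rightarrow> real"
  assumes "0 < e" and f: "\<And>s. \<bar>s\<bar> < e \<Longrightarrow> (f has_real_derivative f' s) (at s)"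
    and f': "(f' has_real_derivative l) (at 0)" and max: "\<And>s. \<bar>s\<bar> < e \<Longrightarrow> f s \<le> f 0"
  shows "l \<le> 0"
proof (rule ccontr)
  assume "\<not> l \<le> 0"
  then obtain d where d: "0 < d" "\<And>h. 0 < h \<Longrightarrow> h < d \<Longrightarrow> f' 0 < f' (0 + h)"
    using DERIV_pos_inc_right[OF f'] by auto
  have f0: "f' 0 = 0"
    by (rule DERIV_local_max[OF f assms(1)]) (use assms(1) max in auto)
  define h where "h = min d e / 2"
  have h: "0 < h" "h < d" "h < e" using d(1) assms(1) by (auto simp: h_def)
  obtain x where x: "0 < x" "x < h" "f h - f 0 = (h - 0) * f' x"
    using MVT2[OF h(1), of f f'] f h by force
  have "0 < f' x" using d(2)[of x] x h f0 by simp
  then have "0 < f h - f 0" using x(3) h(1) by simp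
  moreover have "f h \<le> f 0" using max[of h] h by simp
  ultimately show False by simp
qed

lemma DERIV_quotient_power2:
  fixes h :: "real \<Rightarrow> real"
  assumes "(h has_real_derivative h') (at s)" "h s \<noteq> 0"
  shows "((\<lambda>s. K / (h s)\<^sup>2) has_real_derivative - 2 * K * h' / h s ^ 3) (at s)"
  by (rule DERIV_cong[OF DERIV_quotient[OF DERIV_const DERIV_power[OF assms(1)]]])
     (use assms(2) in \<open>simp_all add: divide_simps power2_eq_square power3_eq_cube\<close>)

lemma DERIV_quotient_power3:
  fixes h n :: "real \<Rightarrow> real"
  assumes "(h has_real_derivative h') (at s)" "(n has_real_derivative n') (at s)" "h s \<noteq> 0"
  shows "((\<lambda>s. n s / h s ^ 3) has_real_derivative (n' * h s - 3 * n s * h') / h s ^ 4) (at s)"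
  by (rule DERIV_cong[OF DERIV_quotient[OF assms(2) DERIV_power[OF assms(1)]]])
     (use assms(3) in \<open>simp_all add: divide_simps power2_eq_square power3_eq_cube power4_eq_xxxx algebra_simps\<close>)

text \<open>
  Along a line \<open>x + s p\<close> the distance \<open>R\<^sup>2 - |x - x\<^sub>0|\<^sup>2\<close> is a quadratic polynomial in \<open>s\<close>, with
  \<open>a = (x - x\<^sub>0) \<bullet> p\<close> and \<open>e = |p|\<^sup>2\<close>. The barrier is \<open>K\<close> divided by its square.
\<close>

lemma DERIV_barrier_profile:
  fixes q a e K s :: real
  assumes "q - 2 * a * s - e * s\<^sup>2 \<noteq> 0"
  shows "((\<lambda>s. K / (q - 2 * a * s - e * s\<^sup>2)\<^sup>2) has_real_derivative
     K * (4 * a + 4 * e * s) / (q - 2 * a * s - e * s\<^sup>2) ^ 3) (at s)"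
proof -
  have "((\<lambda>s. q - 2 * a * s - e * s\<^sup>2) has_real_derivative - 2 * a - 2 * e * s) (at s)"
    by (auto intro!: derivative_eq_intros)
  from DERIV_quotient_power2[OF this assms, of K] show ?thesis by (simp add: algebra_simps)
qed

lemma DERIV2_barrier_profile:
  fixes q a e K :: real
  assumes "q \<noteq> 0"
  shows "((\<lambda>s. K * (4 * a + 4 * e * s) / (q - 2 * a * s - e * s\<^sup>2) ^ 3) has_real_derivative
     K * (24 * a\<^sup>2 + 4 * e * q) / q ^ 4) (at 0)"
proof -
  have h: "((\<lambda>s. q - 2 * a * s - e * s\<^sup>2) has_real_derivative - 2 * a) (at 0)"
    by (auto intro!: derivative_eq_intros)
  have n: "((\<lambda>s. K * (4 * a + 4 * e * s)) has_real_derivative K * (4 * e)) (at 0)"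
    by (auto intro!: derivative_eq_intros)
  from DERIV_quotient_power3[OF h n] assms show ?thesis by (simp add: algebra_simps power2_eq_square)
qed

text \<open>
  At a spatial maximum of \<open>G\<close> minus the barrier, the second derivative of \<open>G\<close> along a line is at most that
  of the barrier. The power 4 in the denominator is twice the power 2 of the barrier, so that the right
  hand side is comparable with the square of the barrier.
\<close>

lemma frame_second_derivative_le_barrier:
  fixes G :: "'n::finite field" and x x0 p :: "real^'n" and R :: real
  defines "q \<equiv> \<lambda>x. R\<^sup>2 - (x - x0) \<bullet> (x - x0)"
  assumes G: "smooth G" and "0 < t" "0 \<le> K" "0 < rho" "rho < R" "norm (x - x0) < rho"
    and max: "\<And>y. norm (y - x0) < rho \<Longrightarrow> G (y, t) - K / (q y)\<^sup>2 \<le> G (x, t) - K / (q x)\<^sup>2"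
  shows "dd (p, 0) (dd (p, 0) G) (x, t) \<le> 28 * K * R\<^sup>2 * (p \<bullet> p) / q x ^ 4"
proof -
  define a where "a = (x - x0) \<bullet> p"
  define e where "e = p \<bullet> p"
  have qline: "q (x + s *\<^sub>R p) = q x - 2 * a * s - e * s\<^sup>2" for s
    unfolding q_def a_def e_def by (simp add: inner_add_left inner_add_right inner_diff_left inner_diff_right
        inner_commute algebra_simps power2_eq_square)
  have qpos: "0 < q y" if "norm (y - x0) < rho" for y
  proof -
    have "(norm (y - x0))\<^sup>2 < R\<^sup>2" using that assms(5,6) by (intro power_strict_mono) auto
    then show ?thesis unfolding q_def by (simp add: power2_norm_eq_inner)
  qed
  obtain eps where eps: "0 < eps" "\<And>s. \<bar>s\<bar> < eps \<Longrightarrow> norm (x + s *\<^sub>R p - x0) < rho"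
  proof
    let ?eps = "(rho - norm (x - x0)) / (norm p + 1)"
    show "0 < ?eps" using assms by (simp add: add_nonneg_pos)
    fix s assume "\<bar>s\<bar> < ?eps"
    then have "\<bar>s\<bar> * (norm p + 1) < rho - norm (x - x0)" by (simp add: pos_less_divide_eq add_nonneg_pos)
    then have "norm (s *\<^sub>R p) < rho - norm (x - x0)" by (simp add: algebra_simps)
    then show "norm (x + s *\<^sub>R p - x0) < rho"
      using norm_triangle_ineq[of "x - x0" "s *\<^sub>R p"] by (simp add: algebra_simps)
  qed
  define f where "f s = G ((x, t) + s *\<^sub>R (p, 0)) - K / (q x - 2 * a * s - e * s\<^sup>2)\<^sup>2" for s
  define f' where "f' s = dd (p, 0) G ((x, t) + s *\<^sub>R (p, 0)) - K * (4 * a + 4 * e * s) / (q x - 2 * a * s - e * s\<^sup>2) ^ 3" for s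
  define l where "l = dd (p, 0) (dd (p, 0) G) (x, t) - K * (24 * a\<^sup>2 + 4 * e * q x) / q x ^ 4"
  have nz: "q x - 2 * a * s - e * s\<^sup>2 \<noteq> 0" if "\<bar>s\<bar> < eps" for s
    using qpos[OF eps(2)[OF that]] unfolding qline by simp
  have inOm: "(x, t) + s *\<^sub>R (p, 0) \<in> Om" for s using assms by simp
  have "l \<le> 0"
  proof (rule second_derivative_nonpos_at_max[OF eps(1)])
    show "(f has_real_derivative f' s) (at s)" if "\<bar>s\<bar> < eps" for s
      unfolding f_def f'_def
      by (intro DERIV_diff DERIV_along_line DERIV_barrier_profile nz that smooth_differentiable[OF G inOm])
    have "((\<lambda>s. dd (p, 0) G ((x, t) + s *\<^sub>R (p, 0))) has_real_derivative
        dd (p, 0) (dd (p, 0) G) ((x, t) + 0 *\<^sub>R (p, 0))) (at 0)"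
      by (intro DERIV_along_line smooth_differentiable[OF smooth_fun_on_dd[OF G] inOm])
    then show "(f' has_real_derivative l) (at 0)"
      unfolding f'_def l_def using qpos[OF assms(7)]
      by (intro DERIV_diff DERIV2_barrier_profile) auto
    show "f s \<le> f 0" if "\<bar>s\<bar> < eps" for s
      using max[OF eps(2)[OF that]] unfolding f_def qline by simp
  qed
  moreover have "K * (24 * a\<^sup>2 + 4 * e * q x) \<le> K * (28 * R\<^sup>2 * e)"
  proof (rule mult_left_mono)
    have e0: "0 \<le> e" by (simp add: e_def)
    have xR: "(x - x0) \<bullet> (x - x0) \<le> R\<^sup>2" using qpos[OF assms(7)] by (simp add: q_def)
    have "a\<^sup>2 \<le> ((x - x0) \<bullet> (x - x0)) * e" unfolding a_def e_def by (rule Cauchy_Schwarz_ineq)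
    also have "\<dots> \<le> R\<^sup>2 * e" by (rule mult_right_mono[OF xR e0])
    finally have 1: "a\<^sup>2 \<le> R\<^sup>2 * e" .
    have "q x \<le> R\<^sup>2" by (simp add: q_def)
    then have 2: "e * q x \<le> R\<^sup>2 * e" using e0 by (simp add: mult_left_mono mult.commute)
    show "24 * a\<^sup>2 + 4 * e * q x \<le> 28 * R\<^sup>2 * e" using 1 2 by (simp add: algebra_simps)
  qed (rule assms)
  moreover have "0 < q x ^ 4" using qpos[OF assms(7)] by simp
  ultimately have "dd (p, 0) (dd (p, 0) G) (x, t) \<le> K * (28 * R\<^sup>2 * e) / q x ^ 4"
    unfolding l_def using divide_right_mono[of "K * (24 * a\<^sup>2 + 4 * e * q x)" "K * (28 * R\<^sup>2 * e)" "q x ^ 4"] by linarith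
  then show ?thesis by (simp add: e_def mult_ac)
qed

lemma time_derivative_ge_barrier:
  fixes G :: "'n::finite field"
  assumes G: "smooth G" and "1/2 < s0" "s0 < t"
    and max: "\<And>s. s0 \<le> s \<Longrightarrow> s \<le> t \<Longrightarrow> G (x, s) - A / (s - 1/2) \<le> G (x, t) - A / (t - 1/2)"
  shows "- A / (t - 1/2)\<^sup>2 \<le> dT G (x, t)"
proof (rule ccontr)
  assume neg: "\<not> ?thesis"
  define f where "f s = G ((x, 0) + s *\<^sub>R (0, 1)) - A / (s - 1/2)" for s
  have "(f has_real_derivative dT G ((x, 0) + t *\<^sub>R (0, 1)) + A / (t - 1/2)\<^sup>2) (at t)"
  proof -
    have "((\<lambda>s. A / (s - 1/2)) has_real_derivative - (A / (t - 1/2)\<^sup>2)) (at t)"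
      using assms by (auto intro!: derivative_eq_intros simp: divide_simps power2_eq_square)
    moreover have "((\<lambda>s. G ((x, 0) + s *\<^sub>R (0, 1))) has_real_derivative dT G ((x, 0) + t *\<^sub>R (0, 1))) (at t)"
      unfolding dT_def by (intro DERIV_along_line smooth_differentiable[OF G]) (use assms in auto)
    ultimately show ?thesis unfolding f_def[abs_def] using DERIV_diff by fastforce
  qed
  moreover have "dT G ((x, 0) + t *\<^sub>R (0, 1)) + A / (t - 1/2)\<^sup>2 < 0" using neg by simp
  ultimately obtain d where d: "0 < d" "\<And>h. 0 < h \<Longrightarrow> h < d \<Longrightarrow> f t < f (t - h)"
    using DERIV_neg_dec_left by blast
  define h where "h = min d (t - s0) / 2"
  have h': "h \<le> (t - s0) / 2" "h \<le> d / 2" "0 < h" using d(1) assms(3) by (simp_all add: h_def)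
  have h: "0 < h" "h < d" using h' d(1) by linarith+
  have h3: "s0 \<le> t - h" using h'(1) assms(3) by (simp add: field_simps)
  have "f (t - h) \<le> f t" unfolding f_def using max[of "t - h"] h h3 by simp
  then show False using d(2)[OF h(1,2)] by simp
qed

text \<open>
  The right hand side \<open>\<Phi>\<close> satisfies \<open>L \<Phi> \<ge> b - c \<Phi>\<^sup>2\<close>: its three terms balance the time
  derivative, the constant \<open>b\<close> and the space derivatives, respectively. As \<open>\<Phi>\<close> is infinite on the
  bottom \<open>t = 1/2\<close> and on the lateral boundary, a positive supremum of \<open>G - \<Phi>\<close> would be attained in the
  interior or at the final time, where it contradicts the hypothesis on \<open>G\<close>.
\<close>

lemma ball_barrier_comparison:
  fixes U G :: "'n::finite field" and x0 x :: "real^'n"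
  defines "N \<equiv> real CARD('n)"
  assumes U: "MA_flow U" and lam: "0 < lam" "pinched lam Lam U" and G: "smooth G"
    and c: "0 < c" "0 \<le> b" and R: "0 < R"
    and sub: "\<And>z. 1/2 \<le> snd z \<Longrightarrow> 0 < G z \<Longrightarrow> heat U G z \<le> b - c * (G z)\<^sup>2"
    and x: "norm (x - x0) < R" and t: "1/2 < t" "t \<le> 1"
  shows "G (x, t) \<le> N / c / (t - 1/2) + sqrt (b / c) + 28 * N / (lam * c) * R\<^sup>2 / (R\<^sup>2 - (x - x0) \<bullet> (x - x0))\<^sup>2"
proof (rule ccontr)
  \<comment> \<open>The constants satisfy \<open>c A\<^sup>2 = N A\<close>, \<open>c beta\<^sup>2 = b\<close> and \<open>c K\<^sup>2 = 28 N R\<^sup>2 K / lam\<close>.\<close>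
  define q where "q = (\<lambda>x. R\<^sup>2 - (x - x0) \<bullet> (x - x0))"
  define A where "A = N / c"
  define B where "B = 28 * N / (lam * c)"
  define K where "K = B * R\<^sup>2"
  define beta where "beta = sqrt (b / c)"
  define Phi where "Phi = (\<lambda>y s. A / (s - 1/2) + beta + K / (q y)\<^sup>2)"
  have N: "1 \<le> N" unfolding N_def using zero_less_card_finite[where 'a = 'n] by linarith
  have pos: "0 < A" "0 < B" "0 < K" "0 \<le> beta"
    using N lam c R by (simp_all add: A_def B_def K_def beta_def)
  assume "\<not> ?thesis"
  then have GP: "Phi x t < G (x, t)" by (simp add: Phi_def A_def B_def K_def beta_def q_def)
  have qpos: "0 < q y" if "norm (y - x0) < R" for y
  proof -
    have "(norm (y - x0))\<^sup>2 < R\<^sup>2" using that by (intro power_strict_mono) auto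
    then show ?thesis unfolding q_def by (simp add: power2_norm_eq_inner)
  qed
  have qle: "q y \<le> R\<^sup>2" for y by (simp add: q_def)
  have qnorm: "q y = R\<^sup>2 - (norm (y - x0))\<^sup>2" for y by (simp add: q_def power2_norm_eq_inner)
  have contG: "continuous_on Om G" by (rule smooth_fun_on_continuous[OF G])
  have "compact (G ` (cball x0 R \<times> {1/2..1}))"
    by (intro compact_continuous_image compact_Times continuous_on_subset[OF contG]) auto
  then obtain M0 where M0: "\<And>g. g \<in> G ` (cball x0 R \<times> {1/2..1}) \<Longrightarrow> \<bar>g\<bar> \<le> M0"
    using compact_imp_bounded bounded_real by metis
  define M where "M = \<bar>M0\<bar> + 1"
  have M: "0 < M" by (simp add: M_def)
  have GM: "G (y, s) < M" if "norm (y - x0) \<le> R" "1/2 \<le> s" "s \<le> 1" for y s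
  proof -
    have "(y, s) \<in> cball x0 R \<times> {1/2..1}" using that by (simp add: dist_norm norm_minus_commute)
    then show ?thesis using M0[of "G (y, s)"] unfolding M_def by force
  qed
  \<comment> \<open>\<open>q0\<close> and \<open>s0\<close> cut off a compact cylinder around the point, on whose lateral boundary and bottom the barrier
    is at least \<open>M\<close>, an upper bound of \<open>G\<close>.\<close>
  define q0 where "q0 = min (q x) (sqrt (K / M))"
  have q0: "0 < q0" "q0 \<le> q x" "q0 \<le> R\<^sup>2" "M \<le> K / q0\<^sup>2"
  proof -
    show 1: "0 < q0" using qpos[OF x] pos M by (simp add: q0_def)
    show "q0 \<le> q x" by (simp add: q0_def)
    then show "q0 \<le> R\<^sup>2" using qle[of x] by linarith
    have "q0\<^sup>2 \<le> (sqrt (K / M))\<^sup>2" using 1 by (intro power_mono) (simp_all add: q0_def)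
    also have "\<dots> = K / M" using pos M by simp
    finally show "M \<le> K / q0\<^sup>2" using 1 M by (simp add: field_simps)
  qed
  define rho where "rho = sqrt (R\<^sup>2 - q0)"
  have rho2: "rho\<^sup>2 = R\<^sup>2 - q0" using q0 by (simp add: rho_def)
  have rho0: "0 \<le> rho" using q0 by (simp add: rho_def)
  have rhoR: "rho < R" using rho2 q0 R by (intro power2_less_imp_less[of rho R]) auto
  define s0 where "s0 = 1/2 + min (t - 1/2) (A / M)"
  have s0: "1/2 < s0" "s0 \<le> t" "M \<le> A / (s0 - 1/2)"
  proof -
    show 1: "1/2 < s0" using t pos M by (simp add: s0_def)
    show "s0 \<le> t" by (simp add: s0_def)
    have "s0 - 1/2 \<le> A / M" by (simp add: s0_def)
    then show "M \<le> A / (s0 - 1/2)" using 1 M pos by (simp add: field_simps)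
  qed
  let ?D = "cball x0 rho \<times> {s0..1}"
  have inD: "norm (y - x0) \<le> rho" "norm (y - x0) < R" "s0 \<le> s" "s \<le> 1" if "(y, s) \<in> ?D" for y s
    using that rhoR by (auto simp: dist_norm norm_minus_commute)
  have "continuous_on ?D (\<lambda>z. G z - Phi (fst z) (snd z))"
  proof (intro continuous_on_diff)
    show "continuous_on ?D G" by (rule continuous_on_subset[OF contG]) (use s0 in auto)
    have "\<And>z. z \<in> ?D \<Longrightarrow> q (fst z) \<noteq> 0 \<and> snd z \<noteq> 1/2"
      using inD qpos s0 by (metis less_irrefl not_le prod.collapse)
    then show "continuous_on ?D (\<lambda>z. Phi (fst z) (snd z))"
      unfolding Phi_def q_def by (intro continuous_intros) (auto simp: q_def)
  qed
  moreover have "compact ?D" by (intro compact_Times) auto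
  moreover have xD: "(x, t) \<in> ?D"
  proof -
    have "(norm (x - x0))\<^sup>2 \<le> rho\<^sup>2" using q0(2) unfolding rho2 qnorm by simp
    then have "norm (x - x0) \<le> rho" using rho0 by (rule power2_le_imp_le)
    then show ?thesis using s0 t by (simp add: dist_norm norm_minus_commute)
  qed
  ultimately obtain z where z: "z \<in> ?D"
    "\<And>w. w \<in> ?D \<Longrightarrow> G w - Phi (fst w) (snd w) \<le> G z - Phi (fst z) (snd z)"
    using continuous_attains_sup[of ?D "\<lambda>z. G z - Phi (fst z) (snd z)"] by blast
  obtain y s where zy: "z = (y, s)" by (cases z)
  note yD = inD[OF z(1)[unfolded zy]]
  have gt: "Phi y s < G (y, s)" using z(2)[OF xD] GP by (simp add: zy)
  have GMz: "G (y, s) < M" using GM yD s0 by simp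
  have qy: "0 < q y" using qpos yD by blast
  have s12: "0 < s - 1/2" using yD s0 by simp
  have ylt: "norm (y - x0) < rho"
  proof (rule ccontr)
    assume "\<not> ?thesis"
    then have "norm (y - x0) = rho" using yD by simp
    then have "q y = q0" by (simp add: qnorm rho2)
    then have "M \<le> K / (q y)\<^sup>2" using q0 by simp
    also have "\<dots> \<le> Phi y s" unfolding Phi_def using pos s12 by simp
    finally show False using gt GMz by simp
  qed
  have slt: "s0 < s"
  proof (rule ccontr)
    assume "\<not> ?thesis"
    then have "s = s0" using yD by simp
    then have "M \<le> A / (s - 1/2)" using s0 by simp
    also have "\<dots> \<le> Phi y s" unfolding Phi_def using pos by simp
    finally show False using gt GMz by simp
  qed
  have zOm: "(y, s) \<in> Om" using s12 by simp
  obtain p where p: "orthonormal_frame (hess U (y, s)) p" using MA_flow_frame[OF U zOm] .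
  have time: "- A / (s - 1/2)\<^sup>2 \<le> dT G (y, s)"
  proof (rule time_derivative_ge_barrier[OF G s0(1) slt])
    fix r assume "s0 \<le> r" "r \<le> s"
    then have "(y, r) \<in> ?D" using z(1) zy by auto
    from z(2)[OF this] show "G (y, r) - A / (r - 1/2) \<le> G (y, s) - A / (s - 1/2)"
      by (simp add: zy Phi_def)
  qed
  have space: "dd (p k, 0) (dd (p k, 0) G) (y, s) \<le> 28 * K * R\<^sup>2 / lam / q y ^ 4" for k
  proof -
    have "dd (p k, 0) (dd (p k, 0) G) (y, s) \<le> 28 * K * R\<^sup>2 * (p k \<bullet> p k) / q y ^ 4"
      unfolding q_def
    proof (rule frame_second_derivative_le_barrier[OF G])
      show "0 < rho" using ylt by (smt (verit) norm_ge_zero)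
      fix y' assume "norm (y' - x0) < rho"
      then have "(y', s) \<in> ?D" using yD by (simp add: dist_norm norm_minus_commute)
      from z(2)[OF this]
      show "G (y', s) - K / (R\<^sup>2 - (y' - x0) \<bullet> (y' - x0))\<^sup>2 \<le> G (y, s) - K / (R\<^sup>2 - (y - x0) \<bullet> (y - x0))\<^sup>2"
        by (simp add: zy Phi_def q_def)
    qed (use pos s12 rhoR ylt in auto)
    also have "\<dots> \<le> 28 * K * R\<^sup>2 * (1 / lam) / q y ^ 4"
    proof (intro divide_right_mono mult_left_mono)
      show "p k \<bullet> p k \<le> 1 / lam"
        using lam(2) zOm unfolding pinched_def
        by (intro orthonormal_frame_norm_le[OF p MA_flowD(4)[OF U zOm] lam(1)]) blast
    qed (use pos R in auto)
    finally show ?thesis by simp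
  qed
  have "heat U G (y, s) = N * dT G (y, s) - (\<Sum>k\<in>UNIV. dd (p k, 0) (dd (p k, 0) G) (y, s))"
    unfolding N_def by (rule heat_frame[OF U G zOm p])
  moreover have "(\<Sum>k\<in>UNIV. dd (p k, 0) (dd (p k, 0) G) (y, s)) \<le> N * (28 * K * R\<^sup>2 / lam / q y ^ 4)"
    unfolding N_def using sum_bounded_above[of UNIV, OF space] by simp
  moreover have "N * (- A / (s - 1/2)\<^sup>2) \<le> N * dT G (y, s)"
    using time N by (intro mult_left_mono) auto
  ultimately have lower: "N * (- A / (s - 1/2)\<^sup>2) - N * (28 * K * R\<^sup>2 / lam / q y ^ 4) \<le> heat U G (y, s)"
    by linarith
  let ?X = "A / (s - 1/2)" and ?Y = "K / (q y)\<^sup>2"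
  have XY: "0 < ?X" "0 < ?Y" using pos s12 qy by simp_all
  then have Phi0: "0 < Phi y s" "Phi y s = ?X + beta + ?Y" using pos by (simp_all add: Phi_def)
  have upper: "heat U G (y, s) \<le> b - c * (G (y, s))\<^sup>2"
    by (rule sub) (use s12 gt Phi0 in auto)
  have "?X\<^sup>2 + beta\<^sup>2 + ?Y\<^sup>2 \<le> (Phi y s)\<^sup>2"
  proof -
    have "x\<^sup>2 + y\<^sup>2 + z\<^sup>2 \<le> (x + y + z)\<^sup>2" if "0 \<le> x" "0 \<le> y" "0 \<le> z" for x y z :: real
      using mult_nonneg_nonneg[OF that(1,2)] mult_nonneg_nonneg[OF that(1,3)] mult_nonneg_nonneg[OF that(2,3)]
      by (simp add: power2_eq_square algebra_simps)
    then show ?thesis unfolding Phi0(2) using XY pos(4) by simp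
  qed
  also have "(Phi y s)\<^sup>2 < (G (y, s))\<^sup>2" using gt Phi0 by (intro power_strict_mono) auto
  finally have "c * (?X\<^sup>2 + beta\<^sup>2 + ?Y\<^sup>2) < c * (G (y, s))\<^sup>2" using c(1) by simp
  moreover have "c * beta\<^sup>2 = b" using c by (simp add: beta_def)
  moreover have "c * ?X\<^sup>2 = - (N * (- A / (s - 1/2)\<^sup>2))"
    using c by (simp add: A_def power_divide power2_eq_square)
  moreover have "c * ?Y\<^sup>2 = N * (28 * K * R\<^sup>2 / lam / q y ^ 4)"
    using c lam by (simp add: K_def B_def power2_eq_square power_def field_simps)
  ultimately show False using lower upper by (simp add: distrib_left)
qed

text \<open>
  The spatial part of the barrier vanishes at the centre of the ball as its radius tends to
  infinity.
\<close>

theorem interior_maximum_bound: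
  fixes U G :: "'n::finite field"
  assumes "MA_flow U" "0 < lam" "pinched lam Lam U" "smooth G" "0 < c" "0 \<le> b"
    and "\<And>z. 1/2 \<le> snd z \<Longrightarrow> 0 < G z \<Longrightarrow> heat U G z \<le> b - c * (G z)\<^sup>2"
  shows "G (x, 1) \<le> 2 * real CARD('n) / c + sqrt (b / c)"
proof (rule field_le_epsilon)
  fix e :: real assume e: "0 < e"
  define B where "B = 28 * real CARD('n) / (lam * c)"
  have B: "0 < B" using assms by (simp add: B_def)
  \<comment> \<open>At the centre the spatial barrier is \<open>B / R\<^sup>2\<close>.\<close>
  define R where "R = sqrt (B / e)"
  have R: "0 < R" using B e by (simp add: R_def)
  have "G (x, 1) \<le> real CARD('n) / c / (1 - 1/2) + sqrt (b / c) + B * R\<^sup>2 / (R\<^sup>2 - (x - x) \<bullet> (x - x))\<^sup>2"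
    unfolding B_def by (rule ball_barrier_comparison[OF assms(1-6) R assms(7)]) (use R in auto)
  also have "B * R\<^sup>2 / (R\<^sup>2 - (x - x) \<bullet> (x - x))\<^sup>2 = e"
    using B e by (simp add: R_def power2_eq_square)
  finally show "G (x, 1) \<le> 2 * real CARD('n) / c + sqrt (b / c) + e" by (simp add: mult.commute)
qed

section \<open>The tensor algebra of the Calabi inequality\<close>

text \<open>
  Contractions of two tensors of order four are all written with this operator, so that relabelling
  indices amounts to swapping neighbouring arguments.
\<close>

definition sum4 :: "('n::finite \<Rightarrow> 'n \<Rightarrow> 'n \<Rightarrow> 'n \<Rightarrow> real) \<Rightarrow> real" where
  "sum4 f = (\<Sum>i\<in>UNIV. \<Sum>j\<in>UNIV. \<Sum>k\<in>UNIV. \<Sum>p\<in>UNIV. f i j k p)"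

lemma sum4_swap12: "sum4 (\<lambda>i j k p. f j i k p) = sum4 f"
  unfolding sum4_def by (rule sum.swap)

lemma sum4_swap23: "sum4 (\<lambda>i j k p. f i k j p) = sum4 f"
  unfolding sum4_def by (intro sum.cong refl sum.swap)

lemma sum4_swap34: "sum4 (\<lambda>i j k p. f i j p k) = sum4 f"
  unfolding sum4_def by (intro sum.cong refl sum.swap)

lemma sum4_add: "sum4 (\<lambda>i j k p. f i j k p + g i j k p) = sum4 f + sum4 g"
  by (simp add: sum4_def sum.distrib)

lemma sum4_diff: "sum4 (\<lambda>i j k p. f i j k p - g i j k p) = sum4 f - sum4 g"
  by (simp add: sum4_def sum_subtractf)

lemma sum4_cmult: "sum4 (\<lambda>i j k p. c * f i j k p) = c * sum4 f"
  by (simp add: sum4_def sum_distrib_left)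

lemma sum4_nonneg: "(\<And>i j k p. 0 \<le> f i j k p) \<Longrightarrow> 0 \<le> sum4 f"
  unfolding sum4_def by (intro sum_nonneg) auto

lemma sum4_cong: "(\<And>i j k p. f i j k p = g i j k p) \<Longrightarrow> sum4 f = sum4 g"
  by presburger

lemma sum_rotate3: "(\<Sum>i\<in>A. \<Sum>j\<in>B. \<Sum>k\<in>C. g i j k) = (\<Sum>j\<in>B. \<Sum>k\<in>C. \<Sum>i\<in>A. g i j k)"
  by (subst sum.swap) (intro sum.cong refl sum.swap)

lemma sum_swap22:
  "(\<Sum>k\<in>A. \<Sum>p\<in>B. \<Sum>a\<in>C. \<Sum>b\<in>D. g k p a b) = (\<Sum>a\<in>C. \<Sum>b\<in>D. \<Sum>k\<in>A. \<Sum>p\<in>B. g k p a b)"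
  by (rule trans[OF sum.cong[OF refl sum_rotate3] sum_rotate3])

text \<open>
  \<open>T\<close> and \<open>Q\<close> stand for the third and fourth derivatives of a function at a point where its Hessian is
  the identity, so that all indices may be written as subscripts.
\<close>

locale symmetric_jets =
  fixes T :: "'n::finite \<Rightarrow> 'n \<Rightarrow> 'n \<Rightarrow> real" and Q :: "'n \<Rightarrow> 'n \<Rightarrow> 'n \<Rightarrow> 'n \<Rightarrow> real"
  assumes T12: "T i j k = T j i k" and T23: "T i j k = T i k j"
    and Q12: "Q i j k l = Q j i k l" and Q23: "Q i j k l = Q i k j l" and Q34: "Q i j k l = Q i j l k"
begin

text \<open>
  \<open>QQ\<close>, \<open>X\<close>, \<open>W\<close> and \<open>RR\<close> are the four complete contractions that occur in the evolution of Calabi's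
  quantity. Two factors \<open>T\<close> joined along one index form \<open>Y\<close>; joining two copies of \<open>Y\<close> gives either
  \<open>RR = |rho|\<^sup>2\<close> or the tetrahedral contraction \<open>W\<close> of four factors \<open>T\<close>.
\<close>

definition Y where "Y i j k p = (\<Sum>a\<in>UNIV. T i j a * T a k p)"
definition rho where "rho i a = (\<Sum>j\<in>UNIV. \<Sum>k\<in>UNIV. T i j k * T a j k)"
definition QQ where "QQ = sum4 (\<lambda>i j k p. (Q i j k p)\<^sup>2)"
definition X where "X = sum4 (\<lambda>i j k p. Q i j k p * Y i j k p)"
definition W where "W = sum4 (\<lambda>i j k p. Y i j k p * Y i k j p)"
definition RR where "RR = sum4 (\<lambda>i j k p. (Y i j k p)\<^sup>2)"

lemma Trot: "T i j a = T a i j" by (rule trans[OF T23 T12])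

lemma Y12: "Y i j k p = Y j i k p" unfolding Y_def by (rule sum.cong[OF refl]) (simp add: T12[of i j])
lemma Y34: "Y i j k p = Y i j p k" unfolding Y_def by (rule sum.cong[OF refl]) (simp add: T23[of _ k p])
lemma Ycyc: "Y i j k p = Y k p i j"
proof -
  have "T i j a * T a k p = T k p a * T a i j" for a by (simp add: Trot[of k p a] Trot[of i j a])
  then show ?thesis unfolding Y_def by simp
qed

lemma rho_mult: "rho a b * c = (\<Sum>i\<in>UNIV. \<Sum>j\<in>UNIV. T a i j * T b i j * c)"
  unfolding rho_def sum_distrib_right ..

lemma RR_rho: "RR = (\<Sum>a\<in>UNIV. \<Sum>b\<in>UNIV. rho a b * rho a b)"
proof -
  have "RR = (\<Sum>i\<in>UNIV. \<Sum>j\<in>UNIV. \<Sum>k\<in>UNIV. \<Sum>p\<in>UNIV. \<Sum>a\<in>UNIV. \<Sum>b\<in>UNIV. T a k p * T b k p * (T a i j * T b i j))"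
    unfolding RR_def sum4_def Y_def power2_eq_square sum_product
  proof (intro sum.cong refl)
    fix i j k p a b
    have "T i j a = T a i j" "T i j b = T b i j" by (rule Trot)+
    then show "T i j a * T a k p * (T i j b * T b k p) = T a k p * T b k p * (T a i j * T b i j)" by simp
  qed
  also have "\<dots> = (\<Sum>i\<in>UNIV. \<Sum>j\<in>UNIV. \<Sum>a\<in>UNIV. \<Sum>b\<in>UNIV. \<Sum>k\<in>UNIV. \<Sum>p\<in>UNIV. T a k p * T b k p * (T a i j * T b i j))"
    by (intro sum.cong refl sum_swap22)
  also have "\<dots> = (\<Sum>i\<in>UNIV. \<Sum>j\<in>UNIV. \<Sum>a\<in>UNIV. \<Sum>b\<in>UNIV. T a i j * T b i j * rho a b)"
    by (simp only: rho_mult[symmetric] mult.commute[of "rho _ _"])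
  also have "\<dots> = (\<Sum>a\<in>UNIV. \<Sum>b\<in>UNIV. \<Sum>i\<in>UNIV. \<Sum>j\<in>UNIV. T a i j * T b i j * rho a b)"
    by (rule sum_swap22)
  finally show ?thesis unfolding rho_mult[symmetric] .
qed

lemma X_perm: "sum4 (\<lambda>i j k p. Q i j k p * Y i k j p) = X" "sum4 (\<lambda>i j k p. Q i j k p * Y i p j k) = X"
proof -
  have "sum4 (\<lambda>i j k p. Q i j k p * Y i k j p) = sum4 (\<lambda>i j k p. Q i k j p * Y i k j p)"
    by (intro sum4_cong) (rule arg_cong2[where f = "(*)", OF Q23 refl])
  also have "\<dots> = X" unfolding X_def by (rule sum4_swap23[where f = "\<lambda>i j k p. Q i j k p * Y i j k p"])
  finally show 1: "sum4 (\<lambda>i j k p. Q i j k p * Y i k j p) = X" .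
  have "sum4 (\<lambda>i j k p. Q i j k p * Y i p j k) = sum4 (\<lambda>i j k p. Q i j p k * Y i p j k)"
    by (intro sum4_cong) (rule arg_cong2[where f = "(*)", OF Q34 refl])
  also have "\<dots> = X" unfolding 1[symmetric]
    by (rule sum4_swap34[where f = "\<lambda>i j k p. Q i j k p * Y i k j p"])
  finally show "sum4 (\<lambda>i j k p. Q i j k p * Y i p j k) = X" .
qed

lemma RR_perm: "sum4 (\<lambda>i j k p. (Y i k j p)\<^sup>2) = RR" "sum4 (\<lambda>i j k p. (Y i p j k)\<^sup>2) = RR"
proof -
  show 1: "sum4 (\<lambda>i j k p. (Y i k j p)\<^sup>2) = RR"
    unfolding RR_def by (rule sum4_swap23[where f = "\<lambda>i j k p. (Y i j k p)\<^sup>2"])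
  show "sum4 (\<lambda>i j k p. (Y i p j k)\<^sup>2) = RR"
    unfolding 1[symmetric] by (rule sum4_swap34[where f = "\<lambda>i j k p. (Y i k j p)\<^sup>2"])
qed

lemma W_perm: "sum4 (\<lambda>i j k p. Y i j k p * Y i p j k) = W" "sum4 (\<lambda>i j k p. Y i k j p * Y i p j k) = W"
proof -
  have "sum4 (\<lambda>i j k p. Y i j k p * Y i p j k) = sum4 (\<lambda>i j k p. Y i j p k * Y i p j k)"
    by (intro sum4_cong) (rule arg_cong2[where f = "(*)", OF Y34 refl])
  also have "\<dots> = W" unfolding W_def
    by (rule sum4_swap34[where f = "\<lambda>i j k p. Y i j k p * Y i k j p"])
  finally show "sum4 (\<lambda>i j k p. Y i j k p * Y i p j k) = W" .
  have "sum4 (\<lambda>i j k p. Y i k j p * Y i p j k) = sum4 (\<lambda>i j k p. Y i k p j * Y i p k j)"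
    by (intro sum4_cong) (rule arg_cong2[where f = "(*)", OF Y34 Y34])
  also have "\<dots> = sum4 (\<lambda>i j k p. Y i j p k * Y i p j k)"
    by (rule sum4_swap23[where f = "\<lambda>i j k p. Y i j p k * Y i p j k"])
  also have "\<dots> = W" unfolding W_def
    by (rule sum4_swap34[where f = "\<lambda>i j k p. Y i j k p * Y i k j p"])
  finally show "sum4 (\<lambda>i j k p. Y i k j p * Y i p j k) = W" .
qed

text \<open>
  \<open>W\<close> is the inner product of two tensors of squared norm \<open>RR\<close>.
\<close>

lemma W_le_RR: "W \<le> RR"
proof -
  have "0 \<le> sum4 (\<lambda>i j k p. (Y i j k p - Y i k j p)\<^sup>2)" by (rule sum4_nonneg) simp
  also have "\<dots> = sum4 (\<lambda>i j k p. (Y i j k p)\<^sup>2 + (Y i k j p)\<^sup>2 - 2 * (Y i j k p * Y i k j p))"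
    by (rule sum4_cong) (simp add: power2_diff)
  also have "\<dots> = 2 * RR - 2 * W"
    by (simp only: sum4_add sum4_diff sum4_cmult RR_perm flip: RR_def W_def)
  finally show ?thesis by simp
qed

text \<open>
  This is the nonnegativity of \<open>|Q - Y'/2|\<^sup>2\<close>, where \<open>Y'\<close> is the sum of the three tensors obtained from
  \<open>Y\<close> by permuting its indices.
\<close>

lemma square_completion: "0 \<le> QQ - 3 * X + 3 / 4 * RR + 3 / 2 * W"
proof -
  let ?q = "\<lambda>i j k p. Q i j k p - (Y i j k p + Y i k j p + Y i p j k) / 2"
  have "0 \<le> sum4 (\<lambda>i j k p. (?q i j k p)\<^sup>2)" by (rule sum4_nonneg) simp
  also have "\<dots> = sum4 (\<lambda>i j k p. (Q i j k p)\<^sup>2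
     - (Q i j k p * Y i j k p + Q i j k p * Y i k j p + Q i j k p * Y i p j k)
     + (1/4) * ((Y i j k p)\<^sup>2 + (Y i k j p)\<^sup>2 + (Y i p j k)\<^sup>2)
     + (1/2) * (Y i j k p * Y i k j p + Y i j k p * Y i p j k + Y i k j p * Y i p j k))"
    by (rule sum4_cong) (simp add: power2_eq_square field_simps)
  also have "\<dots> = QQ - (X + X + X) + (1/4) * (RR + RR + RR) + (1/2) * (W + W + W)"
    by (simp only: sum4_add sum4_diff sum4_cmult RR_perm X_perm W_perm flip: RR_def W_def X_def QQ_def)
  finally show ?thesis by simp
qed

text \<open>
  The trace of \<open>rho\<close> is \<open>|T|\<^sup>2\<close>; by the Cauchy-Schwarz inequality its square is at most \<open>n\<close> times
  the squared norm of \<open>rho\<close>.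
\<close>

lemma trace_rho_le: "(\<Sum>i\<in>UNIV. rho i i)\<^sup>2 \<le> real CARD('n) * RR"
proof -
  have "(\<Sum>i\<in>UNIV. rho i i * 1)\<^sup>2 \<le> (\<Sum>i\<in>UNIV. (rho i i)\<^sup>2) * (\<Sum>i\<in>(UNIV::'n set). 1\<^sup>2)"
    by (rule Cauchy_Schwarz_ineq_sum)
  also have "\<dots> = real CARD('n) * (\<Sum>i\<in>UNIV. (rho i i)\<^sup>2)" by simp
  also have "\<dots> \<le> real CARD('n) * (\<Sum>i\<in>UNIV. \<Sum>j\<in>UNIV. rho i j * rho i j)"
  proof (intro mult_left_mono sum_mono)
    fix i
    show "(rho i i)\<^sup>2 \<le> (\<Sum>j\<in>UNIV. rho i j * rho i j)"
      unfolding power2_eq_square by (rule member_le_sum[where f = "\<lambda>j. rho i j * rho i j"]) auto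
  qed simp
  finally show ?thesis by (simp add: RR_rho)
qed

abbreviation pairing where
  "pairing F \<equiv> \<Sum>i\<in>UNIV. \<Sum>j\<in>UNIV. \<Sum>k\<in>UNIV. T i j k * F i j k"

text \<open>
  Paired with \<open>T\<close>, the terms of the evolution equations below, except those with \<open>rho\<close>, contain two factors \<open>T\<close>
  that share an index. Summing over this index first produces \<open>Y\<close>.
\<close>

lemma contract3:
  "pairing (\<lambda>i j k. \<Sum>a\<in>UNIV. \<Sum>b\<in>UNIV. F i j a b * T k a b)
   = sum4 (\<lambda>i j a b. F i j a b * Y i j a b)"
  unfolding sum4_def
proof (rule sum.cong[OF refl], rule sum.cong[OF refl])
  fix i j
  have "(\<Sum>k\<in>UNIV. T i j k * (\<Sum>a\<in>UNIV. \<Sum>b\<in>UNIV. F i j a b * T k a b))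
    = (\<Sum>k\<in>UNIV. \<Sum>a\<in>UNIV. \<Sum>b\<in>UNIV. F i j a b * (T i j k * T k a b))"
    by (simp add: sum_distrib_left mult_ac)
  also have "\<dots> = (\<Sum>a\<in>UNIV. \<Sum>b\<in>UNIV. \<Sum>k\<in>UNIV. F i j a b * (T i j k * T k a b))"
    by (rule sum_rotate3)
  also have "\<dots> = (\<Sum>a\<in>UNIV. \<Sum>b\<in>UNIV. F i j a b * Y i j a b)"
    by (simp add: Y_def sum_distrib_left)
  finally show "(\<Sum>k\<in>UNIV. T i j k * (\<Sum>a\<in>UNIV. \<Sum>b\<in>UNIV. F i j a b * T k a b))
    = (\<Sum>a\<in>UNIV. \<Sum>b\<in>UNIV. F i j a b * Y i j a b)" .
qed

lemma contract2:
  "pairing (\<lambda>i j k. \<Sum>a\<in>UNIV. \<Sum>b\<in>UNIV. F i k a b * T j a b)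
   = sum4 (\<lambda>i j a b. F i j a b * Y i j a b)"
  unfolding contract3[symmetric]
  by (intro sum.cong[OF refl] trans[OF sum.swap]) (intro sum.cong refl arg_cong2[where f = "(*)"] T23)

lemma contract1:
  "pairing (\<lambda>i j k. \<Sum>a\<in>UNIV. \<Sum>b\<in>UNIV. F j k a b * T i a b)
   = sum4 (\<lambda>i j a b. F i j a b * Y i j a b)"
  unfolding contract3[symmetric]
  by (rule trans[OF sum_rotate3]) (intro sum.cong refl arg_cong2[where f = "(*)"] Trot[symmetric])

lemma contract_rho1:
  "pairing (\<lambda>i j k. \<Sum>a\<in>UNIV. rho i a * T a j k) = RR"
proof -
  have "(\<Sum>j\<in>UNIV. \<Sum>k\<in>UNIV. T i j k * (\<Sum>a\<in>UNIV. rho i a * T a j k)) = (\<Sum>a\<in>UNIV. rho i a * rho i a)" for i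
  proof -
    have "(\<Sum>j\<in>UNIV. \<Sum>k\<in>UNIV. T i j k * (\<Sum>a\<in>UNIV. rho i a * T a j k))
       = (\<Sum>j\<in>UNIV. \<Sum>k\<in>UNIV. \<Sum>a\<in>UNIV. T i j k * T a j k * rho i a)"
      by (simp add: sum_distrib_left mult_ac)
    also have "\<dots> = (\<Sum>a\<in>UNIV. \<Sum>j\<in>UNIV. \<Sum>k\<in>UNIV. T i j k * T a j k * rho i a)"
      by (rule sum_rotate3[symmetric])
    finally show ?thesis unfolding rho_mult[symmetric] .
  qed
  then show ?thesis unfolding RR_rho by simp
qed

lemma contract_rho2:
  "pairing (\<lambda>i j k. \<Sum>a\<in>UNIV. rho j a * T i a k) = RR"
  unfolding contract_rho1[symmetric]
  by (rule trans[OF sum.swap]) (intro sum.cong refl arg_cong2[where f = "(*)"] T12)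

lemma contract_rho3:
  "pairing (\<lambda>i j k. \<Sum>a\<in>UNIV. rho k a * T i j a) = RR"
  unfolding contract_rho1[symmetric]
  by (rule trans[OF sum_rotate3[symmetric]]) (intro sum.cong refl arg_cong2[where f = "(*)"] Trot)

text \<open>
  The values at the point of \<open>L\<close> applied to a third derivative.
\<close>

definition H3 where
  "H3 i j k = 2 * (\<Sum>a\<in>UNIV. \<Sum>b\<in>UNIV. Y i a b j * T k a b) - (\<Sum>a\<in>UNIV. \<Sum>b\<in>UNIV. Q i k a b * T j a b)
     - (\<Sum>a\<in>UNIV. \<Sum>b\<in>UNIV. Q j k a b * T i a b) - (\<Sum>a\<in>UNIV. \<Sum>b\<in>UNIV. Q i j a b * T k a b)"

text \<open>
  The values at the point of \<open>L\<close> applied to the third derivatives with all indices raised.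
\<close>

definition R3 where
  "R3 i j k = H3 i j k - (\<Sum>a\<in>UNIV. rho i a * T a j k) - (\<Sum>a\<in>UNIV. rho j a * T i a k) - (\<Sum>a\<in>UNIV. rho k a * T i j a)
     + 2 * (\<Sum>a\<in>UNIV. \<Sum>p\<in>UNIV. Q j k a p * T i a p)
     + 2 * (\<Sum>a\<in>UNIV. \<Sum>p\<in>UNIV. (Q i k a p - Y i p a k) * T j a p)
     + 2 * (\<Sum>a\<in>UNIV. \<Sum>p\<in>UNIV. (Q i j a p - Y i p j a - Y j p i a) * T k a p)"

text \<open>
  The gradient at the point of the third derivatives with all indices raised.
\<close>

definition G3 where
  "G3 i j k p = Q i j k p - Y i p j k - Y j p i k - Y k p i j"

lemma Qsym: "Q k i a b = Q i k a b" "Q k a b j = Q j k a b" "Q a b i j = Q i j a b"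
  "Q a j k p = Q j k a p" "Q i a k p = Q i k a p"
proof -
  show "Q k i a b = Q i k a b" by (rule Q12)
  have "Q k a b j = Q k a j b" by (rule Q34)
  also have "\<dots> = Q k j a b" by (rule Q23)
  also have "\<dots> = Q j k a b" by (rule Q12)
  finally show "Q k a b j = Q j k a b" .
  have "Q a b i j = Q a i b j" by (rule Q23)
  also have "\<dots> = Q i a b j" by (rule Q12)
  also have "\<dots> = Q i a j b" by (rule Q34)
  also have "\<dots> = Q i j a b" by (rule Q23)
  finally show "Q a b i j = Q i j a b" .
  have "Q a j k p = Q j a k p" by (rule Q12)
  also have "\<dots> = Q j k a p" by (rule Q23)
  finally show "Q a j k p = Q j k a p" .
  show "Q i a k p = Q i k a p" by (rule Q23)
qed

lemma W_forms: "sum4 (\<lambda>i j a b. Y i a b j * Y i j a b) = W" "sum4 (\<lambda>i k a p. Y i p a k * Y i k a p) = W"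
  "sum4 (\<lambda>i j a p. Y i p j a * Y i j a p) = W" "sum4 (\<lambda>i j a p. Y j p i a * Y i j a p) = W"
proof -
  have "sum4 (\<lambda>i j a b. Y i a b j * Y i j a b) = sum4 (\<lambda>i j a b. Y i j a b * Y i a j b)"
    by (intro sum4_cong) (simp add: Y34 mult.commute)
  then show "sum4 (\<lambda>i j a b. Y i a b j * Y i j a b) = W" by (simp add: W_def)
  have 1: "sum4 (\<lambda>i j a p. Y i j p a * Y i p j a) = W"
    unfolding W_def by (rule sum4_swap34[where f = "\<lambda>i j k p. Y i j k p * Y i k j p"])
  have "sum4 (\<lambda>i k a p. Y i p a k * Y i k a p) = sum4 (\<lambda>i j a p. Y i j p a * Y i p j a)"
  proof (rule sum4_cong)
    fix i j k p
    show "Y i p k j * Y i j k p = Y i j p k * Y i p j k" by (simp add: Y34[of i p k j] Y34[of i j k p])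
  qed
  then show "sum4 (\<lambda>i k a p. Y i p a k * Y i k a p) = W" by (simp add: 1)
  have 2: "sum4 (\<lambda>i j a p. Y i p j a * Y i j a p) = sum4 (\<lambda>i j a p. Y i j p a * Y i p j a)"
  proof (rule sum4_cong)
    fix i j k p
    show "Y i p j k * Y i j k p = Y i j p k * Y i p j k" by (simp add: Y34[of i j k p])
  qed
  then show 3: "sum4 (\<lambda>i j a p. Y i p j a * Y i j a p) = W" by (simp add: 1)
  have "sum4 (\<lambda>i j a p. Y j p i a * Y i j a p) = sum4 (\<lambda>i j a p. Y j p i a * Y j i a p)"
    by (intro sum4_cong arg_cong2[where f = "(*)"] refl Y12)
  also have "\<dots> = W" unfolding 3[symmetric]
    by (rule sum4_swap12[where f = "\<lambda>i j a p. Y i p j a * Y i j a p"])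
  finally show "sum4 (\<lambda>i j a p. Y j p i a * Y i j a p) = W" .
qed

lemma contract_H3: "pairing H3 = 2 * W - 3 * X"
proof -
  have "pairing H3 =
     2 * pairing (\<lambda>i j k. \<Sum>a\<in>UNIV. \<Sum>b\<in>UNIV. Y i a b j * T k a b)
     - pairing (\<lambda>i j k. \<Sum>a\<in>UNIV. \<Sum>b\<in>UNIV. Q i k a b * T j a b)
     - pairing (\<lambda>i j k. \<Sum>a\<in>UNIV. \<Sum>b\<in>UNIV. Q j k a b * T i a b)
     - pairing (\<lambda>i j k. \<Sum>a\<in>UNIV. \<Sum>b\<in>UNIV. Q i j a b * T k a b)"
    unfolding H3_def
    by (simp add: right_diff_distrib sum_subtractf sum_distrib_left mult.left_commute)
  then show ?thesis unfolding contract3 contract2 contract1 W_forms X_def[symmetric] by simp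
qed

lemma contract_R3: "pairing R3 = 3 * X - 4 * W - 3 * RR"
proof -
  have s1: "sum4 (\<lambda>i j a b. (Q i j a b - Y i b a j) * Y i j a b) = X - W"
    by (simp add: left_diff_distrib sum4_diff W_forms flip: X_def)
  have s2: "sum4 (\<lambda>i j a b. (Q i j a b - Y i b j a - Y j b i a) * Y i j a b) = X - 2 * W"
    by (simp add: left_diff_distrib sum4_diff W_forms flip: X_def)
  have e: "T i j k * R3 i j k = T i j k * H3 i j k - T i j k * (\<Sum>a\<in>UNIV. rho i a * T a j k)
     - T i j k * (\<Sum>a\<in>UNIV. rho j a * T i a k) - T i j k * (\<Sum>a\<in>UNIV. rho k a * T i j a)
     + 2 * (T i j k * (\<Sum>a\<in>UNIV. \<Sum>p\<in>UNIV. Q j k a p * T i a p))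
     + 2 * (T i j k * (\<Sum>a\<in>UNIV. \<Sum>p\<in>UNIV. (Q i k a p - Y i p a k) * T j a p))
     + 2 * (T i j k * (\<Sum>a\<in>UNIV. \<Sum>p\<in>UNIV. (Q i j a p - Y i p j a - Y j p i a) * T k a p))" for i j k
    unfolding R3_def by (simp add: algebra_simps)
  have "pairing R3 =
     pairing H3
     - pairing (\<lambda>i j k. \<Sum>a\<in>UNIV. rho i a * T a j k)
     - pairing (\<lambda>i j k. \<Sum>a\<in>UNIV. rho j a * T i a k)
     - pairing (\<lambda>i j k. \<Sum>a\<in>UNIV. rho k a * T i j a)
     + 2 * pairing (\<lambda>i j k. \<Sum>a\<in>UNIV. \<Sum>p\<in>UNIV. Q j k a p * T i a p)
     + 2 * pairing (\<lambda>i j k. \<Sum>a\<in>UNIV. \<Sum>p\<in>UNIV. (Q i k a p - Y i p a k) * T j a p)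
     + 2 * pairing (\<lambda>i j k. \<Sum>a\<in>UNIV. \<Sum>p\<in>UNIV. (Q i j a p - Y i p j a - Y j p i a) * T k a p)"
    by (simp only: e sum.distrib sum_subtractf sum_distrib_left[symmetric])
  then show ?thesis unfolding contract3 contract2 contract1 contract_rho1 contract_rho2 contract_rho3 contract_H3 s1 s2
    by (simp flip: X_def)
qed

lemma contract_G3: "sum4 (\<lambda>i j k p. G3 i j k p * Q i j k p) = QQ - 3 * X"
proof -
  have "sum4 (\<lambda>i j k p. G3 i j k p * Q i j k p) = sum4 (\<lambda>i j k p. (Q i j k p)\<^sup>2 - Q i j k p * Y i p j k
      - Q i j k p * Y i k j p - Q i j k p * Y i j k p)"
  proof (rule sum4_cong)
    fix i j k p
    show "G3 i j k p * Q i j k p = (Q i j k p)\<^sup>2 - Q i j k p * Y i p j k - Q i j k p * Y i k j p - Q i j k p * Y i j k p"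
      unfolding G3_def Ycyc[of j p i k] Ycyc[of k p i j] by (simp add: power2_eq_square algebra_simps)
  qed
  then show ?thesis by (simp add: sum4_diff X_perm flip: X_def QQ_def)
qed

text \<open>
  The sum equals \<open>6 X - 2 W - 3 RR - 2 QQ\<close>. Completing the square in \<open>Q\<close> bounds it by
  \<open>W - 3/2 RR \<le> - RR / 2\<close>.
\<close>

lemma calabi_inequality:
  "(\<Sum>i\<in>UNIV. \<Sum>j\<in>UNIV. \<Sum>k\<in>UNIV. T i j k * R3 i j k + T i j k * H3 i j k - 2 * (\<Sum>p\<in>UNIV. G3 i j k p * Q i j k p))
   \<le> - ((\<Sum>i\<in>UNIV. rho i i)\<^sup>2 / (2 * real CARD('n)))"
proof -
  have "(\<Sum>i\<in>UNIV. \<Sum>j\<in>UNIV. \<Sum>k\<in>UNIV. T i j k * R3 i j k + T i j k * H3 i j k - 2 * (\<Sum>p\<in>UNIV. G3 i j k p * Q i j k p))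
    = (3 * X - 4 * W - 3 * RR) + (2 * W - 3 * X) - 2 * (QQ - 3 * X)"
    unfolding contract_R3[symmetric] contract_H3[symmetric] contract_G3[symmetric] sum4_def
    by (simp add: sum.distrib sum_subtractf sum_distrib_left)
  also have "\<dots> \<le> - (RR / 2)" using square_completion W_le_RR by (simp add: algebra_simps)
  also have "\<dots> \<le> - ((\<Sum>i\<in>UNIV. rho i i)\<^sup>2 / (2 * real CARD('n)))"
    using trace_rho_le by (simp add: field_simps)
  finally show ?thesis .
qed

end

section \<open>Evolution of the derivatives along the flow\<close>

lemma dX_sum:
  "(\<And>i. i \<in> I \<Longrightarrow> f i differentiable (at z)) \<Longrightarrow> dX p (\<lambda>y. \<Sum>i\<in>I. f i y) z = (\<Sum>i\<in>I. dX p (f i) z)"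
  unfolding dX_def by (rule dd_sum)

lemma dX_mult:
  "f differentiable (at z) \<Longrightarrow> g differentiable (at z) \<Longrightarrow>
   dX p (\<lambda>y. f y * g y) z = f z * dX p g z + dX p f z * g z"
  unfolding dX_def by (rule dd_mult)

text \<open>
  \<open>L\<close> commutes with a spatial derivative up to the derivative of its coefficients. All evolution
  equations below are obtained from this one by differentiating repeatedly.
\<close>

lemma heat_dX:
  fixes U f :: "'n::finite field"
  assumes "MA_flow U" "smooth f" "z \<in> Om"
  shows "heat U (dX i f) z = dX i (heat U f) z + (\<Sum>a\<in>UNIV. \<Sum>b\<in>UNIV. dX i (ihess U a b) z * dX a (dX b f) z)"
proof -
  have s: "smooth (\<lambda>y. \<Sum>a\<in>UNIV. \<Sum>b\<in>UNIV. ihess U a b y * dX a (dX b f) y)"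
    by (intro smooth_fun_on_mult smooth_fun_on_sum open_Om smooth_ihess smooth_dX assms)
  have d: "dX a (dX b f) differentiable (at z)" "ihess U a b differentiable (at z)"
      "(\<lambda>y. ihess U a b y * dX a (dX b f) y) differentiable (at z)" for a b
    by (intro smooth_differentiable smooth_fun_on_mult open_Om smooth_ihess smooth_dX assms)+
  have e: "dX i (dX a (dX b f)) z = dX a (dX b (dX i f)) z" for a b
  proof -
    have "dX i (dX a (dX b f)) z = dX a (dX i (dX b f)) z"
      by (rule dX_commute) (intro smooth_dX assms)+
    also have "\<dots> = dX a (dX b (dX i f)) z"
      by (rule dX_cong[OF assms(3)]) (rule dX_commute[OF assms(2)])
    finally show ?thesis .
  qed
  have "dX i (\<lambda>y. \<Sum>a\<in>UNIV. \<Sum>b\<in>UNIV. ihess U a b y * dX a (dX b f) y) z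
     = (\<Sum>a\<in>UNIV. \<Sum>b\<in>UNIV. ihess U a b z * dX a (dX b (dX i f)) z + dX i (ihess U a b) z * dX a (dX b f) z)"
    using d by (simp add: dX_sum dX_mult e differentiable_sum)
  moreover have "dX i (heat U f) z = real CARD('n) * dX i (dT f) z - dX i (\<lambda>y. \<Sum>a\<in>UNIV. \<Sum>b\<in>UNIV. ihess U a b y * dX a (dX b f) y) z"
    unfolding heat_def[abs_def] dX_def[of i]
    using smooth_differentiable[OF smooth_dT[OF assms(2)] assms(3)] smooth_differentiable[OF s assms(3)]
    by (simp add: dd_diff dd_cmult)
  ultimately show ?thesis
    unfolding heat_def by (simp add: dX_dT_commute[OF assms(2,3)] sum.distrib)
qed

text \<open>
  The first derivatives solve the linearised equation, because by Jacobi's formula the derivative of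
  \<open>ln det g\<close> is \<open>g\<^sup>a\<^sup>b \<partial>\<^sub>j g\<^sub>a\<^sub>b\<close>.
\<close>

lemma heat_first_derivative:
  fixes U :: "'n::finite field"
  assumes U: "MA_flow U" and z: "z \<in> Om"
  shows "heat U (dX j U) z = 0"
proof -
  note sU = MA_flowD(1)[OF U z]
  obtain c where c: "\<And>z. z \<in> Om \<Longrightarrow> real CARD('n) * dT U z = ln (det (hess U z)) + c"
    using U unfolding MA_flow_def by blast
  have hd: "\<And>i j. (\<lambda>y. hess U y $ i $ j) differentiable (at z)"
    by (rule hess_entry_differentiable[OF sU z])
  have dd: "(\<lambda>y. det (hess U y)) differentiable (at z)"
    using has_derivative_det[OF hd] unfolding differentiable_def by blast
  have dl: "(\<lambda>y. ln (det (hess U y))) differentiable (at z)"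
    using has_derivative_ln[OF MA_flowD(3)[OF U z] has_derivative_dd[OF dd]] unfolding differentiable_def by blast
  have "real CARD('n) * dT (dX j U) z = dX j (\<lambda>y. real CARD('n) * dT U y) z"
    using smooth_differentiable[OF smooth_dT[OF sU] z] dX_dT_commute[OF sU z]
    by (simp add: dX_def dd_cmult)
  also have "\<dots> = dX j (\<lambda>y. ln (det (hess U y)) + c) z"
    by (rule dX_cong[OF z c])
  also have "\<dots> = dX j (\<lambda>y. det (hess U y)) z / det (hess U z)"
    unfolding dX_def using dl by (simp add: dd_add dd_ln_comp[OF dd MA_flowD(3)[OF U z]])
  also have "\<dots> = (\<Sum>a\<in>UNIV. \<Sum>b\<in>UNIV. ihess U a b z * dX j (\<lambda>y. hess U y $ b $ a) z)"
    unfolding dX_def dd_det[OF hd MA_flowD(2)[OF U z]] ihess_def using MA_flowD(2)[OF U z] by simp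
  also have "\<dots> = (\<Sum>a\<in>UNIV. \<Sum>b\<in>UNIV. ihess U a b z * dX a (dX b (dX j U)) z)"
  proof (intro sum.cong refl arg_cong2[where f = "(*)"])
    fix a b
    have "dX j (\<lambda>y. hess U y $ b $ a) z = dX j (dX a (dX b U)) z"
      by (rule dX_cong[OF z]) (simp add: hess_def dX_commute[OF sU, of _ a b])
    also have "\<dots> = dX a (dX j (dX b U)) z"
      by (rule dX_commute[OF smooth_dX[OF sU] z])
    also have "\<dots> = dX a (dX b (dX j U)) z"
      by (rule dX_cong[OF z]) (rule dX_commute[OF sU])
    finally show "dX j (\<lambda>y. hess U y $ b $ a) z = dX a (dX b (dX j U)) z" .
  qed
  finally show ?thesis unfolding heat_def by simp
qed

lemma DJ_swap:
  assumes "smooth U"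
  shows "z \<in> Om \<Longrightarrow> DJ (xs @ a # b # ys) U z = DJ (xs @ b # a # ys) U z"
proof (induction xs arbitrary: z)
  case Nil
  then show ?case using dX_commute[OF smooth_DJ[OF assms]] by simp
next
  case (Cons x xs)
  show ?case by simp (rule dX_cong[OF Cons.prems Cons.IH])
qed

lemma dX_ihess:
  assumes "MA_flow U" "z \<in> Om"
  shows "dX i (ihess U a b) z = - (\<Sum>s\<in>UNIV. \<Sum>t\<in>UNIV. ihess U a s z * DJ [i, s, t] U z * ihess U t b z)"
  unfolding dX_def[of i] dd_ihess(2)[OF assms] by (simp add: dX_def)

lemma heat_second_derivative:
  fixes U :: "'n::finite field"
  assumes "MA_flow U" "z \<in> Om"
  shows "heat U (DJ [i, j] U) z = (\<Sum>a\<in>UNIV. \<Sum>b\<in>UNIV. dX i (ihess U a b) z * DJ [a, b, j] U z)"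
proof -
  have "dX i (heat U (dX j U)) z = dX i (\<lambda>_. 0) z"
    by (rule dX_cong[OF assms(2)]) (rule heat_first_derivative[OF assms(1)])
  then have "dX i (heat U (dX j U)) z = 0" by (simp add: dX_def)
  then show ?thesis using heat_dX[OF assms(1) smooth_dX[OF MA_flowD(1)[OF assms]] assms(2)] by simp
qed

lemma heat_cong:
  assumes "z \<in> Om" "\<And>y. y \<in> Om \<Longrightarrow> f y = g y"
  shows "heat U f z = heat U g z"
proof -
  have "dX a (dX b f) z = dX a (dX b g) z" for a b
    by (rule dX_cong[OF assms(1)]) (rule dX_cong[OF _ assms(2)])
  then show ?thesis unfolding heat_def using dT_cong[OF assms] by simp
qed

lemma sum_delta_left: "(\<Sum>s\<in>UNIV. (if a = s then 1 else 0) * f s) = (f (a::'n::finite) :: real)"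
  by (simp add: delta_mult)

lemma sum_delta_right: "(\<Sum>s\<in>UNIV. f s * (if s = a then 1 else 0)) = (f (a::'n::finite) :: real)"
  using sum_delta_left[of a f] by (simp add: mult.commute eq_commute[of a])

text \<open>
  At a point where \<open>g = I\<close> the contractions with \<open>g\<^sup>-\<^sup>1\<close> disappear from all formulas. Only the
  derivatives of \<open>g\<^sup>-\<^sup>1\<close> have to be kept.
\<close>

locale flow_at_identity =
  fixes U :: "'n::finite field" and z
  assumes U: "MA_flow U" and z: "z \<in> Om" and id: "hess U z = mat 1"
begin

abbreviation "T \<equiv> \<lambda>i j k. DJ [i, j, k] U z"
abbreviation "Q \<equiv> \<lambda>i j k p. DJ [i, j, k, p] U z"

lemma sU: "smooth U" by (rule MA_flowD(1)[OF U z])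

sublocale symmetric_jets T Q
proof
  show "T i j k = T j i k" for i j k using DJ_swap[OF sU z, of "[]" i j "[k]"] by simp
  show "T i j k = T i k j" for i j k using DJ_swap[OF sU z, of "[i]" j k "[]"] by simp
  show "Q i j k p = Q j i k p" for i j k p using DJ_swap[OF sU z, of "[]" i j "[k, p]"] by simp
  show "Q i j k p = Q i k j p" for i j k p using DJ_swap[OF sU z, of "[i]" j k "[p]"] by simp
  show "Q i j k p = Q i j p k" for i j k p using DJ_swap[OF sU z, of "[i,j]" k p "[]"] by simp
qed

lemma ihess_id: "ihess U a b z = (if a = b then 1 else 0)"
proof -
  have "matrix_inv (hess U z) = mat 1" by (rule matrix_inv_eqI) (simp add: id)
  then show ?thesis by (simp add: ihess_def mat_def)
qed

lemma grad_inner_id: "grad_inner U f g z = (\<Sum>p\<in>UNIV. dX p f z * dX p g z)"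
  unfolding grad_inner_def ihess_id sum_delta_left ..

lemma dX_ihess_id: "dX i (ihess U a b) z = - T i a b"
proof -
  have "(\<Sum>t\<in>UNIV. ihess U a s z * T i s t * ihess U t b z) = ihess U a s z * T i s b" for s
    by (simp only: mult.assoc sum_distrib_left[symmetric] ihess_id sum_delta_right)
  then show ?thesis unfolding dX_ihess[OF U z] by (simp only: ihess_id sum_delta_left)
qed

lemma smooth_T: "smooth (DJ js U)" by (rule smooth_DJ[OF sU])

lemma T_differentiable: "DJ js U differentiable (at z)"
  by (rule smooth_differentiable[OF smooth_T z])

lemma ihess_differentiable: "ihess U a b differentiable (at z)"
  by (rule smooth_differentiable[OF smooth_ihess[OF U] z])

lemma dX2_ihess_id:
  "dX k (dX i (ihess U a b)) z =
   (\<Sum>s\<in>UNIV. T k a s * T i s b) + (\<Sum>s\<in>UNIV. T i a s * T k s b) - Q k i a b"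
proof -
  have d: "(\<lambda>y. ihess U a s y * DJ [i, s, t] U y) differentiable (at z)" for s t
    by (rule differentiable_mult[OF ihess_differentiable T_differentiable])
  have d2: "(\<lambda>y. ihess U a s y * DJ [i, s, t] U y * ihess U t b y) differentiable (at z)" for s t
    by (rule differentiable_mult[OF d ihess_differentiable])
  have d3: "(\<lambda>y. \<Sum>t\<in>UNIV. ihess U a s y * DJ [i, s, t] U y * ihess U t b y) differentiable (at z)" for s
    by (intro differentiable_sum ballI d2) simp
  have "dX k (dX i (ihess U a b)) z = dX k (\<lambda>y. (-1) * (\<Sum>s\<in>UNIV. \<Sum>t\<in>UNIV. ihess U a s y * DJ [i, s, t] U y * ihess U t b y)) z"
    by (rule dX_cong[OF z]) (simp only: dX_ihess[OF U] mult_minus1)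
  also have "\<dots> = - dX k (\<lambda>y. \<Sum>s\<in>UNIV. \<Sum>t\<in>UNIV. ihess U a s y * DJ [i, s, t] U y * ihess U t b y) z"
    unfolding dX_def[of k] by (subst dd_cmult) (auto intro!: differentiable_sum d3 simp del: DJ.simps)
  also have "dX k (\<lambda>y. \<Sum>s\<in>UNIV. \<Sum>t\<in>UNIV. ihess U a s y * DJ [i, s, t] U y * ihess U t b y) z
     = (\<Sum>s\<in>UNIV. \<Sum>t\<in>UNIV. ihess U a s z * T i s t * dX k (ihess U t b) z
          + (ihess U a s z * dX k (DJ [i, s, t] U) z + dX k (ihess U a s) z * T i s t) * ihess U t b z)"
    by (simp only: dX_sum[OF d3] dX_sum[OF d2] dX_mult[OF d ihess_differentiable]
        dX_mult[OF ihess_differentiable T_differentiable])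
  also have "\<dots> = (\<Sum>s\<in>UNIV. \<Sum>t\<in>UNIV. ihess U a s z * (T i s t * dX k (ihess U t b) z))
      + (\<Sum>s\<in>UNIV. \<Sum>t\<in>UNIV. ihess U a s z * (Q k i s t * ihess U t b z))
      + (\<Sum>s\<in>UNIV. \<Sum>t\<in>UNIV. (dX k (ihess U a s) z * T i s t) * ihess U t b z)"
    by (simp add: algebra_simps sum.distrib)
  also have "\<dots> = - (\<Sum>s\<in>UNIV. T i a s * T k s b) + Q k i a b - (\<Sum>s\<in>UNIV. T k a s * T i s b)"
    by (simp only: sum_distrib_left[symmetric] ihess_id sum_delta_left sum_delta_right dX_ihess_id
        mult_minus_left mult_minus_right sum_negf)
  finally show ?thesis by simp
qed

lemma dXT: "dX p (DJ [i, j, k] U) z = Q p i j k" by simp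

lemma heat_T: "heat U (DJ [k, i, j] U) z = H3 i j k"
proof -
  have d: "(\<lambda>y. dX i (ihess U a b) y * DJ [a, b, j] U y) differentiable (at z)" for a b
    by (intro differentiable_mult T_differentiable smooth_differentiable[OF smooth_dX[OF smooth_ihess[OF U]] z])
  have d2: "(\<lambda>y. \<Sum>b\<in>UNIV. dX i (ihess U a b) y * DJ [a, b, j] U y) differentiable (at z)" for a
    by (intro differentiable_sum ballI d) simp
  have "heat U (DJ [k, i, j] U) z = dX k (heat U (DJ [i, j] U)) z
      + (\<Sum>a\<in>UNIV. \<Sum>b\<in>UNIV. dX k (ihess U a b) z * Q a b i j)"
    using heat_dX[OF U smooth_T[of "[i,j]"] z, of k] by simp
  also have "dX k (heat U (DJ [i, j] U)) z = dX k (\<lambda>y. \<Sum>a\<in>UNIV. \<Sum>b\<in>UNIV. dX i (ihess U a b) y * DJ [a, b, j] U y) z"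
    by (rule dX_cong[OF z]) (rule heat_second_derivative[OF U])
  also have "\<dots> = (\<Sum>a\<in>UNIV. \<Sum>b\<in>UNIV. dX i (ihess U a b) z * dX k (DJ [a, b, j] U) z + dX k (dX i (ihess U a b)) z * T a b j)"
    by (simp only: dX_sum[OF d2] dX_sum[OF d]
        dX_mult[OF smooth_differentiable[OF smooth_dX[OF smooth_ihess[OF U]] z] T_differentiable])
  finally have "heat U (DJ [k, i, j] U) z =
      (\<Sum>a\<in>UNIV. \<Sum>b\<in>UNIV. - T i a b * Q k a b j +
         ((\<Sum>s\<in>UNIV. T k a s * T i s b) + (\<Sum>s\<in>UNIV. T i a s * T k s b) - Q k i a b) * T a b j)
      + (\<Sum>a\<in>UNIV. \<Sum>b\<in>UNIV. - T k a b * Q a b i j)"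
    unfolding dX_ihess_id dX2_ihess_id dXT .
  also have "\<dots> = (\<Sum>a\<in>UNIV. \<Sum>b\<in>UNIV. \<Sum>s\<in>UNIV. T k a s * (T i s b * T b a j))
      + (\<Sum>a\<in>UNIV. \<Sum>b\<in>UNIV. \<Sum>s\<in>UNIV. T k s b * (T i s a * T a b j))
      - (\<Sum>a\<in>UNIV. \<Sum>b\<in>UNIV. Q i k a b * T j a b) - (\<Sum>a\<in>UNIV. \<Sum>b\<in>UNIV. Q j k a b * T i a b)
      - (\<Sum>a\<in>UNIV. \<Sum>b\<in>UNIV. Q i j a b * T k a b)"
  proof -
    have e: "- T i a b * Q k a b j +
         ((\<Sum>s\<in>UNIV. T k a s * T i s b) + (\<Sum>s\<in>UNIV. T i a s * T k s b) - Q k i a b) * T a b j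
       = (\<Sum>s\<in>UNIV. T k a s * (T i s b * T b a j)) + (\<Sum>s\<in>UNIV. T k s b * (T i s a * T a b j))
         - Q i k a b * T j a b - Q j k a b * T i a b" for a b
    proof -
      have "(\<Sum>s\<in>UNIV. T k a s * (T i s b * T b a j)) = (\<Sum>s\<in>UNIV. T k a s * T i s b) * T a b j"
        by (simp only: sum_distrib_right mult.assoc T12[of b a j])
      moreover have "(\<Sum>s\<in>UNIV. T k s b * (T i s a * T a b j)) = (\<Sum>s\<in>UNIV. T i a s * T k s b) * T a b j"
        by (simp only: sum_distrib_left T23[of i a] mult_ac)
      ultimately show ?thesis
        by (simp only: Qsym(1)[of k i] Qsym(2)[of k _ _ j] Trot[of a b j]) (simp only: algebra_simps)
    qed
    show ?thesis
      unfolding e Qsym(3)[of _ _ i j] by (simp add: sum.distrib sum_subtractf sum_negf mult.commute[of "T k _ _"] del: DJ.simps)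
  qed
  also have "(\<Sum>a\<in>UNIV. \<Sum>b\<in>UNIV. \<Sum>s\<in>UNIV. T k a s * (T i s b * T b a j)) = (\<Sum>a\<in>UNIV. \<Sum>b\<in>UNIV. Y i a b j * T k a b)"
  proof -
    have "(\<Sum>a\<in>UNIV. \<Sum>b\<in>UNIV. \<Sum>s\<in>UNIV. T k a s * (T i s b * T b a j)) = (\<Sum>a\<in>UNIV. \<Sum>s\<in>UNIV. T k a s * Y i s a j)"
      unfolding Y_def sum_distrib_left by (rule sum.cong[OF refl]) (rule sum.swap)
    also have "\<dots> = (\<Sum>s\<in>UNIV. \<Sum>a\<in>UNIV. Y i s a j * T k s a)"
      by (subst sum.swap) (simp only: T23[of k] mult.commute)
    finally show ?thesis .
  qed
  also have "(\<Sum>a\<in>UNIV. \<Sum>b\<in>UNIV. \<Sum>s\<in>UNIV. T k s b * (T i s a * T a b j)) = (\<Sum>a\<in>UNIV. \<Sum>b\<in>UNIV. Y i a b j * T k a b)"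
  proof -
    have "(\<Sum>a\<in>UNIV. \<Sum>b\<in>UNIV. \<Sum>s\<in>UNIV. T k s b * (T i s a * T a b j)) = (\<Sum>b\<in>UNIV. \<Sum>s\<in>UNIV. T k s b * Y i s b j)"
      unfolding Y_def sum_distrib_left by (rule sum_rotate3)
    also have "\<dots> = (\<Sum>s\<in>UNIV. \<Sum>b\<in>UNIV. Y i s b j * T k s b)"
      by (subst sum.swap) (simp only: mult.commute)
    finally show ?thesis .
  qed
  finally show ?thesis unfolding H3_def by simp
qed

lemma hess_id: "DJ [i, b] U z = (if i = b then 1 else 0)"
  using id unfolding hess_def mat_def vec_eq_iff by simp

text \<open>
  Applying \<open>L\<close> to \<open>g g\<^sup>-\<^sup>1 = I\<close> gives \<open>L g\<^sup>-\<^sup>1 = - L g - 2 rho\<close>, where the last term comes from the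
  product of the gradients, and \<open>L g = - rho\<close>.
\<close>

lemma heat_ihess_id: "heat U (ihess U i a) z = - rho i a"
proof -
  have "heat U (\<lambda>y. \<Sum>b\<in>UNIV. DJ [i, b] U y * ihess U b a y) z = (\<Sum>b\<in>UNIV. heat U (\<lambda>y. DJ [i, b] U y * ihess U b a y) z)"
    by (intro heat_sum z smooth_fun_on_mult open_Om smooth_T smooth_ihess U) simp
  also have "\<dots> = (\<Sum>b\<in>UNIV. DJ [i, b] U z * heat U (ihess U b a) z + ihess U b a z * heat U (DJ [i, b] U) z
       - 2 * grad_inner U (DJ [i, b] U) (ihess U b a) z)"
    by (intro sum.cong refl heat_mult U smooth_T smooth_ihess z)
  also have "\<dots> = heat U (ihess U i a) z + heat U (DJ [i, a] U) z - 2 * (\<Sum>b\<in>UNIV. grad_inner U (DJ [i, b] U) (ihess U b a) z)"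
  proof -
    have "(\<Sum>b\<in>UNIV. ihess U b a z * heat U (DJ [i, b] U) z) = heat U (DJ [i, a] U) z"
      using sum_delta_right[of "\<lambda>b. heat U (DJ [i, b] U) z" a] by (simp only: ihess_id mult.commute)
    then show ?thesis
      by (simp only: sum.distrib sum_subtractf hess_id sum_delta_left sum_distrib_left)
  qed
  also have "(\<Sum>b\<in>UNIV. grad_inner U (DJ [i, b] U) (ihess U b a) z) = - rho i a"
    unfolding grad_inner_id dX_ihess_id rho_def sum_negf[symmetric]
  proof (intro sum.cong refl)
    fix b p
    have "T i b p = T p i b" by (rule Trot)
    moreover have "T a b p = T p b a" by (rule trans[OF Trot T23])
    ultimately show "dX p (DJ [i, b] U) z * - T p b a = - (T i b p * T a b p)" by simp
  qed
  also have "heat U (DJ [i, a] U) z = - rho i a"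
    unfolding heat_second_derivative[OF U z] dX_ihess_id rho_def
    by (simp only: Trot[of _ _ a] mult_minus_left sum_negf)
  finally have "heat U (\<lambda>y. \<Sum>b\<in>UNIV. DJ [i, b] U y * ihess U b a y) z = heat U (ihess U i a) z + rho i a" by simp
  moreover have "heat U (\<lambda>y. \<Sum>b\<in>UNIV. DJ [i, b] U y * ihess U b a y) z = heat U (\<lambda>y. if i = a then 1 else 0) z"
  proof (rule heat_cong[OF z])
    fix y :: "'n::finite spacetime" assume y: "y \<in> Om"
    show "(\<Sum>b\<in>UNIV. DJ [i, b] U y * ihess U b a y) = (if i = a then 1 else 0)"
      using matrix_inv_sum(1)[OF MA_flowD(2)[OF U y]] by (simp add: ihess_def hess_def)
  qed
  ultimately show ?thesis by simp
qed

text \<open>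
  Since \<open>g = I\<close> at the point, raising one index leaves the value unchanged and alters the first derivatives and
  \<open>L\<close> by contractions with \<open>T\<close>. The indices of
  the third derivatives are raised one after the other with this lemma, which avoids differentiating a product of five
  factors at once.
\<close>

lemma raise_index:
  assumes F: "\<And>a. smooth (F a)"
  shows "smooth (\<lambda>y. \<Sum>a\<in>UNIV. ihess U i a y * F a y)"
    "(\<Sum>a\<in>UNIV. ihess U i a z * F a z) = F i z"
    "dX p (\<lambda>y. \<Sum>a\<in>UNIV. ihess U i a y * F a y) z = dX p (F i) z - (\<Sum>a\<in>UNIV. T i p a * F a z)"
    "heat U (\<lambda>y. \<Sum>a\<in>UNIV. ihess U i a y * F a y) z =
       heat U (F i) z - (\<Sum>a\<in>UNIV. rho i a * F a z) + 2 * (\<Sum>a\<in>UNIV. \<Sum>p\<in>UNIV. dX p (F a) z * T i a p)"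
proof -
  note d = ihess_differentiable smooth_differentiable[OF F z]
  show "smooth (\<lambda>y. \<Sum>a\<in>UNIV. ihess U i a y * F a y)"
    by (intro smooth_fun_on_sum smooth_fun_on_mult open_Om smooth_ihess U F)
  show "(\<Sum>a\<in>UNIV. ihess U i a z * F a z) = F i z" by (simp only: ihess_id sum_delta_left)
  have "dX p (ihess U i a) z = - T i p a" for p a
    unfolding dX_ihess_id using T12[of p i a] by simp
  then show "dX p (\<lambda>y. \<Sum>a\<in>UNIV. ihess U i a y * F a y) z = dX p (F i) z - (\<Sum>a\<in>UNIV. T i p a * F a z)"
    by (simp only: dX_sum[OF differentiable_mult[OF d]] dX_mult[OF d] sum.distrib ihess_id sum_delta_left
        mult_minus_left sum_negf)
  have "heat U (\<lambda>y. \<Sum>a\<in>UNIV. ihess U i a y * F a y) z = (\<Sum>a\<in>UNIV. heat U (\<lambda>y. ihess U i a y * F a y) z)"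
    by (intro heat_sum z smooth_fun_on_mult open_Om smooth_ihess U F) simp
  also have "\<dots> = (\<Sum>a\<in>UNIV. ihess U i a z * heat U (F a) z + F a z * heat U (ihess U i a) z - 2 * grad_inner U (ihess U i a) (F a) z)"
    by (intro sum.cong refl heat_mult U smooth_ihess z F)
  also have "\<dots> = heat U (F i) z - (\<Sum>a\<in>UNIV. rho i a * F a z) - 2 * (\<Sum>a\<in>UNIV. grad_inner U (ihess U i a) (F a) z)"
    by (simp only: sum.distrib sum_subtractf ihess_id sum_delta_left heat_ihess_id mult_minus_right sum_negf
        sum_distrib_left mult.commute[of "F _ z"])
  also have "(\<Sum>a\<in>UNIV. grad_inner U (ihess U i a) (F a) z) = - (\<Sum>a\<in>UNIV. \<Sum>p\<in>UNIV. dX p (F a) z * T i a p)"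
    unfolding grad_inner_id dX_ihess_id sum_negf[symmetric]
    by (intro sum.cong refl) (simp add: Trot[of i] del: DJ.simps)
  finally show "heat U (\<lambda>y. \<Sum>a\<in>UNIV. ihess U i a y * F a y) z =
       heat U (F i) z - (\<Sum>a\<in>UNIV. rho i a * F a z) + 2 * (\<Sum>a\<in>UNIV. \<Sum>p\<in>UNIV. dX p (F a) z * T i a p)"
    by simp
qed

end

definition raised :: "'n::finite field \<Rightarrow> 'n \<Rightarrow> 'n \<Rightarrow> 'n \<Rightarrow> 'n field" where
  "raised U i j k y = (\<Sum>c\<in>UNIV. ihess U k c y * (\<Sum>b\<in>UNIV. ihess U j b y * (\<Sum>a\<in>UNIV. ihess U i a y * DJ [a, b, c] U y)))"

text \<open>
  Calabi's quantity, the squared norm of the third derivatives in the metric \<open>g\<close>.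
\<close>

definition calabi :: "'n::finite field \<Rightarrow> 'n field" where
  "calabi U y = (\<Sum>i\<in>UNIV. \<Sum>j\<in>UNIV. \<Sum>k\<in>UNIV. DJ [i, j, k] U y * raised U i j k y)"

lemma smooth_raised: "MA_flow U \<Longrightarrow> smooth (raised U i j k)"
  unfolding raised_def[abs_def]
  by (intro smooth_fun_on_sum smooth_fun_on_mult open_Om smooth_ihess smooth_DJ) (auto simp: MA_flow_def)

lemma smooth_calabi: "MA_flow U \<Longrightarrow> smooth (calabi U)"
  unfolding calabi_def[abs_def]
  by (intro smooth_fun_on_sum smooth_fun_on_mult open_Om smooth_raised smooth_DJ) (auto simp: MA_flow_def)

context flow_at_identity
begin

lemma dX_DJ3: "dX p (DJ [i, j, k] U) z = Q i j k p"
proof -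
  have "Q p i j k = Q i p j k" by (rule Q12)
  also have "\<dots> = Q i j p k" by (rule Q23)
  also have "\<dots> = Q i j k p" by (rule Q34)
  finally show ?thesis unfolding dXT .
qed

lemma heat_DJ3: "heat U (DJ [i, j, k] U) z = H3 i j k"
proof -
  have "heat U (DJ [i, j, k] U) z = heat U (DJ [k, i, j] U) z"
  proof (rule heat_cong[OF z])
    fix y :: "'n::finite spacetime" assume y: "y \<in> Om"
    show "DJ [i, j, k] U y = DJ [k, i, j] U y"
      using DJ_swap[OF sU y, of "[i]" j k "[]"] DJ_swap[OF sU y, of "[]" i k "[j]"] by simp
  qed
  then show ?thesis unfolding heat_T .
qed

lemma raised_jets:
  "raised U i j k z = T i j k"
  "dX p (raised U i j k) z = G3 i j k p"
  "heat U (raised U i j k) z = R3 i j k"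
proof -
  define F1 where "F1 i j k y = (\<Sum>a\<in>UNIV. ihess U i a y * DJ [a, j, k] U y)" for i j k y
  define F2 where "F2 i j k y = (\<Sum>b\<in>UNIV. ihess U j b y * F1 i b k y)" for i j k y
  have ra: "raised U i j k = (\<lambda>y. \<Sum>c\<in>UNIV. ihess U k c y * F2 i j c y)" for i j k
    by (simp only: raised_def[abs_def] F1_def F2_def)
  have Q2: "dX p (DJ [a, j, k] U) z = Q j k a p" for a j k p
    by (rule trans[OF dX_DJ3 Qsym(4)])
  have F1: "smooth (F1 i j k)" "F1 i j k z = T i j k" "dX p (F1 i j k) z = Q i j k p - Y i p j k"
    "heat U (F1 i j k) z = H3 i j k - (\<Sum>a\<in>UNIV. rho i a * T a j k) + 2 * (\<Sum>a\<in>UNIV. \<Sum>p\<in>UNIV. Q j k a p * T i a p)"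
    for i j k p
  proof -
    note r = raise_index[where F = "\<lambda>a. DJ [a, j, k] U" and i = i, OF smooth_T]
    show "smooth (F1 i j k)" "F1 i j k z = T i j k" using r(1,2) unfolding F1_def[abs_def] .
    show "dX p (F1 i j k) z = Q i j k p - Y i p j k"
      using r(3) unfolding dX_DJ3 Y_def F1_def[abs_def] .
    show "heat U (F1 i j k) z = H3 i j k - (\<Sum>a\<in>UNIV. rho i a * T a j k) + 2 * (\<Sum>a\<in>UNIV. \<Sum>p\<in>UNIV. Q j k a p * T i a p)"
      using r(4) unfolding Q2 heat_DJ3 F1_def[abs_def] .
  qed
  have F2: "smooth (F2 i j k)" "F2 i j k z = T i j k" "dX p (F2 i j k) z = Q i j k p - Y i p j k - Y j p i k"
    "heat U (F2 i j k) z = H3 i j k - (\<Sum>a\<in>UNIV. rho i a * T a j k) + 2 * (\<Sum>a\<in>UNIV. \<Sum>p\<in>UNIV. Q j k a p * T i a p)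
      - (\<Sum>a\<in>UNIV. rho j a * T i a k) + 2 * (\<Sum>a\<in>UNIV. \<Sum>p\<in>UNIV. (Q i k a p - Y i p a k) * T j a p)"
    for i j k p
  proof -
    have Q3: "Q i a k p = Q i k a p" for a p by (rule Q23)
    have T3: "T i b k = T b i k" for b by (rule T12)
    note r = raise_index[where F = "\<lambda>b. F1 i b k" and i = j, OF F1(1)]
    show "smooth (F2 i j k)" "F2 i j k z = T i j k" using r(1,2) unfolding F1(2) F2_def[abs_def] .
    show "dX p (F2 i j k) z = Q i j k p - Y i p j k - Y j p i k"
      using r(3) unfolding F1(2,3) T3 Y_def[of j p i k] F2_def[abs_def] .
    show "heat U (F2 i j k) z = H3 i j k - (\<Sum>a\<in>UNIV. rho i a * T a j k) + 2 * (\<Sum>a\<in>UNIV. \<Sum>p\<in>UNIV. Q j k a p * T i a p)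
      - (\<Sum>a\<in>UNIV. rho j a * T i a k) + 2 * (\<Sum>a\<in>UNIV. \<Sum>p\<in>UNIV. (Q i k a p - Y i p a k) * T j a p)"
      using r(4) unfolding F1(2,3,4) Q3 F2_def[abs_def] .
  qed
  note r = raise_index[where F = "\<lambda>c. F2 i j c" and i = k, OF F2(1)]
  show "raised U i j k z = T i j k" using r(2) unfolding F2(2) ra .
  have T3: "T i j c = T c i j" for c by (rule Trot)
  show "dX p (raised U i j k) z = G3 i j k p"
    using r(3) unfolding F2(2,3) T3 Y_def[of k p i j] G3_def ra .
  show "heat U (raised U i j k) z = R3 i j k"
    using r(4) unfolding F2(2,3,4) R3_def ra by simp
qed

lemma calabi_id: "calabi U z = (\<Sum>i\<in>UNIV. rho i i)"
  unfolding calabi_def raised_jets rho_def ..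

lemma heat_calabi_id: "heat U (calabi U) z \<le> - ((calabi U z)\<^sup>2 / (2 * real CARD('n)))"
proof -
  have s1: "smooth (\<lambda>y. DJ [i, j, k] U y * raised U i j k y)" for i j k
    by (intro smooth_fun_on_mult open_Om smooth_T smooth_raised U)
  have s2: "smooth (\<lambda>y. \<Sum>k\<in>UNIV. DJ [i, j, k] U y * raised U i j k y)" for i j
    by (intro smooth_fun_on_sum open_Om s1)
  have s3: "smooth (\<lambda>y. \<Sum>j\<in>UNIV. \<Sum>k\<in>UNIV. DJ [i, j, k] U y * raised U i j k y)" for i
    by (intro smooth_fun_on_sum open_Om s2)
  have "heat U (calabi U) z = (\<Sum>i\<in>UNIV. \<Sum>j\<in>UNIV. \<Sum>k\<in>UNIV. heat U (\<lambda>y. DJ [i, j, k] U y * raised U i j k y) z)"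
    unfolding calabi_def[abs_def] by (simp only: heat_sum[OF s3 z finite] heat_sum[OF s2 z finite] heat_sum[OF s1 z finite])
  also have "\<dots> = (\<Sum>i\<in>UNIV. \<Sum>j\<in>UNIV. \<Sum>k\<in>UNIV. T i j k * R3 i j k + T i j k * H3 i j k - 2 * (\<Sum>p\<in>UNIV. G3 i j k p * Q i j k p))"
  proof (intro sum.cong refl)
    fix i j k
    have "heat U (\<lambda>y. DJ [i, j, k] U y * raised U i j k y) z =
      T i j k * R3 i j k + T i j k * heat U (DJ [i, j, k] U) z - 2 * (\<Sum>p\<in>UNIV. dX p (DJ [i, j, k] U) z * G3 i j k p)"
      unfolding heat_mult[OF U smooth_T smooth_raised[OF U] z] raised_jets grad_inner_id ..
    then show "heat U (\<lambda>y. DJ [i, j, k] U y * raised U i j k y) z =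
       T i j k * R3 i j k + T i j k * H3 i j k - 2 * (\<Sum>p\<in>UNIV. G3 i j k p * Q i j k p)"
      unfolding heat_DJ3 dX_DJ3 by (simp only: mult.commute)
  qed
  also have "\<dots> \<le> - ((calabi U z)\<^sup>2 / (2 * real CARD('n)))"
    unfolding calabi_id by (rule calabi_inequality)
  finally show ?thesis .
qed

end

section \<open>Linear changes of variables and the third derivatives\<close>

definition lin_change :: "real^'n^'n \<Rightarrow> real \<Rightarrow> 'n::finite spacetime \<Rightarrow> 'n spacetime" where
  "lin_change P s w = (P *v fst w, s * snd w)"

lemma bounded_linear_lin_change: "bounded_linear (lin_change P s)"
  unfolding lin_change_def[abs_def]
  by (intro bounded_linear_Pair bounded_linear_compose[OF matrix_vector_mul_bounded_linear bounded_linear_fst]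
      bounded_linear_compose[OF bounded_linear_mult_right bounded_linear_snd])

lemma lin_change_Om: "0 < s \<Longrightarrow> y \<in> Om \<Longrightarrow> lin_change P s y \<in> Om"
  by (auto simp: lin_change_def)

lemma smooth_lin_change:
  assumes "0 < s" "smooth f"
  shows "smooth (\<lambda>w. f (lin_change P s w))"
  by (rule smooth_fun_on_comp_linear[OF bounded_linear_lin_change open_Om lin_change_Om assms(2)])
     (use assms in auto)

lemma dX_lin_change:
  assumes "0 < s" "smooth f" "y \<in> Om"
  shows "dX i (\<lambda>w. f (lin_change P s w)) y = (\<Sum>a\<in>UNIV. P$a$i * dX a f (lin_change P s y))"
proof -
  have d: "f differentiable (at (lin_change P s y))"
    by (intro smooth_differentiable assms lin_change_Om)
  have "lin_change P s (axis i 1, 0) = (column i P, 0)"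
    by (simp add: lin_change_def matrix_vector_mult_basis)
  then have "dX i (\<lambda>w. f (lin_change P s w)) y = dd (column i P, 0) f (lin_change P s y)"
    unfolding dX_def dd_comp_linear[OF bounded_linear_lin_change d] by simp
  then show ?thesis by (simp add: dd_space_direction[OF d] column_def)
qed

lemma dT_lin_change:
  assumes "0 < s" "smooth f" "y \<in> Om"
  shows "dT (\<lambda>w. f (lin_change P s w)) y = s * dT f (lin_change P s y)"
proof -
  have d: "f differentiable (at (lin_change P s y))"
    by (intro smooth_differentiable assms lin_change_Om)
  have "lin_change P s (0, 1) = s *\<^sub>R (0, 1)" by (simp add: lin_change_def)
  then show ?thesis unfolding dT_def dd_comp_linear[OF bounded_linear_lin_change d]
    using linear_cmul[OF dd_linear[OF d]] by (simp only: real_scaleR_def)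
qed

lemma dX_sum_lin_change:
  assumes "0 < s" "\<And>b. smooth (f b)" "y \<in> Om"
  shows "dX i (\<lambda>w. \<Sum>b\<in>UNIV. c b * f b (lin_change P s w)) y =
    (\<Sum>b\<in>UNIV. c b * (\<Sum>a\<in>UNIV. P$a$i * dX a (f b) (lin_change P s y)))"
proof -
  have d: "(\<lambda>w. f b (lin_change P s w)) differentiable (at y)" for b
    by (intro smooth_differentiable[OF smooth_lin_change] assms)
  have "dX i (\<lambda>w. \<Sum>b\<in>UNIV. c b * f b (lin_change P s w)) y = (\<Sum>b\<in>UNIV. dX i (\<lambda>w. c b * f b (lin_change P s w)) y)"
    by (rule dX_sum) (intro differentiable_mult d differentiable_const)
  also have "\<dots> = (\<Sum>b\<in>UNIV. c b * dX i (\<lambda>w. f b (lin_change P s w)) y)"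
    unfolding dX_def by (simp only: dd_cmult[OF d])
  finally show ?thesis by (simp only: dX_lin_change[OF assms(1,2,3)])
qed

lemma dX2_lin_change:
  assumes "0 < s" "smooth f" "y \<in> Om"
  shows "dX i (dX j (\<lambda>w. f (lin_change P s w))) y =
    (\<Sum>b\<in>UNIV. P$b$j * (\<Sum>a\<in>UNIV. P$a$i * dX a (dX b f) (lin_change P s y)))"
proof -
  have "dX i (dX j (\<lambda>w. f (lin_change P s w))) y = dX i (\<lambda>w. \<Sum>b\<in>UNIV. P$b$j * dX b f (lin_change P s w)) y"
    by (rule dX_cong[OF assms(3)]) (rule dX_lin_change[OF assms(1,2)])
  also have "\<dots> = (\<Sum>b\<in>UNIV. P$b$j * (\<Sum>a\<in>UNIV. P$a$i * dX a (dX b f) (lin_change P s y)))"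
    by (rule dX_sum_lin_change) (intro assms smooth_dX)+
  finally show ?thesis .
qed

text \<open>
  Each of the three indices has its own matrix, so that a change of basis can be carried out in one index
  at a time.
\<close>

definition cubic_form :: "('n::finite \<Rightarrow> 'n \<Rightarrow> real) \<Rightarrow> ('n \<Rightarrow> 'n \<Rightarrow> real) \<Rightarrow> ('n \<Rightarrow> 'n \<Rightarrow> real) \<Rightarrow> ('n \<Rightarrow> 'n \<Rightarrow> 'n \<Rightarrow> real) \<Rightarrow> real" where
  "cubic_form B1 B2 B3 T = (\<Sum>i\<in>UNIV. \<Sum>j\<in>UNIV. \<Sum>k\<in>UNIV. T i j k *
     (\<Sum>c\<in>UNIV. B3 k c * (\<Sum>b\<in>UNIV. B2 j b * (\<Sum>a\<in>UNIV. B1 i a * T a b c))))"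

text \<open>
  The operations for one index are stated for the last index only; rotating brings each index there.
\<close>

lemma cubic_form_rotate: "cubic_form B1 B2 B3 T = cubic_form B3 B1 B2 (\<lambda>k i j. T i j k)"
proof -
  have e: "(\<Sum>c\<in>UNIV. B3 k c * (\<Sum>b\<in>UNIV. B2 j b * (\<Sum>a\<in>UNIV. B1 i a * T a b c)))
     = (\<Sum>b\<in>UNIV. B2 j b * (\<Sum>a\<in>UNIV. B1 i a * (\<Sum>c\<in>UNIV. B3 k c * T a b c)))" for i j k
    using sum_rotate3[of "\<lambda>c b a. B3 k c * (B2 j b * (B1 i a * T a b c))" UNIV UNIV UNIV]
    by (simp only: sum_distrib_left mult.left_commute)
  show ?thesis unfolding cubic_form_def e by (rule sum_rotate3[symmetric])
qed

lemma contract_slot: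
  fixes BU BV P :: "'n::finite \<Rightarrow> 'n \<Rightarrow> real"
  assumes "\<And>c d. BU c d = (\<Sum>a\<in>UNIV. \<Sum>b\<in>UNIV. P c a * (BV a b * P d b))"
  shows "(\<Sum>k\<in>UNIV. f k * (\<Sum>c\<in>UNIV. BU k c * g c)) =
     (\<Sum>k\<in>UNIV. (\<Sum>m\<in>UNIV. P m k * f m) * (\<Sum>c\<in>UNIV. BV k c * (\<Sum>m\<in>UNIV. P m c * g m)))"
proof -
  have "(\<Sum>k\<in>UNIV. f k * (\<Sum>c\<in>UNIV. BU k c * g c)) =
     (\<Sum>k\<in>UNIV. \<Sum>c\<in>UNIV. \<Sum>a\<in>UNIV. \<Sum>b\<in>UNIV. (P k a * f k) * (BV a b * (P c b * g c)))"
    unfolding assms by (simp only: sum_distrib_left sum_distrib_right mult_ac)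
  also have "\<dots> = (\<Sum>a\<in>UNIV. \<Sum>b\<in>UNIV. \<Sum>k\<in>UNIV. \<Sum>c\<in>UNIV. (P k a * f k) * (BV a b * (P c b * g c)))"
    by (rule sum_swap22)
  also have "\<dots> = (\<Sum>a\<in>UNIV. \<Sum>b\<in>UNIV. (\<Sum>k\<in>UNIV. P k a * f k) * (BV a b * (\<Sum>c\<in>UNIV. P c b * g c)))"
    by (simp only: sum_distrib_left[symmetric] sum_distrib_right[symmetric])
  finally show ?thesis by (simp only: sum_distrib_left[symmetric])
qed

lemma cubic_form_slot:
  fixes BU BV P :: "'n::finite \<Rightarrow> 'n \<Rightarrow> real"
  assumes "\<And>c d. BU c d = (\<Sum>a\<in>UNIV. \<Sum>b\<in>UNIV. P c a * (BV a b * P d b))"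
  shows "cubic_form B1 B2 BU T = cubic_form B1 B2 BV (\<lambda>i j k. \<Sum>m\<in>UNIV. P m k * T i j m)"
proof -
  have "(\<Sum>m\<in>UNIV. P m c * (\<Sum>b\<in>UNIV. B2 j b * (\<Sum>a\<in>UNIV. B1 i a * T a b m)))
    = (\<Sum>b\<in>UNIV. B2 j b * (\<Sum>a\<in>UNIV. B1 i a * (\<Sum>m\<in>UNIV. P m c * T a b m)))" for i j c
    using sum_rotate3[of "\<lambda>m b a. P m c * (B2 j b * (B1 i a * T a b m))" UNIV UNIV UNIV]
    by (simp only: sum_distrib_left mult.left_commute)
  then show ?thesis unfolding cubic_form_def contract_slot[OF assms] by simp
qed

lemma cubic_form_transform:
  fixes BU BV P :: "'n::finite \<Rightarrow> 'n \<Rightarrow> real"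
  assumes "\<And>c d. BU c d = (\<Sum>a\<in>UNIV. \<Sum>b\<in>UNIV. P c a * (BV a b * P d b))"
  shows "cubic_form BU BU BU T = cubic_form BV BV BV
    (\<lambda>i j k. \<Sum>a\<in>UNIV. P a i * (\<Sum>b\<in>UNIV. P b j * (\<Sum>c\<in>UNIV. P c k * T a b c)))"
proof -
  \<comment> \<open>Three rounds of changing the last index and rotating restore the original order of the indices.\<close>
  note s = cubic_form_slot[OF assms] and r = cubic_form_rotate
  have "cubic_form BU BU BU T = cubic_form BV BU BU (\<lambda>k i j. \<Sum>c\<in>UNIV. P c k * T i j c)"
    by (subst s, subst r) (rule refl)
  also have "\<dots> = cubic_form BV BV BU (\<lambda>j k i. \<Sum>b\<in>UNIV. P b j * (\<Sum>c\<in>UNIV. P c k * T i b c))"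
    by (subst s, subst r) (rule refl)
  also have "\<dots> = cubic_form BV BV BV
    (\<lambda>i j k. \<Sum>a\<in>UNIV. P a i * (\<Sum>b\<in>UNIV. P b j * (\<Sum>c\<in>UNIV. P c k * T a b c)))"
    by (subst s, subst r) (rule refl)
  finally show ?thesis .
qed

lemma calabi_cubic_form:
  "calabi U y = cubic_form (\<lambda>a b. ihess U a b y) (\<lambda>a b. ihess U a b y) (\<lambda>a b. ihess U a b y) (\<lambda>i j k. DJ [i, j, k] U y)"
  unfolding calabi_def raised_def cubic_form_def ..

text \<open>
  In the coordinates given by an orthonormal frame at \<open>z\<close> the function \<open>U\<close> becomes \<open>V\<close>, with the Hessian \<open>I\<close> at
  the point \<open>y\<close> that corresponds to \<open>z\<close>.
\<close>

locale flow_frame =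
  fixes U :: "'n::finite field" and z and p :: "'n \<Rightarrow> real^'n"
  assumes U: "MA_flow U" and z: "z \<in> Om" and fr: "orthonormal_frame (hess U z) p"
begin

definition P :: "real^'n^'n" where "P = (\<chi> i j. p j $ i)"
definition V where "V w = U (lin_change P 1 w)"
definition y where "y = (matrix_inv P *v fst z, snd z)"

abbreviation "L \<equiv> lin_change P 1"

lemma sU: "smooth U" by (rule MA_flowD(1)[OF U z])

lemma LOm: "w \<in> Om \<Longrightarrow> L w \<in> Om" by (rule lin_change_Om) auto

lemma P_frame: "transpose P ** hess U z ** P = mat 1"
  using fr unfolding orthonormal_frame_def vec_eq_iff inner_vec_def matrix_mul_assoc[symmetric]
  by (simp add: P_def transpose_def matrix_matrix_mult_def mat_def matrix_vector_mult_def)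

lemma detP: "det P \<noteq> 0"
proof
  assume "det P = 0"
  then have "det (transpose P ** hess U z ** P) = 0" by (simp add: det_mul)
  then show False using P_frame by simp
qed

lemma yOm: "y \<in> Om" using z by (auto simp: y_def)

lemma Ly: "L y = z"
  by (simp add: y_def lin_change_def matrix_vector_mul_assoc matrix_inv_mult[OF detP])

lemma DJ2_V: "w \<in> Om \<Longrightarrow> DJ [i, j] V w = (\<Sum>b\<in>UNIV. P$b$j * (\<Sum>a\<in>UNIV. P$a$i * DJ [a, b] U (L w)))"
  unfolding V_def[abs_def] by (simp add: dX2_lin_change[OF _ sU])

lemma DJ3_V:
  assumes "w \<in> Om"
  shows "DJ [i, j, k] V w = (\<Sum>a\<in>UNIV. P$a$i * (\<Sum>b\<in>UNIV. P$b$j * (\<Sum>c\<in>UNIV. P$c$k * DJ [a, b, c] U (L w))))"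
proof -
  have "DJ [i, j, k] V w = dX i (\<lambda>w. \<Sum>c\<in>UNIV. P$c$k * (\<Sum>b\<in>UNIV. P$b$j * DJ [b, c] U (L w))) w"
    using DJ2_V by (simp only: DJ.simps(2)) (rule dX_cong[OF assms], simp)
  also have "\<dots> = (\<Sum>c\<in>UNIV. P$c$k * (\<Sum>a\<in>UNIV. P$a$i * dX a (\<lambda>w. \<Sum>b\<in>UNIV. P$b$j * DJ [b, c] U w) (L w)))"
    by (rule dX_sum_lin_change[where f = "\<lambda>c w. \<Sum>b\<in>UNIV. P$b$j * DJ [b, c] U w"])
       (intro smooth_fun_on_sum smooth_fun_on_mult open_Om smooth_fun_on_const smooth_DJ sU assms | simp)+
  also have "\<dots> = (\<Sum>c\<in>UNIV. P$c$k * (\<Sum>a\<in>UNIV. P$a$i * (\<Sum>b\<in>UNIV. P$b$j * DJ [a, b, c] U (L w))))"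
  proof -
    have d: "DJ [b, c] U differentiable (at (L w))" for b c
      by (rule smooth_differentiable[OF smooth_DJ[OF sU] LOm[OF assms]])
    have "dX a (\<lambda>w. \<Sum>b\<in>UNIV. P$b$j * DJ [b, c] U w) (L w) = (\<Sum>b\<in>UNIV. P$b$j * DJ [a, b, c] U (L w))" for a c
      using d unfolding dX_def[of a] by (simp add: dd_sum dd_cmult dX_def)
    then show ?thesis by (simp only:)
  qed
  also have "\<dots> = (\<Sum>c\<in>UNIV. \<Sum>a\<in>UNIV. \<Sum>b\<in>UNIV. P$a$i * (P$b$j * (P$c$k * DJ [a, b, c] U (L w))))"
    by (simp only: sum_distrib_left mult.left_commute)
  also have "\<dots> = (\<Sum>a\<in>UNIV. P$a$i * (\<Sum>b\<in>UNIV. P$b$j * (\<Sum>c\<in>UNIV. P$c$k * DJ [a, b, c] U (L w))))"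
    by (subst sum_rotate3) (simp only: sum_distrib_left)
  finally show ?thesis .
qed

lemma hess_V: "w \<in> Om \<Longrightarrow> hess V w = transpose P ** hess U (L w) ** P"
  unfolding hess_def
  by (simp add: vec_eq_iff matrix_matrix_mult_def transpose_def DJ2_V sum_distrib_left sum_distrib_right mult_ac
     del: DJ.simps)

lemma ihess_V:
  assumes "w \<in> Om"
  shows "ihess U c d (L w) = (\<Sum>a\<in>UNIV. \<Sum>b\<in>UNIV. P$c$a * (ihess V a b w * P$d$b))"
proof -
  let ?B = "matrix_inv (hess V w)"
  have "det (hess V w) \<noteq> 0" using detP MA_flowD(2)[OF U LOm[OF assms]] by (simp add: hess_V[OF assms] det_mul)
  then have "transpose P ** (hess U (L w) ** P ** ?B) = mat 1"
    using matrix_inv_mult(1) hess_V[OF assms] by (metis matrix_mul_assoc)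
  then have "hess U (L w) ** P ** ?B ** transpose P = mat 1"
    using matrix_left_right_inverse by metis
  then have "hess U (L w) ** (P ** ?B ** transpose P) = mat 1" by (simp add: matrix_mul_assoc)
  then have "matrix_inv (hess U (L w)) = P ** ?B ** transpose P" by (rule matrix_inv_eqI)
  then have "ihess U c d (L w) = (P ** (?B ** transpose P)) $ c $ d"
    by (simp add: ihess_def matrix_mul_assoc)
  then show ?thesis
    by (simp add: ihess_def matrix_matrix_mult_def transpose_def sum_distrib_left)
qed

lemma flow_V: "MA_flow V"
  unfolding MA_flow_def
proof (intro conjI ballI allI impI)
  show "smooth V" unfolding V_def[abs_def] by (rule smooth_lin_change[OF _ sU]) simp
  obtain c where c: "\<And>z. z \<in> Om \<Longrightarrow> real CARD('n) * dT U z = ln (det (hess U z)) + c"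
    using U unfolding MA_flow_def by blast
  have detV: "det (hess V w) = (det P)\<^sup>2 * det (hess U (L w))" if "w \<in> Om" for w
    by (simp add: hess_V[OF that] det_mul power2_eq_square)
  have P2: "0 < (det P)\<^sup>2" using detP by simp
  show "\<exists>c. \<forall>w\<in>Om. real CARD('n) * dT V w = ln (det (hess V w)) + c"
  proof (intro exI ballI)
    fix w :: "'n::finite spacetime" assume w: "w \<in> Om"
    have "dT V w = dT U (L w)" unfolding V_def[abs_def] by (simp add: dT_lin_change[OF _ sU w])
    then show "real CARD('n) * dT V w = ln (det (hess V w)) + (c - ln ((det P)\<^sup>2))"
      using c[OF LOm[OF w]] ln_mult[of "(det P)\<^sup>2" "det (hess U (L w))"] detP MA_flowD(2)[OF U LOm[OF w]]
      by (simp add: detV[OF w])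
  qed
  fix w :: "'n spacetime" assume w: "w \<in> Om"
  show "0 < det (hess V w)" using P2 MA_flowD(3)[OF U LOm[OF w]] by (simp add: detV[OF w])
  fix v :: "real^'n" assume v: "v \<noteq> 0"
  have "P *v v \<noteq> 0"
  proof
    assume "P *v v = 0"
    then have "(matrix_inv P ** P) *v v = 0" by (simp add: matrix_vector_mul_assoc[symmetric])
    then show False using v by (simp add: matrix_inv_mult[OF detP])
  qed
  moreover have "v \<bullet> (hess V w *v v) = (P *v v) \<bullet> (hess U (L w) *v (P *v v))"
    unfolding hess_V[OF w] matrix_vector_mul_assoc[symmetric]
    by (metis dot_lmul_matrix inner_commute transpose_matrix_vector)
  ultimately show "0 < v \<bullet> (hess V w *v v)" using MA_flowD(5)[OF U LOm[OF w]] by simp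
qed

lemma calabi_V: "w \<in> Om \<Longrightarrow> calabi V w = calabi U (L w)"
  unfolding calabi_cubic_form cubic_form_transform[where P = "\<lambda>i j. P$i$j", OF ihess_V] DJ3_V ..

lemma heat_V:
  assumes "smooth f" "w \<in> Om"
  shows "heat V (\<lambda>w. f (L w)) w = heat U f (L w)"
proof -
  have e: "dX a (dX b (\<lambda>w. f (L w))) w = (\<Sum>c\<in>UNIV. \<Sum>d\<in>UNIV. P$c$a * P$d$b * dX c (dX d f) (L w))" for a b
    unfolding dX2_lin_change[OF zero_less_one assms] sum_distrib_left
    by (subst sum.swap) (simp only: mult_ac)
  have "(\<Sum>c\<in>UNIV. \<Sum>d\<in>UNIV. ihess U c d (L w) * dX c (dX d f) (L w))
    = (\<Sum>c\<in>UNIV. \<Sum>d\<in>UNIV. \<Sum>a\<in>UNIV. \<Sum>b\<in>UNIV. ihess V a b w * (P$c$a * P$d$b * dX c (dX d f) (L w)))"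
    unfolding ihess_V[OF assms(2)] sum_distrib_right by (simp only: mult_ac)
  also have "\<dots> = (\<Sum>a\<in>UNIV. \<Sum>b\<in>UNIV. \<Sum>c\<in>UNIV. \<Sum>d\<in>UNIV. ihess V a b w * (P$c$a * P$d$b * dX c (dX d f) (L w)))"
    by (rule sum_swap22)
  also have "\<dots> = (\<Sum>a\<in>UNIV. \<Sum>b\<in>UNIV. ihess V a b w * dX a (dX b (\<lambda>w. f (L w))) w)"
    unfolding e sum_distrib_left ..
  finally show ?thesis unfolding heat_def dT_lin_change[OF zero_less_one assms] by simp
qed

lemma hess_V_y: "hess V y = mat 1"
  unfolding hess_V[OF yOm] Ly by (rule P_frame)

sublocale V: flow_at_identity V y
  by unfold_locales (rule flow_V yOm hess_V_y)+

lemma heat_calabi: "heat U (calabi U) z \<le> - ((calabi U z)\<^sup>2 / (2 * real CARD('n)))"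
proof -
  have "heat V (calabi V) y = heat V (\<lambda>w. calabi U (L w)) y"
    by (rule heat_cong[OF yOm calabi_V])
  also have "\<dots> = heat U (calabi U) z"
    unfolding heat_V[OF smooth_calabi[OF U] yOm] Ly ..
  finally show ?thesis using V.heat_calabi_id calabi_V[OF yOm] unfolding Ly by simp
qed

text \<open>
  In the frame Calabi's quantity is an ordinary sum of squares, so that the ellipticity bound can be applied to
  one index after the other to recover the Euclidean norm.
\<close>

lemma calabi_frame_squares:
  "calabi U z = (\<Sum>i\<in>UNIV. \<Sum>j\<in>UNIV. \<Sum>k\<in>UNIV.
     (\<Sum>a\<in>UNIV. P$a$i * (\<Sum>b\<in>UNIV. P$b$j * (\<Sum>c\<in>UNIV. P$c$k * DJ [a, b, c] U z)))\<^sup>2)"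
proof -
  have "calabi U z = (\<Sum>i\<in>UNIV. V.rho i i)" using calabi_V[OF yOm] V.calabi_id unfolding Ly by simp
  then show ?thesis unfolding V.rho_def unfolding DJ3_V[OF yOm] Ly power2_eq_square .
qed

lemma frame_squares_ge:
  assumes "0 < Lam" "pinched lam Lam U"
  shows "(\<Sum>a\<in>UNIV. (x a)\<^sup>2) \<le> Lam * (\<Sum>k\<in>UNIV. (\<Sum>a\<in>UNIV. P$a$k * x a)\<^sup>2)"
proof -
  have "(\<Sum>a\<in>UNIV. (x a)\<^sup>2) / Lam \<le> (\<Sum>k\<in>UNIV. (p k \<bullet> (\<chi> a. x a))\<^sup>2)"
    unfolding matrix_inv_quadratic_squares[OF fr MA_flowD(4)[OF U z], symmetric]
    using assms(2) z unfolding pinched_def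
    by (intro matrix_inv_quadratic_ge[OF fr MA_flowD(4)[OF U z] assms(1)]) blast
  then show ?thesis using assms(1) by (simp add: field_simps P_def inner_vec_def)
qed

lemma third_derivatives_le_calabi:
  assumes "0 < Lam" "pinched lam Lam U"
  shows "(\<Sum>i\<in>UNIV. \<Sum>j\<in>UNIV. \<Sum>k\<in>UNIV. (DJ [i, j, k] U z)\<^sup>2) \<le> Lam ^ 3 * calabi U z"
proof -
  let ?T = "\<lambda>i j k. DJ [i, j, k] U z"
  note q = frame_squares_ge[OF assms]
  have "(\<Sum>i\<in>UNIV. \<Sum>j\<in>UNIV. \<Sum>k\<in>UNIV. (?T i j k)\<^sup>2)
     \<le> (\<Sum>i\<in>UNIV. \<Sum>j\<in>UNIV. Lam * (\<Sum>k\<in>UNIV. (\<Sum>c\<in>UNIV. P$c$k * ?T i j c)\<^sup>2))"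
    by (intro sum_mono q)
  also have "\<dots> = (\<Sum>i\<in>UNIV. \<Sum>k\<in>UNIV. Lam * (\<Sum>j\<in>UNIV. (\<Sum>c\<in>UNIV. P$c$k * ?T i j c)\<^sup>2))"
    unfolding sum_distrib_left by (intro sum.cong[OF refl] sum.swap)
  also have "\<dots> \<le> (\<Sum>i\<in>UNIV. \<Sum>k\<in>UNIV. Lam * (Lam * (\<Sum>j\<in>UNIV. (\<Sum>b\<in>UNIV. P$b$j * (\<Sum>c\<in>UNIV. P$c$k * ?T i b c))\<^sup>2)))"
    using assms(1) by (intro sum_mono mult_left_mono q) auto
  also have "\<dots> = (\<Sum>k\<in>UNIV. \<Sum>j\<in>UNIV. Lam * (Lam * (\<Sum>i\<in>UNIV. (\<Sum>b\<in>UNIV. P$b$j * (\<Sum>c\<in>UNIV. P$c$k * ?T i b c))\<^sup>2)))"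
    unfolding sum_distrib_left by (rule sum_rotate3)
  also have "\<dots> \<le> (\<Sum>k\<in>UNIV. \<Sum>j\<in>UNIV. Lam * (Lam * (Lam * (\<Sum>i\<in>UNIV. (\<Sum>a\<in>UNIV. P$a$i * (\<Sum>b\<in>UNIV. P$b$j * (\<Sum>c\<in>UNIV. P$c$k * ?T a b c)))\<^sup>2))))"
    using assms(1) by (intro sum_mono mult_left_mono q) auto
  also have "\<dots> = Lam ^ 3 * (\<Sum>k\<in>UNIV. \<Sum>j\<in>UNIV. \<Sum>i\<in>UNIV. (\<Sum>a\<in>UNIV. P$a$i * (\<Sum>b\<in>UNIV. P$b$j * (\<Sum>c\<in>UNIV. P$c$k * ?T a b c)))\<^sup>2)"
    by (simp only: sum_distrib_left power3_eq_cube mult.assoc)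
  also have "(\<Sum>k\<in>UNIV. \<Sum>j\<in>UNIV. \<Sum>i\<in>UNIV. (\<Sum>a\<in>UNIV. P$a$i * (\<Sum>b\<in>UNIV. P$b$j * (\<Sum>c\<in>UNIV. P$c$k * ?T a b c)))\<^sup>2) = calabi U z"
    unfolding calabi_frame_squares
    by (subst (2) sum_rotate3[symmetric]) (intro sum.cong refl sum.swap)
  finally show ?thesis .
qed

end

text \<open>
  Calabi's quantity satisfies \<open>L S \<le> - S\<^sup>2 / (2 n)\<close>, so that it is at most \<open>4 n\<^sup>2\<close> at time 1.
\<close>

theorem third_derivative_bound_at_1:
  fixes U :: "'n::finite field"
  assumes U: "MA_flow U" and "0 < lam" "0 < Lam" "pinched lam Lam U"
  shows "(\<Sum>i\<in>UNIV. \<Sum>j\<in>UNIV. \<Sum>k\<in>UNIV. (DJ [i, j, k] U (x, 1))\<^sup>2) \<le> Lam ^ 3 * (4 * (real CARD('n))\<^sup>2)"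
proof -
  have N: "0 < real CARD('n)" by simp
  have "calabi U (x, 1) \<le> 2 * real CARD('n) / (1 / (2 * real CARD('n))) + sqrt (0 / (1 / (2 * real CARD('n))))"
  proof (rule interior_maximum_bound[OF U assms(2,4) smooth_calabi[OF U]])
    fix z :: "'n spacetime" assume "1/2 \<le> snd z"
    then have z: "z \<in> Om" by (cases z) auto
    obtain p where "orthonormal_frame (hess U z) p" using MA_flow_frame[OF U z] .
    then interpret flow_frame U z p using U z by unfold_locales
    show "heat U (calabi U) z \<le> 0 - 1 / (2 * real CARD('n)) * (calabi U z)\<^sup>2" using heat_calabi by simp
  qed (use N in auto)
  then have 1: "calabi U (x, 1) \<le> 4 * (real CARD('n))\<^sup>2" by (simp add: power2_eq_square)
  have z: "(x, 1) \<in> Om" by simp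
  obtain p where "orthonormal_frame (hess U (x, 1)) p" using MA_flow_frame[OF U z] .
  then interpret flow_frame U "(x, 1)" p using U z by unfold_locales
  have "Lam ^ 3 * calabi U (x, 1) \<le> Lam ^ 3 * (4 * (real CARD('n))\<^sup>2)"
    using 1 assms(3) by (intro mult_left_mono) auto
  then show ?thesis using third_derivatives_le_calabi[OF assms(3,4)] by linarith
qed

section \<open>Parabolic scaling\<close>

definition scaled :: "real \<Rightarrow> 'n::finite field \<Rightarrow> 'n field" where
  "scaled m U w = U (m *\<^sub>R fst w, m\<^sup>2 * snd w) / m\<^sup>2"

lemma delta_mult_const: "(if Q then c else 0) * x = (if Q then c * x else (0::real))"
  by simp

lemma lin_change_mat: "lin_change (mat m) s w = (m *\<^sub>R fst w, s * snd w)"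
  by (simp add: lin_change_def vec_eq_iff matrix_vector_mult_def mat_def delta_mult_const)

lemma scaled_lin_change: "scaled m U = (\<lambda>w. (1 / m\<^sup>2) * U (lin_change (mat m) (m\<^sup>2) w))"
  by (simp add: scaled_def lin_change_mat fun_eq_iff)

lemma DJ_scaled:
  fixes U :: "'n::finite field"
  assumes "0 < m" "smooth U"
  shows "w \<in> Om \<Longrightarrow> DJ js (scaled m U) w = m ^ length js / m\<^sup>2 * DJ js U (m *\<^sub>R fst w, m\<^sup>2 * snd w)"
proof (induction js arbitrary: w)
  case Nil
  then show ?case by (simp add: scaled_def)
next
  case (Cons i js)
  have m2: "0 < m\<^sup>2" using assms(1) by simp
  have d: "(\<lambda>w. DJ js U (lin_change (mat m) (m\<^sup>2) w)) differentiable (at w)"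
    by (intro smooth_differentiable[OF smooth_lin_change] m2 smooth_DJ assms Cons.prems)
  have "DJ (i # js) (scaled m U) w = dX i (\<lambda>w. m ^ length js / m\<^sup>2 * DJ js U (lin_change (mat m) (m\<^sup>2) w)) w"
    unfolding DJ.simps lin_change_mat by (rule dX_cong[OF Cons.prems Cons.IH])
  also have "\<dots> = m ^ length js / m\<^sup>2 * dX i (\<lambda>w. DJ js U (lin_change (mat m) (m\<^sup>2) w)) w"
    unfolding dX_def by (rule dd_cmult[OF d])
  also have "dX i (\<lambda>w. DJ js U (lin_change (mat m) (m\<^sup>2) w)) w = m * DJ (i # js) U (lin_change (mat m) (m\<^sup>2) w)"
    unfolding dX_lin_change[OF m2 smooth_DJ[OF assms(2)] Cons.prems]
    by (simp add: mat_def delta_mult_const)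
  finally show ?case unfolding lin_change_mat by simp
qed

lemma flow_scaled:
  fixes U :: "'n::finite field"
  assumes "0 < m" "MA_flow U" "pinched lam Lam U"
  shows "MA_flow (scaled m U)" "pinched lam Lam (scaled m U)"
proof -
  have sU: "smooth U" using assms(2) unfolding MA_flow_def by blast
  have m2: "0 < m\<^sup>2" using assms(1) by simp
  have sOm: "(m *\<^sub>R fst w, m\<^sup>2 * snd w) \<in> Om" if "w \<in> Om" for w :: "'n spacetime"
    using that m2 by auto
  have h: "hess (scaled m U) w = hess U (m *\<^sub>R fst w, m\<^sup>2 * snd w)" if "w \<in> Om" for w
    unfolding hess_def using DJ_scaled[OF assms(1) sU that, of "[_, _]"] assms(1)
    by (simp add: vec_eq_iff power2_eq_square)
  have s: "smooth (scaled m U)"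
    unfolding scaled_lin_change
    by (intro smooth_fun_on_mult open_Om smooth_fun_on_const smooth_lin_change sU m2)
  have t: "dT (scaled m U) w = dT U (m *\<^sub>R fst w, m\<^sup>2 * snd w)" if "w \<in> Om" for w
  proof -
    have a: "dT (scaled m U) w = 1 / m\<^sup>2 * dT (\<lambda>w. U (lin_change (mat m) (m\<^sup>2) w)) w"
      unfolding scaled_lin_change dT_def
      by (intro dd_cmult smooth_differentiable[OF smooth_lin_change] m2 sU that)
    show ?thesis unfolding a dT_lin_change[OF m2 sU that] unfolding lin_change_mat using m2 by simp
  qed
  obtain c where c: "\<forall>z\<in>Om. real CARD('n) * dT U z = ln (det (hess U z)) + c"
    and p: "\<forall>z\<in>Om. 0 < det (hess U z) \<and> (\<forall>v. v \<noteq> 0 \<longrightarrow> 0 < v \<bullet> (hess U z *v v))"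
    using assms(2) unfolding MA_flow_def by blast
  have "\<forall>w\<in>Om. real CARD('n) * dT (scaled m U) w = ln (det (hess (scaled m U) w)) + c"
  proof
    fix w :: "'n spacetime" assume w: "w \<in> Om"
    show "real CARD('n) * dT (scaled m U) w = ln (det (hess (scaled m U) w)) + c"
      using bspec[OF c sOm[OF w]] unfolding h[OF w] t[OF w] .
  qed
  moreover have "\<forall>w\<in>Om. 0 < det (hess (scaled m U) w) \<and> (\<forall>v. v \<noteq> 0 \<longrightarrow> 0 < v \<bullet> (hess (scaled m U) w *v v))"
  proof
    fix w :: "'n spacetime" assume w: "w \<in> Om"
    show "0 < det (hess (scaled m U) w) \<and> (\<forall>v. v \<noteq> 0 \<longrightarrow> 0 < v \<bullet> (hess (scaled m U) w *v v))"
      using bspec[OF p sOm[OF w]] unfolding h[OF w] .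
  qed
  ultimately show "MA_flow (scaled m U)" unfolding MA_flow_def using s by blast
  show "pinched lam Lam (scaled m U)" unfolding pinched_def
  proof
    fix w :: "'n spacetime" assume w: "w \<in> Om"
    show "\<forall>v. lam * (v \<bullet> v) \<le> v \<bullet> (hess (scaled m U) w *v v) \<and> v \<bullet> (hess (scaled m U) w *v v) \<le> Lam * (v \<bullet> v)"
      using bspec[OF assms(3)[unfolded pinched_def] sOm[OF w]] unfolding h[OF w] .
  qed
qed

section \<open>The structure of the evolution of higher derivatives\<close>

abbreviation lists_of_length :: "nat \<Rightarrow> 'n::finite list set" where
  "lists_of_length l \<equiv> {js. length js = l}"

lemma finite_lists_of_length: "finite (lists_of_length l :: 'a::finite list set)"
  using finite_lists_length_eq[of "UNIV :: 'a::finite set" l] by simp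

text \<open>
  A differential polynomial is treated as a map on functions \<open>U\<close>, so that the constants
  obtained for it below do not depend on \<open>U\<close>. Second derivatives are represented by the entries of the inverse Hessian only.
\<close>

inductive diff_poly :: "nat \<Rightarrow> 'n::finite functional \<Rightarrow> bool" for m where
  const: "diff_poly m (\<lambda>U z. c)"
| inv: "diff_poly m (\<lambda>U. ihess U a b)"
| der: "3 \<le> length js \<Longrightarrow> length js \<le> m \<Longrightarrow> diff_poly m (DJ js)"
| add: "diff_poly m F \<Longrightarrow> diff_poly m G \<Longrightarrow> diff_poly m (\<lambda>U z. F U z + G U z)"
| mult: "diff_poly m F \<Longrightarrow> diff_poly m G \<Longrightarrow> diff_poly m (\<lambda>U z. F U z * G U z)"

lemma diff_poly_mono: "diff_poly m F \<Longrightarrow> m \<le> m' \<Longrightarrow> diff_poly m' F"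
  by (induction rule: diff_poly.induct) (auto intro: diff_poly.intros)

lemma diff_poly_sum:
  assumes "\<And>i. i \<in> I \<Longrightarrow> diff_poly m (F i)"
  shows "diff_poly m (\<lambda>U z. \<Sum>i\<in>I. F i U z)"
proof (cases "finite I")
  case True
  then show ?thesis using assms
    by (induction I rule: finite_induct) (auto intro: diff_poly.intros)
qed (simp add: diff_poly.const)

lemma diff_poly_smooth: "diff_poly m F \<Longrightarrow> MA_flow U \<Longrightarrow> smooth (F U)"
proof (induction rule: diff_poly.induct)
  case (der js) then show ?case using smooth_DJ MA_flow_def by blast
qed (auto intro: smooth_fun_on_const smooth_ihess smooth_fun_on_add smooth_fun_on_mult open_Om)

text \<open>
  The derivatives of order \<open>m + 1\<close> may enter in degree one only. Such a term is controlled by the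
  square root of the good term, so that it can be absorbed. The lists \<open>K\<close> run through all derivatives of that order.
\<close>

definition quasi_linear :: "nat \<Rightarrow> 'n::finite functional \<Rightarrow> bool" where
  "quasi_linear m G \<longleftrightarrow> (\<exists>A B. diff_poly m A \<and> (\<forall>K. diff_poly m (B K)) \<and>
     (\<forall>U z. G U z = A U z + (\<Sum>K\<in>lists_of_length (Suc m). B K U z * DJ K U z)))"

lemma quasi_linear_poly: "diff_poly m F \<Longrightarrow> quasi_linear m F"
  unfolding quasi_linear_def
  by (intro exI[of _ F] exI[of _ "\<lambda>K U z. 0"]) (auto intro: diff_poly.const)

lemma quasi_linear_DJ:
  assumes "length J = Suc m" shows "quasi_linear m (DJ J)"
  unfolding quasi_linear_def
proof (intro exI conjI allI)
  show "diff_poly m (\<lambda>U z. 0)" by (rule diff_poly.const)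
  show "diff_poly m (\<lambda>U z. if K = J then 1 else 0)" for K :: "'a list" by (rule diff_poly.const)
  show "DJ J U z = 0 + (\<Sum>K\<in>lists_of_length (Suc m). (if K = J then 1 else 0) * DJ K U z)" for U z
    using assms by (simp add: delta_mult_const sum.delta[OF finite_lists_of_length])
qed

lemma quasi_linear_add:
  assumes "quasi_linear m F" "quasi_linear m G"
  shows "quasi_linear m (\<lambda>U z. F U z + G U z)"
proof -
  obtain A B where 1: "diff_poly m A" "\<And>K. diff_poly m (B K)"
    "\<And>U z. F U z = A U z + (\<Sum>K\<in>lists_of_length (Suc m). B K U z * DJ K U z)"
    using assms(1) unfolding quasi_linear_def by blast
  obtain A' B' where 2: "diff_poly m A'" "\<And>K. diff_poly m (B' K)"
    "\<And>U z. G U z = A' U z + (\<Sum>K\<in>lists_of_length (Suc m). B' K U z * DJ K U z)"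
    using assms(2) unfolding quasi_linear_def by blast
  show ?thesis unfolding quasi_linear_def
    by (intro exI[of _ "\<lambda>U z. A U z + A' U z"] exI[of _ "\<lambda>K U z. B K U z + B' K U z"] conjI allI diff_poly.add 1(1,2) 2(1,2))
       (simp add: 1(3) 2(3) sum.distrib algebra_simps)
qed

lemma quasi_linear_mult:
  assumes "diff_poly m F" "quasi_linear m G"
  shows "quasi_linear m (\<lambda>U z. F U z * G U z)"
proof -
  obtain A B where 1: "diff_poly m A" "\<And>K. diff_poly m (B K)"
    "\<And>U z. G U z = A U z + (\<Sum>K\<in>lists_of_length (Suc m). B K U z * DJ K U z)"
    using assms(2) unfolding quasi_linear_def by blast
  show ?thesis unfolding quasi_linear_def
    by (intro exI[of _ "\<lambda>U z. F U z * A U z"] exI[of _ "\<lambda>K U z. F U z * B K U z"] conjI allI diff_poly.mult 1(1,2) assms(1))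
       (simp add: 1(3) sum_distrib_left algebra_simps)
qed

lemma quasi_linear_sum:
  assumes "\<And>i. i \<in> I \<Longrightarrow> quasi_linear m (F i)"
  shows "quasi_linear m (\<lambda>U z. \<Sum>i\<in>I. F i U z)"
proof (cases "finite I")
  case True
  then show ?thesis using assms
    by (induction I rule: finite_induct) (auto intro: quasi_linear_add quasi_linear_poly diff_poly.const)
qed (simp add: quasi_linear_poly diff_poly.const)

lemma quasi_linear_imp_diff_poly:
  assumes "quasi_linear m G" "2 \<le> m" shows "diff_poly (Suc m) G"
proof -
  obtain A B where 1: "diff_poly m A" "\<And>K. diff_poly m (B K)"
    "\<And>U z. G U z = A U z + (\<Sum>K\<in>lists_of_length (Suc m). B K U z * DJ K U z)"
    using assms unfolding quasi_linear_def by blast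
  have "diff_poly (Suc m) (\<lambda>U z. A U z + (\<Sum>K\<in>lists_of_length (Suc m). B K U z * DJ K U z))"
    by (intro diff_poly.add diff_poly_sum diff_poly.mult diff_poly.der diff_poly_mono[OF 1(1)] diff_poly_mono[OF 1(2)])
       (use assms(2) in auto)
  then show ?thesis using 1(3) by presburger
qed

lemma diff_poly_dX_ihess:
  assumes "3 \<le> m"
  shows "diff_poly m (\<lambda>U z. - (\<Sum>s\<in>UNIV. \<Sum>t\<in>UNIV. ihess U a s z * DJ [i, s, t] U z * ihess U t b z))"
proof -
  have "diff_poly m (\<lambda>U z. (-1) * (\<Sum>s\<in>UNIV. \<Sum>t\<in>UNIV. ihess U a s z * DJ [i, s, t] U z * ihess U t b z))"
    by (intro diff_poly.mult diff_poly_sum diff_poly.inv diff_poly.const diff_poly.der) (use assms in auto)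
  then show ?thesis by simp
qed

text \<open>
  Differentiating a polynomial raises one derivative at a time, so that the new order \<open>m + 1\<close> occurs
  linearly.
\<close>

lemma dX_diff_poly:
  assumes "3 \<le> m" "diff_poly m F"
  shows "\<exists>G. quasi_linear m G \<and> (\<forall>U z. MA_flow U \<longrightarrow> z \<in> Om \<longrightarrow> dX i (F U) z = G U z)"
  using assms(2)
proof (induction rule: diff_poly.induct)
  case (const c)
  show ?case by (rule exI[of _ "\<lambda>U z. 0"]) (auto intro: quasi_linear_poly diff_poly.const simp: dX_def)
next
  case (inv a b)
  show ?case
    using quasi_linear_poly[OF diff_poly_dX_ihess[OF assms(1), of a i b]] dX_ihess by blast
next
  case (der js)
  have "quasi_linear m (DJ (i # js))"
  proof (cases "length js = m")
    case True then show ?thesis by (intro quasi_linear_DJ) simp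
  next
    case False then show ?thesis using der by (intro quasi_linear_poly diff_poly.der) auto
  qed
  moreover have "\<forall>U z. MA_flow U \<longrightarrow> z \<in> Om \<longrightarrow> dX i (DJ js U) z = DJ (i # js) U z" by simp
  ultimately show ?case by blast
next
  case (add F G)
  then obtain F' G' where 1: "quasi_linear m F'" "quasi_linear m G'"
    "\<And>U z. MA_flow U \<Longrightarrow> z \<in> Om \<Longrightarrow> dX i (F U) z = F' U z"
    "\<And>U z. MA_flow U \<Longrightarrow> z \<in> Om \<Longrightarrow> dX i (G U) z = G' U z" by metis
  have "dX i (\<lambda>z. F U z + G U z) z = F' U z + G' U z" if "MA_flow U" "z \<in> Om" for U z
    using 1(3,4)[OF that] diff_poly_smooth[OF add.hyps(1) that(1)] diff_poly_smooth[OF add.hyps(2) that(1)] that(2)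
    by (simp add: dX_def dd_add smooth_differentiable)
  then show ?case using quasi_linear_add[OF 1(1,2)] by blast
next
  case (mult F G)
  then obtain F' G' where 1: "quasi_linear m F'" "quasi_linear m G'"
    "\<And>U z. MA_flow U \<Longrightarrow> z \<in> Om \<Longrightarrow> dX i (F U) z = F' U z"
    "\<And>U z. MA_flow U \<Longrightarrow> z \<in> Om \<Longrightarrow> dX i (G U) z = G' U z" by metis
  have "dX i (\<lambda>z. F U z * G U z) z = F U z * G' U z + G U z * F' U z" if "MA_flow U" "z \<in> Om" for U z
    using 1(3,4)[OF that] diff_poly_smooth[OF mult.hyps(1) that(1)] diff_poly_smooth[OF mult.hyps(2) that(1)] that(2)
    by (simp add: dX_def dd_mult smooth_differentiable)
  then show ?case
    using quasi_linear_add[OF quasi_linear_mult[OF mult.hyps(1) 1(2)] quasi_linear_mult[OF mult.hyps(2) 1(1)]] by blast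
qed

lemma heat_DJ_Cons:
  assumes "MA_flow U" "z \<in> Om"
  shows "heat U (DJ (i # J) U) z = dX i (heat U (DJ J U)) z +
    (\<Sum>a\<in>UNIV. \<Sum>b\<in>UNIV. - (\<Sum>s\<in>UNIV. \<Sum>t\<in>UNIV. ihess U a s z * DJ [i, s, t] U z * ihess U t b z) * DJ (a # b # J) U z)"
  using heat_dX[OF assms(1) smooth_DJ[OF MA_flowD(1)[OF assms]] assms(2), of i J]
  unfolding dX_ihess[OF assms] by simp

text \<open>
  Both terms of the commutation formula are affine in the new top order: the first one as the derivative of
  a polynomial, the second one because the derivative of \<open>g\<^sup>-\<^sup>1\<close> has order three only.
\<close>

lemma heat_DJ_step:
  assumes "2 \<le> l" "length J = l" "diff_poly (Suc l) G"
    and G: "\<And>U z. MA_flow U \<Longrightarrow> z \<in> Om \<Longrightarrow> heat U (DJ J U) z = G U z"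
  shows "\<exists>H. quasi_linear (Suc l) H \<and> (\<forall>U z. MA_flow U \<longrightarrow> z \<in> Om \<longrightarrow> heat U (DJ (i # J) U) z = H U z)"
proof -
  have l3: "3 \<le> Suc l" using assms(1) by simp
  obtain H where H: "quasi_linear (Suc l) H" "\<And>U z. MA_flow U \<Longrightarrow> z \<in> Om \<Longrightarrow> dX i (G U) z = H U z"
    using dX_diff_poly[OF l3 assms(3)] by metis
  have "quasi_linear (Suc l) (\<lambda>U z. H U z + (\<Sum>a\<in>UNIV. \<Sum>b\<in>UNIV.
      - (\<Sum>s\<in>UNIV. \<Sum>t\<in>UNIV. ihess U a s z * DJ [i, s, t] U z * ihess U t b z) * DJ (a # b # J) U z))"
    by (intro quasi_linear_add H(1) quasi_linear_sum quasi_linear_mult diff_poly_dX_ihess l3 quasi_linear_DJ)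
       (simp add: assms(2))
  moreover have "heat U (DJ (i # J) U) z = H U z + (\<Sum>a\<in>UNIV. \<Sum>b\<in>UNIV.
      - (\<Sum>s\<in>UNIV. \<Sum>t\<in>UNIV. ihess U a s z * DJ [i, s, t] U z * ihess U t b z) * DJ (a # b # J) U z)"
    if "MA_flow U" "z \<in> Om" for U z
  proof -
    have "dX i (heat U (DJ J U)) z = dX i (G U) z" by (rule dX_cong[OF that(2) G[OF that(1)]])
    then show ?thesis unfolding heat_DJ_Cons[OF that] H(2)[OF that] by simp
  qed
  ultimately show ?thesis by blast
qed

lemma heat_DJ_diff_poly:
  fixes J :: "'n::finite list"
  assumes "2 \<le> length J"
  shows "\<exists>G :: 'n functional. diff_poly (Suc (length J)) G \<and> (\<forall>U z. MA_flow U \<longrightarrow> z \<in> Om \<longrightarrow> heat U (DJ J U) z = G U z)"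
  using assms
proof (induction J)
  case (Cons i J)
  show ?case
  proof (cases "2 \<le> length J")
    case True
    obtain G :: "'n functional" where G: "diff_poly (Suc (length J)) G" "\<And>U z. MA_flow U \<Longrightarrow> z \<in> Om \<Longrightarrow> heat U (DJ J U) z = G U z"
      using Cons.IH[OF True] by blast
    obtain H :: "'n functional" where "quasi_linear (Suc (length J)) H" "\<And>U z. MA_flow U \<Longrightarrow> z \<in> Om \<Longrightarrow> heat U (DJ (i # J) U) z = H U z"
      using heat_DJ_step[OF True refl G] by blast
    then show ?thesis using quasi_linear_imp_diff_poly[of "Suc (length J)" H] True by auto
  next
    case False
    then obtain j where J: "J = [j]" using Cons.prems by (cases J; cases "tl J") auto
    let ?G = "\<lambda>U z. \<Sum>a\<in>UNIV. \<Sum>b\<in>UNIV. - (\<Sum>s\<in>UNIV. \<Sum>t\<in>UNIV. ihess U a s z * DJ [i, s, t] U z * ihess U t b z) * DJ [a, b, j] U z"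
    have "diff_poly 3 ?G"
      by (intro diff_poly_sum diff_poly.mult diff_poly_dX_ihess diff_poly.der) auto
    moreover have "heat U (DJ (i # J) U) z = ?G U z" if "MA_flow U" "z \<in> Om" for U z
      unfolding J heat_second_derivative[OF that] dX_ihess[OF that] ..
    ultimately show ?thesis unfolding J by (intro exI[of _ ?G]) (simp add: numeral_3_eq_3)
  qed
qed simp

text \<open>
  For second derivatives \<open>L\<close> gives an expression quadratic in the third derivatives, which is why the
  affine form starts at order three.
\<close>

lemma heat_DJ_quasi_linear:
  fixes J :: "'n::finite list"
  assumes "3 \<le> length J"
  shows "\<exists>G :: 'n functional. quasi_linear (length J) G \<and> (\<forall>U z. MA_flow U \<longrightarrow> z \<in> Om \<longrightarrow> heat U (DJ J U) z = G U z)"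
proof -
  obtain i J' where J: "J = i # J'" using assms by (cases J) auto
  then have l: "2 \<le> length J'" using assms by simp
  obtain G :: "'n functional" where G: "diff_poly (Suc (length J')) G" "\<And>U z. MA_flow U \<Longrightarrow> z \<in> Om \<Longrightarrow> heat U (DJ J' U) z = G U z"
    using heat_DJ_diff_poly[OF l] by blast
  show ?thesis using heat_DJ_step[OF l refl G, of i] unfolding J by simp
qed

section \<open>Bounds for differential polynomials\<close>

definition jet_sq :: "nat \<Rightarrow> 'n::finite field \<Rightarrow> 'n field" where
  "jet_sq l U z = (\<Sum>js\<in>lists_of_length l. (DJ js U z)\<^sup>2)"

definition jet_bounded :: "real \<Rightarrow> nat \<Rightarrow> 'n::finite field \<Rightarrow> 'n spacetime \<Rightarrow> bool" where
  "jet_bounded K m U z \<longleftrightarrow> (\<forall>a b. \<bar>ihess U a b z\<bar> \<le> K) \<and> (\<forall>js. 3 \<le> length js \<longrightarrow> length js \<le> m \<longrightarrow> \<bar>DJ js U z\<bar> \<le> K)"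

lemma jet_sq_nonneg: "0 \<le> jet_sq l U z"
  unfolding jet_sq_def by (intro sum_nonneg) auto

lemma DJ_le_jet_sq: "length js = l \<Longrightarrow> \<bar>DJ js U z\<bar> \<le> sqrt (jet_sq l U z)"
proof -
  assume "length js = l"
  then have "(DJ js U z)\<^sup>2 \<le> jet_sq l U z"
    unfolding jet_sq_def by (intro member_le_sum[where f = "\<lambda>js. (DJ js U z)\<^sup>2"] finite_lists_of_length) auto
  then show ?thesis by (metis real_sqrt_abs real_sqrt_le_iff)
qed

lemma diff_poly_bounded:
  assumes "diff_poly m F" "0 \<le> K"
  shows "\<exists>C\<ge>0. \<forall>U z. jet_bounded K m U z \<longrightarrow> \<bar>F U z\<bar> \<le> C"
  using assms(1)
proof (induction rule: diff_poly.induct)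
  case (const c) show ?case by (intro exI[of _ "\<bar>c\<bar>"]) auto
next
  case (inv a b) show ?case using assms(2) by (intro exI[of _ K]) (auto simp: jet_bounded_def)
next
  case (der js) then show ?case using assms(2) by (intro exI[of _ K]) (auto simp: jet_bounded_def)
next
  case (add F G)
  then obtain C D where "0 \<le> C" "0 \<le> D" "\<And>U z. jet_bounded K m U z \<Longrightarrow> \<bar>F U z\<bar> \<le> C" "\<And>U z. jet_bounded K m U z \<Longrightarrow> \<bar>G U z\<bar> \<le> D"
    by metis
  then show ?case by (intro exI[of _ "C + D"]) (auto intro!: order_trans[OF abs_triangle_ineq] add_mono)
next
  case (mult F G)
  then obtain C D where "0 \<le> C" "0 \<le> D" "\<And>U z. jet_bounded K m U z \<Longrightarrow> \<bar>F U z\<bar> \<le> C" "\<And>U z. jet_bounded K m U z \<Longrightarrow> \<bar>G U z\<bar> \<le> D"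
    by metis
  then show ?case by (intro exI[of _ "C * D"]) (auto simp: abs_mult intro!: mult_mono)
qed

text \<open>
  The number of terms depends on the dimension and the order only, so that bounds that are uniform in
  \<open>U\<close> add up to a uniform bound.
\<close>

lemma linear_combination_bounded:
  fixes E :: "'i \<Rightarrow> 'n::finite functional"
  assumes "finite I" "\<And>i. i \<in> I \<Longrightarrow> \<exists>C\<ge>0. \<forall>U z. P U z \<longrightarrow> \<bar>E i U z\<bar> \<le> C * r U z" "\<And>U z. 0 \<le> r U z"
  shows "\<exists>C\<ge>0. \<forall>U z. P U z \<longrightarrow> \<bar>\<Sum>i\<in>I. E i U z\<bar> \<le> C * r U z"
  using assms(1,2)
proof (induction I rule: finite_induct)
  case empty show ?case by (intro exI[of _ 0]) auto
next
  case (insert i I)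
  obtain C where C: "0 \<le> C" "\<And>U z. P U z \<Longrightarrow> \<bar>\<Sum>i\<in>I. E i U z\<bar> \<le> C * r U z"
    using insert.IH insert.prems by blast
  obtain D where D: "0 \<le> D" "\<And>U z. P U z \<Longrightarrow> \<bar>E i U z\<bar> \<le> D * r U z"
    using insert.prems[of i] by blast
  have "\<bar>\<Sum>i\<in>insert i I. E i U z\<bar> \<le> (D + C) * r U z" if "P U z" for U z
    using C(2)[OF that] D(2)[OF that] insert.hyps by (simp add: algebra_simps)
  then show ?case using C(1) D(1) by (intro exI[of _ "D + C"]) auto
qed

lemma quasi_linear_bounded:
  fixes G :: "'n::finite functional"
  assumes "quasi_linear m G" "0 \<le> K"
  shows "\<exists>C\<ge>0. \<forall>U z. jet_bounded K m U z \<longrightarrow> \<bar>G U z\<bar> \<le> C * (1 + sqrt (jet_sq (Suc m) U z))"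
proof -
  obtain A B where 1: "diff_poly m A" "\<And>K. diff_poly m (B K)"
    "\<And>U z. G U z = A U z + (\<Sum>K\<in>lists_of_length (Suc m). B K U z * DJ K U z)"
    using assms unfolding quasi_linear_def by blast
  obtain C where C: "0 \<le> C" "\<And>U z. jet_bounded K m U z \<Longrightarrow> \<bar>A U z\<bar> \<le> C"
    using diff_poly_bounded[OF 1(1) assms(2)] by blast
  have "\<exists>D\<ge>0. \<forall>U z. jet_bounded K m U z \<longrightarrow> \<bar>\<Sum>J\<in>lists_of_length (Suc m). B J U z * DJ J U z\<bar> \<le> D * sqrt (jet_sq (Suc m) U z)"
  proof (rule linear_combination_bounded[OF finite_lists_of_length])
    fix J :: "'n list" assume J: "J \<in> lists_of_length (Suc m)"
    obtain D where D: "0 \<le> D" "\<And>U z. jet_bounded K m U z \<Longrightarrow> \<bar>B J U z\<bar> \<le> D"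
      using diff_poly_bounded[OF 1(2) assms(2)] by blast
    then show "\<exists>C\<ge>0. \<forall>U z. jet_bounded K m U z \<longrightarrow> \<bar>B J U z * DJ J U z\<bar> \<le> C * sqrt (jet_sq (Suc m) U z)"
      using J by (intro exI[of _ D]) (auto simp: abs_mult intro!: mult_mono DJ_le_jet_sq)
  qed (simp add: jet_sq_nonneg)
  then obtain D where D: "0 \<le> D" "\<And>U z. jet_bounded K m U z \<Longrightarrow> \<bar>\<Sum>J\<in>lists_of_length (Suc m). B J U z * DJ J U z\<bar> \<le> D * sqrt (jet_sq (Suc m) U z)"
    by blast
  have "\<bar>G U z\<bar> \<le> (C + D) * (1 + sqrt (jet_sq (Suc m) U z))" if "jet_bounded K m U z" for U z
  proof -
    have "\<bar>G U z\<bar> \<le> C + D * sqrt (jet_sq (Suc m) U z)" unfolding 1(3) using C(2)[OF that] D(2)[OF that] by linarith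
    moreover have "0 \<le> D" "0 \<le> C * sqrt (jet_sq (Suc m) U z)" using C D by (simp_all add: jet_sq_nonneg)
    ultimately show ?thesis by (simp add: algebra_simps)
  qed
  then show ?thesis using C(1) D(1) by (intro exI[of _ "C + D"]) auto
qed

lemma heat_DJ_bounded:
  fixes J :: "'n::finite list"
  assumes "3 \<le> length J" "0 \<le> K"
  shows "\<exists>C\<ge>0. \<forall>U z. MA_flow U \<and> z \<in> Om \<and> jet_bounded K (length J) U z \<longrightarrow>
     \<bar>heat U (DJ J U) z\<bar> \<le> C * (1 + sqrt (jet_sq (Suc (length J)) U z))"
proof -
  obtain G :: "'n functional" where G: "quasi_linear (length J) G" "\<And>U z. MA_flow U \<Longrightarrow> z \<in> Om \<Longrightarrow> heat U (DJ J U) z = G U z"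
    using heat_DJ_quasi_linear[OF assms(1)] by blast
  then show ?thesis using quasi_linear_bounded[OF G(1) assms(2)] by metis
qed

text \<open>
  One order above the range in which the derivatives are bounded. Differentiating the affine
  expression of order \<open>m\<close> once more produces products of at most two derivatives of order \<open>m + 1\<close>, which is the
  only source of the quadratic term.
\<close>

lemma heat_DJ_next_bounded:
  fixes J :: "'n::finite list"
  assumes "3 \<le> m" "length J = Suc m" "0 \<le> K"
  shows "\<exists>C\<ge>0. \<forall>U z. MA_flow U \<and> z \<in> Om \<and> jet_bounded K m U z \<longrightarrow>
     \<bar>heat U (DJ J U) z\<bar> \<le> C * (1 + jet_sq (Suc m) U z + sqrt (jet_sq (Suc (Suc m)) U z))"
proof -
  let ?P = "\<lambda>U z. MA_flow U \<and> z \<in> Om \<and> jet_bounded K m U z"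
  let ?r = "\<lambda>U z. 1 + jet_sq (Suc m) U z + sqrt (jet_sq (Suc (Suc m)) U z)"
  have r0: "0 \<le> ?r U z" for U :: "'n field" and z by (simp add: jet_sq_nonneg)
  obtain i J' where J: "J = i # J'" "length J' = m" using assms(2) by (cases J) auto
  obtain G :: "'n functional" where G: "quasi_linear m G" "\<And>U z. MA_flow U \<Longrightarrow> z \<in> Om \<Longrightarrow> heat U (DJ J' U) z = G U z"
    using heat_DJ_quasi_linear[of J'] assms(1) J(2) by blast
  obtain A B where AB: "diff_poly m A" "\<And>L. diff_poly m (B L)"
    "\<And>U z. G U z = A U z + (\<Sum>L\<in>lists_of_length (Suc m). B L U z * DJ L U z)"
    using G(1) unfolding quasi_linear_def by blast
  obtain A' where A': "quasi_linear m A'" "\<And>U z. MA_flow U \<Longrightarrow> z \<in> Om \<Longrightarrow> dX i (A U) z = A' U z"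
    using dX_diff_poly[OF assms(1) AB(1)] by blast
  have "\<forall>L. \<exists>B'. quasi_linear m B' \<and> (\<forall>U z. MA_flow U \<longrightarrow> z \<in> Om \<longrightarrow> dX i (B L U) z = B' U z)"
    using dX_diff_poly[OF assms(1) AB(2)] by blast
  then obtain B' where B': "\<And>L. quasi_linear m (B' L)" "\<And>L U z. MA_flow U \<Longrightarrow> z \<in> Om \<Longrightarrow> dX i (B L U) z = B' L U z"
    by metis
  let ?c = "\<lambda>a b U z. - (\<Sum>s\<in>UNIV. \<Sum>t\<in>UNIV. ihess U a s z * DJ [i, s, t] U z * ihess U t b z)"
  have heat: "heat U (DJ J U) z = A' U z + (\<Sum>L\<in>lists_of_length (Suc m). B L U z * DJ (i # L) U z + B' L U z * DJ L U z)
     + (\<Sum>a\<in>UNIV. \<Sum>b\<in>UNIV. ?c a b U z * DJ (a # b # J') U z)" if "MA_flow U" "z \<in> Om" for U z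
  proof -
    have d: "DJ L U differentiable (at z)" "A U differentiable (at z)" "B L U differentiable (at z)" for L
      using smooth_DJ[OF MA_flowD(1)[OF that]] diff_poly_smooth[OF AB(1) that(1)] diff_poly_smooth[OF AB(2) that(1)] that(2)
      by (auto intro: smooth_differentiable)
    have d2: "(\<lambda>z. B L U z * DJ L U z) differentiable (at z)" for L by (intro differentiable_mult d)
    have d3: "(\<lambda>z. \<Sum>L\<in>lists_of_length (Suc m). B L U z * DJ L U z) differentiable (at z)"
      by (intro differentiable_sum ballI d2 finite_lists_of_length)
    have "dX i (heat U (DJ J' U)) z = dX i (\<lambda>z. A U z + (\<Sum>L\<in>lists_of_length (Suc m). B L U z * DJ L U z)) z"
      by (rule dX_cong[OF that(2)]) (simp add: G(2)[OF that(1)] AB(3))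
    also have "\<dots> = dX i (A U) z + (\<Sum>L\<in>lists_of_length (Suc m). dX i (\<lambda>z. B L U z * DJ L U z) z)"
      using dd_add[OF d(2) d3] dX_sum[of "lists_of_length (Suc m)" "\<lambda>L z. B L U z * DJ L U z", OF d2] unfolding dX_def by simp
    also have "\<dots> = A' U z + (\<Sum>L\<in>lists_of_length (Suc m). B L U z * DJ (i # L) U z + B' L U z * DJ L U z)"
      by (simp only: A'(2)[OF that] dX_mult[OF d(3) d(1)] B'(2)[OF that] DJ.simps(2))
    finally show ?thesis unfolding J(1) heat_DJ_Cons[OF that] by simp
  qed
  have sq: "sqrt g \<le> 1 + g" "sqrt g * sqrt g = g" if "0 \<le> g" for g :: real
  proof -
    show 1: "sqrt g * sqrt g = g" using that by simp
    have "0 \<le> (sqrt g - 1)\<^sup>2" by simp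
    then show "sqrt g \<le> 1 + g" using 1 that real_sqrt_ge_zero[OF that] unfolding power2_eq_square by (simp add: algebra_simps)
  qed
  have top: "\<exists>C\<ge>0. \<forall>U z. ?P U z \<longrightarrow> \<bar>F U z * DJ L U z\<bar> \<le> C * ?r U z"
    if F: "diff_poly m F" and L: "length L = Suc (Suc m)" for F :: "'n functional" and L
  proof -
    obtain D where D: "0 \<le> D" "\<And>U z. jet_bounded K m U z \<Longrightarrow> \<bar>F U z\<bar> \<le> D"
      using diff_poly_bounded[OF F assms(3)] by blast
    have "\<bar>F U z * DJ L U z\<bar> \<le> D * ?r U z" if "?P U z" for U z
      unfolding abs_mult using D(2)[of U z] that D(1) DJ_le_jet_sq[OF L, of U z] jet_sq_nonneg[of "Suc m" U z]
      by (intro mult_mono) auto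
    then show ?thesis using D(1) by blast
  qed
  have low: "\<exists>C\<ge>0. \<forall>U z. ?P U z \<longrightarrow> \<bar>F U z\<bar> \<le> C * ?r U z" if F: "quasi_linear m F" for F :: "'n functional"
  proof -
    obtain D where D: "0 \<le> D" "\<And>U z. jet_bounded K m U z \<Longrightarrow> \<bar>F U z\<bar> \<le> D * (1 + sqrt (jet_sq (Suc m) U z))"
      using quasi_linear_bounded[OF F assms(3)] by blast
    have "\<bar>F U z\<bar> \<le> (2 * D) * ?r U z" if "?P U z" for U z
    proof -
      have "1 + sqrt (jet_sq (Suc m) U z) \<le> 2 * ?r U z"
        using sq(1)[OF jet_sq_nonneg[of "Suc m" U z]] jet_sq_nonneg[of "Suc m" U z] real_sqrt_ge_zero[OF jet_sq_nonneg[of "Suc (Suc m)" U z]]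
        unfolding distrib_left by linarith
      then have "D * (1 + sqrt (jet_sq (Suc m) U z)) \<le> D * (2 * ?r U z)" by (rule mult_left_mono[OF _ D(1)])
      then show ?thesis using D(2)[of U z] that by linarith
    qed
    then show ?thesis using D(1) by (intro exI[of _ "2 * D"]) auto
  qed
  have mid: "\<exists>C\<ge>0. \<forall>U z. ?P U z \<longrightarrow> \<bar>F U z * DJ L U z\<bar> \<le> C * ?r U z"
    if F: "quasi_linear m F" and L: "length L = Suc m" for F :: "'n functional" and L
  proof -
    obtain D where D: "0 \<le> D" "\<And>U z. jet_bounded K m U z \<Longrightarrow> \<bar>F U z\<bar> \<le> D * (1 + sqrt (jet_sq (Suc m) U z))"
      using quasi_linear_bounded[OF F assms(3)] by blast
    have "\<bar>F U z * DJ L U z\<bar> \<le> (2 * D) * ?r U z" if "?P U z" for U z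
    proof -
      let ?g = "jet_sq (Suc m) U z"
      have "\<bar>F U z * DJ L U z\<bar> \<le> (D * (1 + sqrt ?g)) * sqrt ?g"
        unfolding abs_mult using D that DJ_le_jet_sq[OF L] by (intro mult_mono) (auto simp: jet_sq_nonneg)
      also have "\<dots> = D * (sqrt ?g + ?g)" using sq(2)[OF jet_sq_nonneg[of "Suc m" U z]] by (simp add: algebra_simps)
      also have "\<dots> \<le> D * (2 * ?r U z)"
      proof (rule mult_left_mono[OF _ D(1)])
        show "sqrt ?g + ?g \<le> 2 * ?r U z"
          using sq(1)[OF jet_sq_nonneg[of "Suc m" U z]] jet_sq_nonneg[of "Suc m" U z] real_sqrt_ge_zero[OF jet_sq_nonneg[of "Suc (Suc m)" U z]]
          unfolding distrib_left by linarith
      qed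
      finally show ?thesis by (simp add: algebra_simps)
    qed
    then show ?thesis using D(1) by (intro exI[of _ "2 * D"]) auto
  qed
  obtain C1 where C1: "0 \<le> C1" "\<And>U z. ?P U z \<Longrightarrow> \<bar>A' U z\<bar> \<le> C1 * ?r U z" using low[OF A'(1)] by blast
  have "\<exists>C\<ge>0. \<forall>U z. ?P U z \<longrightarrow> \<bar>\<Sum>L\<in>lists_of_length (Suc m). B L U z * DJ (i # L) U z\<bar> \<le> C * ?r U z"
    by (intro linear_combination_bounded finite_lists_of_length top AB(2) r0) simp
  then obtain C2 where C2: "0 \<le> C2" "\<And>U z. ?P U z \<Longrightarrow> \<bar>\<Sum>L\<in>lists_of_length (Suc m). B L U z * DJ (i # L) U z\<bar> \<le> C2 * ?r U z"
    by blast
  have "\<exists>C\<ge>0. \<forall>U z. ?P U z \<longrightarrow> \<bar>\<Sum>L\<in>lists_of_length (Suc m). B' L U z * DJ L U z\<bar> \<le> C * ?r U z"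
    by (intro linear_combination_bounded finite_lists_of_length mid B'(1) r0) simp
  then obtain C3 where C3: "0 \<le> C3" "\<And>U z. ?P U z \<Longrightarrow> \<bar>\<Sum>L\<in>lists_of_length (Suc m). B' L U z * DJ L U z\<bar> \<le> C3 * ?r U z"
    by blast
  have "\<exists>C\<ge>0. \<forall>U z. ?P U z \<longrightarrow> \<bar>\<Sum>a\<in>UNIV. \<Sum>b\<in>UNIV. ?c a b U z * DJ (a # b # J') U z\<bar> \<le> C * ?r U z"
    by (intro linear_combination_bounded finite top diff_poly_dX_ihess assms(1) r0) (simp add: J(2))
  then obtain C4 where C4: "0 \<le> C4" "\<And>U z. ?P U z \<Longrightarrow> \<bar>\<Sum>a\<in>UNIV. \<Sum>b\<in>UNIV. ?c a b U z * DJ (a # b # J') U z\<bar> \<le> C4 * ?r U z"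
    by blast
  have "\<bar>heat U (DJ J U) z\<bar> \<le> (C1 + C2 + C3 + C4) * ?r U z" if P: "?P U z" for U z
  proof -
    have U: "MA_flow U" "z \<in> Om" using P by auto
    show ?thesis using C1(2)[OF P] C2(2)[OF P] C3(2)[OF P] C4(2)[OF P]
      unfolding heat[OF U] sum.distrib distrib_right by linarith
  qed
  then show ?thesis using C1(1) C2(1) C3(1) C4(1) by (intro exI[of _ "C1 + C2 + C3 + C4"]) auto
qed

lemma sum_lists_of_length_Suc:
  fixes f :: "'n::finite list \<Rightarrow> real"
  shows "(\<Sum>K\<in>lists_of_length (Suc l). f K) = (\<Sum>J\<in>lists_of_length l. \<Sum>a\<in>UNIV. f (a # J))"
proof -
  have "(\<Sum>J\<in>lists_of_length l. \<Sum>a\<in>UNIV. f (a # J)) = (\<Sum>q\<in>lists_of_length l \<times> (UNIV :: 'n set). f (snd q # fst q))"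
    by (simp add: sum.cartesian_product case_prod_unfold)
  also have "\<dots> = (\<Sum>K\<in>lists_of_length (Suc l). f K)"
    by (rule sum.reindex_bij_witness[of _ "\<lambda>K. (tl K, hd K)" "\<lambda>q. snd q # fst q"])
       (auto simp: length_Suc_conv)
  finally show ?thesis by simp
qed

lemma smooth_jet_sq: "smooth U \<Longrightarrow> smooth (jet_sq l U)"
  unfolding jet_sq_def[abs_def] by (intro smooth_fun_on_sum smooth_fun_on_power2 open_Om smooth_DJ)

lemma grad_inner_ge:
  fixes U f :: "'n::finite field"
  assumes "MA_flow U" "pinched lam Lam U" "0 < Lam" "z \<in> Om"
  shows "(\<Sum>a\<in>UNIV. (dX a f z)\<^sup>2) / Lam \<le> grad_inner U f f z"
proof -
  obtain p where p: "orthonormal_frame (hess U z) p" using MA_flow_frame[OF assms(1,4)] .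
  show ?thesis unfolding grad_inner_def ihess_def
    using assms(2,4) unfolding pinched_def
    by (intro matrix_inv_quadratic_ge[OF p MA_flowD(4)[OF assms(1,4)] assms(3)]) blast
qed

lemma ihess_le:
  fixes U :: "'n::finite field"
  assumes "MA_flow U" "pinched lam Lam U" "0 < lam" "z \<in> Om"
  shows "\<bar>ihess U a b z\<bar> \<le> real CARD('n) / lam"
proof -
  obtain p where p: "orthonormal_frame (hess U z) p" using MA_flow_frame[OF assms(1,4)] .
  show ?thesis unfolding ihess_def
    using assms(2,4) unfolding pinched_def
    by (intro matrix_inv_entry_le[OF p MA_flowD(4)[OF assms(1,4)] assms(3)]) blast
qed

lemma heat_jet_sq_le:
  fixes U :: "'n::finite field"
  assumes "MA_flow U" "pinched lam Lam U" "0 < Lam" "z \<in> Om"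
  shows "heat U (jet_sq l U) z \<le> 2 * (\<Sum>J\<in>lists_of_length l. DJ J U z * heat U (DJ J U) z) - 2 / Lam * jet_sq (Suc l) U z"
proof -
  note s = smooth_DJ[OF MA_flowD(1)[OF assms(1,4)]]
  have "heat U (jet_sq l U) z = (\<Sum>J\<in>lists_of_length l. heat U (\<lambda>y. DJ J U y * DJ J U y) z)"
    unfolding jet_sq_def[abs_def] power2_eq_square
    by (intro heat_sum smooth_fun_on_mult open_Om s assms(4) finite_lists_of_length)
  also have "\<dots> = (\<Sum>J\<in>lists_of_length l. 2 * (DJ J U z * heat U (DJ J U) z) - 2 * grad_inner U (DJ J U) (DJ J U) z)"
    by (simp add: heat_mult[OF assms(1) s s assms(4)])
  also have "\<dots> = 2 * (\<Sum>J\<in>lists_of_length l. DJ J U z * heat U (DJ J U) z) - 2 * (\<Sum>J\<in>lists_of_length l. grad_inner U (DJ J U) (DJ J U) z)"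
    by (simp only: sum_subtractf sum_distrib_left)
  finally have e: "heat U (jet_sq l U) z = 2 * (\<Sum>J\<in>lists_of_length l. DJ J U z * heat U (DJ J U) z)
      - 2 * (\<Sum>J\<in>lists_of_length l. grad_inner U (DJ J U) (DJ J U) z)" .
  have "jet_sq (Suc l) U z / Lam \<le> (\<Sum>J\<in>lists_of_length l. grad_inner U (DJ J U) (DJ J U) z)"
  proof -
    have "jet_sq (Suc l) U z / Lam = (\<Sum>J\<in>lists_of_length l. (\<Sum>a\<in>UNIV. (dX a (DJ J U) z)\<^sup>2) / Lam)"
      unfolding jet_sq_def sum_lists_of_length_Suc by (simp add: sum_divide_distrib)
    also have "\<dots> \<le> (\<Sum>J\<in>lists_of_length l. grad_inner U (DJ J U) (DJ J U) z)"
      by (intro sum_mono grad_inner_ge[OF assms])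
    finally show ?thesis .
  qed
  moreover have "2 / Lam * jet_sq (Suc l) U z = 2 * (jet_sq (Suc l) U z / Lam)" by simp
  ultimately show ?thesis unfolding e by linarith
qed

lemma dX_jet_sq_le:
  fixes U :: "'n::finite field"
  assumes "smooth U" "z \<in> Om"
  shows "\<bar>dX a (jet_sq l U) z\<bar> \<le> 2 * real (card (lists_of_length l :: 'n list set)) * (sqrt (jet_sq l U z) * sqrt (jet_sq (Suc l) U z))"
proof -
  have d: "DJ J U differentiable (at z)" for J by (rule smooth_differentiable[OF smooth_DJ[OF assms(1)] assms(2)])
  have "dX a (jet_sq l U) z = (\<Sum>J\<in>lists_of_length l. 2 * DJ J U z * DJ (a # J) U z)"
    unfolding jet_sq_def[abs_def] dX_def
    by (subst dd_sum) (auto simp: d power2_eq_square dd_mult dX_def intro!: sum.cong)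
  also have "\<bar>\<dots>\<bar> \<le> (\<Sum>J\<in>(lists_of_length l :: 'n list set). 2 * (sqrt (jet_sq l U z) * sqrt (jet_sq (Suc l) U z)))"
  proof (intro order_trans[OF sum_abs] sum_mono)
    fix J :: "'n list" assume "J \<in> lists_of_length l"
    then have "\<bar>DJ J U z\<bar> * \<bar>DJ (a # J) U z\<bar> \<le> sqrt (jet_sq l U z) * sqrt (jet_sq (Suc l) U z)"
      by (intro mult_mono DJ_le_jet_sq) (auto simp: jet_sq_nonneg)
    then show "\<bar>2 * DJ J U z * DJ (a # J) U z\<bar> \<le> 2 * (sqrt (jet_sq l U z) * sqrt (jet_sq (Suc l) U z))"
      by (simp add: abs_mult)
  qed
  finally show ?thesis by simp
qed

lemma grad_inner_le:
  fixes U f g :: "'n::finite field"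
  assumes "\<And>a b. \<bar>ihess U a b z\<bar> \<le> K" "\<And>a. \<bar>dX a f z\<bar> \<le> F" "\<And>a. \<bar>dX a g z\<bar> \<le> G"
  shows "\<bar>grad_inner U f g z\<bar> \<le> (real CARD('n))\<^sup>2 * (K * (F * G))"
proof -
  have K: "0 \<le> K" and F: "0 \<le> F" using assms(1,2) by (meson abs_ge_zero order_trans)+
  have "\<bar>grad_inner U f g z\<bar> \<le> (\<Sum>a\<in>UNIV. \<Sum>b\<in>UNIV. \<bar>ihess U a b z * (dX a f z * dX b g z)\<bar>)"
    unfolding grad_inner_def by (intro order_trans[OF sum_abs] sum_mono sum_abs)
  also have "\<dots> \<le> (\<Sum>a\<in>(UNIV::'n set). \<Sum>b\<in>(UNIV::'n set). K * (F * G))"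
    unfolding abs_mult by (intro sum_mono mult_mono assms mult_nonneg_nonneg abs_ge_zero K F)
  finally show ?thesis by (simp add: power2_eq_square)
qed

section \<open>The induction on the order of differentiation\<close>

text \<open>
  For large \<open>x\<close> the quartic dominates; on the remaining bounded interval the left hand side is bounded.
\<close>

lemma quartic_absorbs:
  fixes c P :: real
  assumes "0 < c" "0 \<le> P"
  shows "\<exists>b\<ge>0. \<forall>x\<ge>0. P * (x + x\<^sup>2 + x ^ 3) \<le> c * x ^ 4 + b"
proof -
  define X where "X = max 1 (3 * P / c)"
  have X: "1 \<le> X" "3 * P \<le> c * X"
  proof -
    show "1 \<le> X" by (simp add: X_def)
    have "3 * P / c \<le> X" by (simp add: X_def)
    then show "3 * P \<le> c * X" using assms(1) by (simp add: field_simps)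
  qed
  have "P * (x + x\<^sup>2 + x ^ 3) \<le> c * x ^ 4 + 3 * P * X ^ 3" if x: "0 \<le> x" for x
  proof (cases "x \<le> X")
    case True
    have "x ^ 2 \<le> X ^ 2" "x ^ 3 \<le> X ^ 3" using True x by (simp_all add: power_mono)
    moreover have "X ^ 1 \<le> X ^ 3" "X ^ 2 \<le> X ^ 3" by (rule power_increasing[OF _ X(1)]; simp)+
    ultimately have "x + x\<^sup>2 + x ^ 3 \<le> 3 * X ^ 3" using True by simp
    then have "P * (x + x\<^sup>2 + x ^ 3) \<le> P * (3 * X ^ 3)" by (rule mult_left_mono[OF _ assms(2)])
    moreover have "0 \<le> c * x ^ 4" using assms(1) x by simp
    ultimately show ?thesis by simp
  next
    case False
    then have x1: "1 \<le> x" using X(1) by simp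
    have "x ^ 1 \<le> x ^ 3" "x ^ 2 \<le> x ^ 3" by (rule power_increasing[OF _ x1]; simp)+
    then have "x + x\<^sup>2 + x ^ 3 \<le> 3 * x ^ 3" by simp
    then have "P * (x + x\<^sup>2 + x ^ 3) \<le> P * (3 * x ^ 3)" by (rule mult_left_mono[OF _ assms(2)])
    also have "\<dots> = 3 * P * x ^ 3" by simp
    also have "\<dots> \<le> (c * x) * x ^ 3"
    proof (rule mult_right_mono)
      have "c * X \<le> c * x" using False assms(1) by simp
      then show "3 * P \<le> c * x" using X(2) by simp
    qed (use x in simp)
    also have "\<dots> = c * x ^ 4" by (simp add: power3_eq_cube power4_eq_xxxx)
    also have "\<dots> \<le> c * x ^ 4 + 3 * P * X ^ 3" using assms(2) X(1) by simp
    finally show ?thesis .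
  qed
  then show ?thesis using assms(2) X(1) by (intro exI[of _ "3 * P * X ^ 3"]) auto
qed

lemma young_ineq:
  fixes c a b :: real
  assumes "0 < c" shows "a * b \<le> c / 4 * b\<^sup>2 + a\<^sup>2 / c"
proof -
  have "0 \<le> (c / 2 * b - a)\<^sup>2 / c" using assms by simp
  also have "\<dots> = c / 4 * b\<^sup>2 + a\<^sup>2 / c - a * b" using assms by (simp add: power2_eq_square field_simps)
  finally show ?thesis by simp
qed

text \<open>
  Here \<open>w = |D\<^sup>m u|\<^sup>2\<close>, \<open>x = |D\<^sup>m\<^sup>+\<^sup>1 u|\<close>, \<open>y = |D\<^sup>m\<^sup>+\<^sup>2 u|\<close>, while \<open>Hw\<close>, \<open>Hg\<close> and \<open>gi\<close> stand for \<open>L w\<close>,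
  \<open>L x\<^sup>2\<close> and the inner product of the gradients of \<open>w\<close> and \<open>x\<^sup>2\<close>. The left hand side is the product rule for
  \<open>L ((k + w) x\<^sup>2)\<close>. The good term \<open>- c x\<^sup>4\<close> comes from \<open>x\<^sup>2 Hw\<close>. The gradient term is split between it and
  \<open>- c k y\<^sup>2\<close>, which is possible for large \<open>k\<close>.
\<close>

lemma product_absorption:
  fixes c C1 C2 C3 W :: real
  assumes "0 < c" "0 \<le> C1" "0 \<le> C2" "0 \<le> C3" "0 \<le> W"
  shows "\<exists>k\<ge>1. \<exists>c'>0. \<exists>b\<ge>0. \<forall>w x y Hw Hg gi. 0 \<le> w \<longrightarrow> w \<le> W \<longrightarrow> 0 \<le> x \<longrightarrow> 0 \<le> y \<longrightarrow>
     Hw \<le> C1 * (1 + x) - c * x\<^sup>2 \<longrightarrow> Hg \<le> C2 * (x * (1 + x\<^sup>2 + y)) - c * y\<^sup>2 \<longrightarrow> \<bar>gi\<bar> \<le> C3 * (x\<^sup>2 * y) \<longrightarrow>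
     (k + w) * Hg + x\<^sup>2 * Hw - 2 * gi \<le> b - c' * ((k + w) * x\<^sup>2)\<^sup>2"
proof -
  \<comment> \<open>Young's inequality leaves \<open>(4 C3\<^sup>2 / c) y\<^sup>2\<close> of the gradient term; \<open>k\<close> makes \<open>(3/4) c k y\<^sup>2\<close> absorb it.\<close>
  define k where "k = 1 + 16 * C3\<^sup>2 / c\<^sup>2"
  define M where "M = k + W"
  define P where "P = M * C2 + (M * C2\<^sup>2 / c + C1) + (M * C2 + C1)"
  have k: "1 \<le> k" using assms by (simp add: k_def)
  have M: "1 \<le> M" using k assms by (simp add: M_def)
  have P: "0 \<le> P" using M assms by (simp add: P_def)
  obtain b where b: "0 \<le> b" "\<And>x. 0 \<le> x \<Longrightarrow> P * (x + x\<^sup>2 + x ^ 3) \<le> c / 4 * x ^ 4 + b"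
    using quartic_absorbs[of "c / 4" P] assms(1) P by auto
  define c' where "c' = c / 2 / M\<^sup>2"
  have c': "0 < c'" using assms(1) M by (simp add: c'_def)
  have "(k + w) * Hg + x\<^sup>2 * Hw - 2 * gi \<le> b - c' * ((k + w) * x\<^sup>2)\<^sup>2"
    if w: "0 \<le> w" "w \<le> W" and x: "0 \<le> x" and y: "0 \<le> y" and Hw: "Hw \<le> C1 * (1 + x) - c * x\<^sup>2"
      and Hg: "Hg \<le> C2 * (x * (1 + x\<^sup>2 + y)) - c * y\<^sup>2" and gi: "\<bar>gi\<bar> \<le> C3 * (x\<^sup>2 * y)" for w x y Hw Hg gi
  proof -
    have kw: "0 \<le> k + w" "k \<le> k + w" "k + w \<le> M" using k w by (simp_all add: M_def)
    let ?A = "C2 * x + C2 * x ^ 3 + C2\<^sup>2 / c * x\<^sup>2"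
    have A0: "0 \<le> ?A" using assms x by simp
    have "(C2 * x) * y \<le> c / 4 * y\<^sup>2 + (C2 * x)\<^sup>2 / c" by (rule young_ineq[OF assms(1)])
    then have "Hg \<le> ?A - 3 * c / 4 * y\<^sup>2"
      using Hg by (simp add: algebra_simps power2_eq_square power3_eq_cube)
    then have "(k + w) * Hg \<le> (k + w) * (?A - 3 * c / 4 * y\<^sup>2)" by (rule mult_left_mono[OF _ kw(1)])
    also have "\<dots> = (k + w) * ?A - (k + w) * (3 * c / 4 * y\<^sup>2)" by (simp only: right_diff_distrib)
    also have "\<dots> \<le> M * ?A - k * (3 * c / 4 * y\<^sup>2)"
      using kw A0 assms(1) by (intro diff_mono mult_right_mono) auto
    finally have 1: "(k + w) * Hg \<le> M * ?A - k * (3 * c / 4 * y\<^sup>2)" .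
    have 2: "x\<^sup>2 * Hw \<le> x\<^sup>2 * (C1 * (1 + x) - c * x\<^sup>2)" by (intro mult_left_mono Hw) simp
    have "(2 * C3 * y) * x\<^sup>2 \<le> c / 4 * (x\<^sup>2)\<^sup>2 + (2 * C3 * y)\<^sup>2 / c" by (rule young_ineq[OF assms(1)])
    then have 3: "- 2 * gi \<le> c / 4 * x ^ 4 + 4 * C3\<^sup>2 / c * y\<^sup>2"
      using gi by (simp add: power_mult_distrib mult_ac flip: power_mult)
    have "4 * C3\<^sup>2 / c \<le> k * (3 * c / 4)"
    proof -
      have "k * (3 * c / 4) = 3 * c / 4 + 12 * (C3\<^sup>2 / c)"
        using assms(1) by (simp add: k_def field_simps power2_eq_square)
      moreover have "0 \<le> C3\<^sup>2 / c" using assms(1) by simp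
      moreover have "4 * C3\<^sup>2 / c = 4 * (C3\<^sup>2 / c)" by simp
      ultimately show ?thesis using assms(1) by linarith
    qed
    then have 4: "4 * C3\<^sup>2 / c * y\<^sup>2 \<le> k * (3 * c / 4 * y\<^sup>2)"
      using mult_right_mono[of "4 * C3\<^sup>2 / c" "k * (3 * c / 4)" "y\<^sup>2"] by (simp add: mult.assoc)
    have 5: "M * ?A + x\<^sup>2 * (C1 * (1 + x) - c * x\<^sup>2) \<le> P * (x + x\<^sup>2 + x ^ 3) - c * x ^ 4"
    proof -
      have e: "M * ?A + x\<^sup>2 * (C1 * (1 + x) - c * x\<^sup>2) =
         (M * C2) * x + (M * C2\<^sup>2 / c + C1) * x\<^sup>2 + (M * C2 + C1) * x ^ 3 - c * x ^ 4"
        by (simp add: algebra_simps power2_eq_square power3_eq_cube power4_eq_xxxx)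
      have "M * C2 \<le> P" "M * C2\<^sup>2 / c + C1 \<le> P" "M * C2 + C1 \<le> P"
        using M assms by (simp_all add: P_def)
      then have "(M * C2) * x \<le> P * x" "(M * C2\<^sup>2 / c + C1) * x\<^sup>2 \<le> P * x\<^sup>2" "(M * C2 + C1) * x ^ 3 \<le> P * x ^ 3"
        using x by (simp_all add: mult_right_mono)
      moreover have "P * (x + x\<^sup>2 + x ^ 3) = P * x + P * x\<^sup>2 + P * x ^ 3" by (simp only: distrib_left)
      ultimately show ?thesis unfolding e by linarith
    qed
    have 6: "c' * ((k + w) * x\<^sup>2)\<^sup>2 \<le> c / 2 * x ^ 4"
    proof -
      have "((k + w) * x\<^sup>2)\<^sup>2 \<le> (M * x\<^sup>2)\<^sup>2" using kw by (intro power_mono mult_right_mono) auto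
      then have "c' * ((k + w) * x\<^sup>2)\<^sup>2 \<le> c' * (M * x\<^sup>2)\<^sup>2" using c' by simp
      also have "\<dots> = c / 2 * x ^ 4" using M by (simp add: c'_def power_mult_distrib flip: power_mult)
      finally show ?thesis .
    qed
    show ?thesis using 1 2 3 4 5 6 b(2)[OF x] by linarith
  qed
  then show ?thesis using k c' b(1) by (intro exI[of _ k] exI[of _ c'] exI[of _ b] conjI) auto
qed

lemma heat_product_inequality:
  assumes "3 \<le> m" "0 \<le> K" "0 < lam" "0 < Lam"
  shows "\<exists>k\<ge>1. \<exists>c>0. \<exists>b\<ge>0. \<forall>(U :: 'n::finite field) z.
    MA_flow U \<longrightarrow> pinched lam Lam U \<longrightarrow> z \<in> Om \<longrightarrow> jet_bounded K m U z \<longrightarrow>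
    heat U (\<lambda>y. (k + jet_sq m U y) * jet_sq (Suc m) U y) z \<le> b - c * ((k + jet_sq m U z) * jet_sq (Suc m) U z)\<^sup>2"
proof -
  let ?P = "\<lambda>U z. MA_flow U \<and> z \<in> Om \<and> jet_bounded K m U z"
  have "\<exists>C\<ge>0. \<forall>U z. ?P U z \<longrightarrow> \<bar>\<Sum>J\<in>(lists_of_length m :: 'n list set). DJ J U z * heat U (DJ J U) z\<bar> \<le> C * (1 + sqrt (jet_sq (Suc m) U z))"
  proof (rule linear_combination_bounded[OF finite_lists_of_length])
    fix J :: "'n list" assume "J \<in> lists_of_length m"
    then have J: "length J = m" by simp
    obtain C where C: "0 \<le> C" "\<And>U z. ?P U z \<Longrightarrow> \<bar>heat U (DJ J U) z\<bar> \<le> C * (1 + sqrt (jet_sq (Suc m) U z))"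
      using heat_DJ_bounded[of J K] assms(1,2) unfolding J by blast
    have "\<bar>DJ J U z * heat U (DJ J U) z\<bar> \<le> (K * C) * (1 + sqrt (jet_sq (Suc m) U z))" if "?P U z" for U z
      unfolding abs_mult mult.assoc using C(2)[OF that] that assms(1,2) J
      by (intro mult_mono) (auto simp: jet_bounded_def)
    then show "\<exists>C\<ge>0. \<forall>U z. ?P U z \<longrightarrow> \<bar>DJ J U z * heat U (DJ J U) z\<bar> \<le> C * (1 + sqrt (jet_sq (Suc m) U z))"
      using C(1) assms(2) by (intro exI[of _ "K * C"]) auto
  qed (simp add: jet_sq_nonneg)
  then obtain C1 where C1: "0 \<le> C1" "\<And>(U :: 'n field) z. ?P U z \<Longrightarrow>
      \<bar>\<Sum>J\<in>lists_of_length m. DJ J U z * heat U (DJ J U) z\<bar> \<le> C1 * (1 + sqrt (jet_sq (Suc m) U z))" by blast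
  let ?r = "\<lambda>U z. sqrt (jet_sq (Suc m) U z) * (1 + jet_sq (Suc m) U z + sqrt (jet_sq (Suc (Suc m)) U z))"
  have "\<exists>C\<ge>0. \<forall>U z. ?P U z \<longrightarrow> \<bar>\<Sum>J\<in>(lists_of_length (Suc m) :: 'n list set). DJ J U z * heat U (DJ J U) z\<bar> \<le> C * ?r U z"
  proof (rule linear_combination_bounded[OF finite_lists_of_length])
    fix J :: "'n list" assume "J \<in> lists_of_length (Suc m)"
    then have J: "length J = Suc m" by simp
    obtain C where C: "0 \<le> C" "\<And>U z. ?P U z \<Longrightarrow> \<bar>heat U (DJ J U) z\<bar> \<le> C * (1 + jet_sq (Suc m) U z + sqrt (jet_sq (Suc (Suc m)) U z))"
      using heat_DJ_next_bounded[OF assms(1) J assms(2)] by blast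
    have "\<bar>DJ J U z * heat U (DJ J U) z\<bar> \<le> C * ?r U z" if "?P U z" for U z
      unfolding abs_mult mult.left_commute[of C] using C(2)[OF that] DJ_le_jet_sq[OF J]
      by (intro mult_mono) (auto simp: jet_sq_nonneg)
    then show "\<exists>C\<ge>0. \<forall>U z. ?P U z \<longrightarrow> \<bar>DJ J U z * heat U (DJ J U) z\<bar> \<le> C * ?r U z"
      using C(1) by blast
  qed (simp add: jet_sq_nonneg)
  then obtain C2 where C2: "0 \<le> C2" "\<And>(U :: 'n field) z. ?P U z \<Longrightarrow>
      \<bar>\<Sum>J\<in>lists_of_length (Suc m). DJ J U z * heat U (DJ J U) z\<bar> \<le> C2 * ?r U z" by blast
  define n0 where "n0 = real (card (lists_of_length m :: 'n list set))"
  define n1 where "n1 = real (card (lists_of_length (Suc m) :: 'n list set))"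
  define W where "W = n0 * K\<^sup>2"
  define C3 where "C3 = (real CARD('n))\<^sup>2 * (K * (2 * n0 * sqrt W * (2 * n1)))"
  have n: "0 \<le> n0" "0 \<le> n1" by (simp_all add: n0_def n1_def)
  have W: "0 \<le> W" using n by (simp add: W_def)
  have C3: "0 \<le> C3" using n W assms(2) by (simp add: C3_def)
  have Lam2: "0 < 2 / Lam" using assms(4) by simp
  obtain k c b where kcb: "1 \<le> k" "0 < c" "0 \<le> b" and main: "\<And>w x y Hw Hg gi. 0 \<le> w \<Longrightarrow> w \<le> W \<Longrightarrow> 0 \<le> x \<Longrightarrow> 0 \<le> y \<Longrightarrow>
     Hw \<le> (2 * C1) * (1 + x) - 2 / Lam * x\<^sup>2 \<Longrightarrow> Hg \<le> (2 * C2) * (x * (1 + x\<^sup>2 + y)) - 2 / Lam * y\<^sup>2 \<Longrightarrow> \<bar>gi\<bar> \<le> C3 * (x\<^sup>2 * y) \<Longrightarrow>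
     (k + w) * Hg + x\<^sup>2 * Hw - 2 * gi \<le> b - c * ((k + w) * x\<^sup>2)\<^sup>2"
    using product_absorption[OF Lam2 _ _ C3 W, of "2 * C1" "2 * C2"] C1(1) C2(1) by auto
  have "heat U (\<lambda>y. (k + jet_sq m U y) * jet_sq (Suc m) U y) z \<le> b - c * ((k + jet_sq m U z) * jet_sq (Suc m) U z)\<^sup>2"
    if U: "MA_flow U" "pinched lam Lam U" and z: "z \<in> Om" and jb: "jet_bounded K m U z"
    for U :: "'n field" and z
  proof -
    let ?w = "jet_sq m U z" and ?x = "sqrt (jet_sq (Suc m) U z)" and ?y = "sqrt (jet_sq (Suc (Suc m)) U z)"
    have P: "?P U z" using U z jb by blast
    note sU = MA_flowD(1)[OF U(1) z]
    have x2: "?x\<^sup>2 = jet_sq (Suc m) U z" and y2: "?y\<^sup>2 = jet_sq (Suc (Suc m)) U z" by (simp_all add: jet_sq_nonneg)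
    have wW: "?w \<le> W"
    proof -
      have "?w \<le> (\<Sum>J\<in>(lists_of_length m :: 'n list set). K\<^sup>2)"
        unfolding jet_sq_def
      proof (rule sum_mono)
        fix J :: "'n list" assume "J \<in> lists_of_length m"
        then have "\<bar>DJ J U z\<bar> \<le> K" using jb assms(1) by (simp add: jet_bounded_def)
        then show "(DJ J U z)\<^sup>2 \<le> K\<^sup>2" using assms(2) by (simp add: abs_le_square_iff[symmetric])
      qed
      then show ?thesis by (simp add: W_def n0_def)
    qed
    have Hw: "heat U (jet_sq m U) z \<le> (2 * C1) * (1 + ?x) - 2 / Lam * ?x\<^sup>2"
      using heat_jet_sq_le[OF U assms(4) z, of m] abs_le_D1[OF C1(2)[OF P]] unfolding x2 by linarith
    have Hg: "heat U (jet_sq (Suc m) U) z \<le> (2 * C2) * (?x * (1 + ?x\<^sup>2 + ?y)) - 2 / Lam * ?y\<^sup>2"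
      using heat_jet_sq_le[OF U assms(4) z, of "Suc m"] abs_le_D1[OF C2(2)[OF P]] unfolding x2 y2 by linarith
    have gi: "\<bar>grad_inner U (jet_sq m U) (jet_sq (Suc m) U) z\<bar> \<le> C3 * (?x\<^sup>2 * ?y)"
    proof -
      have F: "\<bar>dX a (jet_sq m U) z\<bar> \<le> 2 * n0 * sqrt W * ?x" for a
      proof -
        have "sqrt ?w * ?x \<le> sqrt W * ?x" using wW by (intro mult_right_mono) (auto simp: jet_sq_nonneg)
        then have "2 * n0 * (sqrt ?w * ?x) \<le> 2 * n0 * (sqrt W * ?x)" using n by (intro mult_left_mono) auto
        then show ?thesis using dX_jet_sq_le[OF sU z, of a m] unfolding n0_def by (simp add: mult.assoc)
      qed
      have G: "\<bar>dX a (jet_sq (Suc m) U) z\<bar> \<le> 2 * n1 * (?x * ?y)" for a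
        using dX_jet_sq_le[OF sU z, of a "Suc m"] unfolding n1_def .
      have "\<bar>grad_inner U (jet_sq m U) (jet_sq (Suc m) U) z\<bar> \<le> (real CARD('n))\<^sup>2 * (K * ((2 * n0 * sqrt W * ?x) * (2 * n1 * (?x * ?y))))"
        using jb by (intro grad_inner_le F G) (simp add: jet_bounded_def)
      also have "\<dots> = C3 * (?x\<^sup>2 * ?y)" unfolding C3_def power2_eq_square by (simp only: mult_ac)
      finally show ?thesis .
    qed
    have sm: "smooth (\<lambda>y. k + jet_sq m U y)"
      by (intro smooth_fun_on_add smooth_fun_on_const smooth_jet_sq open_Om sU)
    have "heat U (\<lambda>y. (k + jet_sq m U y) * jet_sq (Suc m) U y) z =
        (k + ?w) * heat U (jet_sq (Suc m) U) z + jet_sq (Suc m) U z * heat U (\<lambda>y. k + jet_sq m U y) z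
        - 2 * grad_inner U (\<lambda>y. k + jet_sq m U y) (jet_sq (Suc m) U) z"
      by (rule heat_mult[OF U(1) sm smooth_jet_sq[OF sU] z])
    also have "heat U (\<lambda>y. k + jet_sq m U y) z = heat U (jet_sq m U) z"
      using heat_add[OF smooth_fun_on_const smooth_jet_sq[OF sU] z, of U k m] by simp
    also have "grad_inner U (\<lambda>y. k + jet_sq m U y) (jet_sq (Suc m) U) z = grad_inner U (jet_sq m U) (jet_sq (Suc m) U) z"
    proof -
      have "dX a (\<lambda>y. k + jet_sq m U y) z = dX a (jet_sq m U) z" for a
        unfolding dX_def using smooth_differentiable[OF smooth_jet_sq[OF sU] z] by (simp add: dd_add)
      then show ?thesis unfolding grad_inner_def by simp
    qed
    also have "(k + ?w) * heat U (jet_sq (Suc m) U) z + jet_sq (Suc m) U z * heat U (jet_sq m U) z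
        - 2 * grad_inner U (jet_sq m U) (jet_sq (Suc m) U) z \<le> b - c * ((k + ?w) * jet_sq (Suc m) U z)\<^sup>2"
      using main[OF jet_sq_nonneg wW _ _ Hw Hg gi] unfolding x2 by (simp add: jet_sq_nonneg)
    finally show ?thesis .
  qed
  then show ?thesis using kcb by blast
qed

text \<open>
  The scaling with \<open>\<mu>\<^sup>2 = t\<close> carries time 1 to time \<open>t\<close>.
\<close>

lemma jet_sq_scaling:
  fixes U :: "'n::finite field"
  assumes C: "\<And>(U :: 'n field) x. MA_flow U \<Longrightarrow> pinched lam Lam U \<Longrightarrow> jet_sq l U (x, 1) \<le> C"
    and U: "MA_flow U" "pinched lam Lam U" and "0 < t" "2 \<le> l"
  shows "jet_sq l U (x, t) \<le> C / t ^ (l - 2)"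
proof -
  define m where "m = sqrt t"
  have m: "0 < m" "m\<^sup>2 = t" using assms(4) by (simp_all add: m_def)
  obtain k where k: "l = k + 2" using assms(5) by (metis le_add_diff_inverse2)
  have z: "((1 / m) *\<^sub>R x, 1) \<in> Om" by simp
  have sU: "smooth U" using U(1) MA_flow_def by blast
  have "jet_sq l (scaled m U) ((1 / m) *\<^sub>R x, 1) = (\<Sum>js\<in>lists_of_length l. (m ^ k * DJ js U (x, t))\<^sup>2)"
    unfolding jet_sq_def
  proof (intro sum.cong refl)
    fix js :: "'n list" assume "js \<in> lists_of_length l"
    then have l: "length js = l" by simp
    have mk: "m ^ l / m\<^sup>2 = m ^ k" using m(1) by (simp add: k power_add power2_eq_square)
    have "DJ js (scaled m U) ((1 / m) *\<^sub>R x, 1) = m ^ k * DJ js U (x, t)"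
      unfolding DJ_scaled[OF m(1) sU z] l mk using m by simp
    then show "(DJ js (scaled m U) ((1 / m) *\<^sub>R x, 1))\<^sup>2 = (m ^ k * DJ js U (x, t))\<^sup>2" by simp
  qed
  also have "\<dots> = t ^ k * jet_sq l U (x, t)"
    by (simp add: jet_sq_def power_mult_distrib sum_distrib_left m(2) flip: power_mult add: mult.commute[of k] power_mult[of m 2 k])
  finally have "t ^ k * jet_sq l U (x, t) \<le> C" using C[OF flow_scaled[OF m(1) U]] by metis
  then show ?thesis using assms(4) k by (simp add: field_simps)
qed

text \<open>
  Scaling turns the bounds at time 1 for the orders below \<open>l\<close> into bounds for all times \<open>t \<ge> 1/2\<close>, which is
  the range needed for the interior bound at time 1.
\<close>

theorem derivative_bound_at_1:
  assumes "0 < lam" "0 < Lam" "3 \<le> l"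
  shows "\<exists>C. \<forall>(U :: 'n::finite field) x. MA_flow U \<longrightarrow> pinched lam Lam U \<longrightarrow> jet_sq l U (x, 1) \<le> C"
  using assms(3)
proof (induction l rule: less_induct)
  case (less l)
  show ?case
  proof (cases "l = 3")
    case True
    have "jet_sq 3 U (x, 1) \<le> Lam ^ 3 * (4 * (real CARD('n))\<^sup>2)" if "MA_flow U" "pinched lam Lam U"
      for U :: "'n field" and x
    proof -
      have "lists_of_length 0 = {[] :: 'n list}" by auto
      then have "jet_sq 3 U (x, 1) = (\<Sum>k\<in>UNIV. \<Sum>j\<in>UNIV. \<Sum>i\<in>UNIV. (DJ [i, j, k] U (x, 1))\<^sup>2)"
        unfolding jet_sq_def numeral_3_eq_3 sum_lists_of_length_Suc by simp
      also have "\<dots> = (\<Sum>i\<in>UNIV. \<Sum>j\<in>UNIV. \<Sum>k\<in>UNIV. (DJ [i, j, k] U (x, 1))\<^sup>2)"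
        by (subst (2) sum_rotate3[symmetric]) (intro sum.cong refl sum.swap)
      also have "\<dots> \<le> Lam ^ 3 * (4 * (real CARD('n))\<^sup>2)"
        by (rule third_derivative_bound_at_1[OF that(1) assms(1,2) that(2)])
      finally show ?thesis .
    qed
    then show ?thesis unfolding True by blast
  next
    case False
    then obtain m where m: "l = Suc m" "3 \<le> m" using less.prems by (cases l) auto
    have "\<forall>j. \<exists>C. 3 \<le> j \<longrightarrow> j \<le> m \<longrightarrow> (\<forall>(U :: 'n field) x. MA_flow U \<longrightarrow> pinched lam Lam U \<longrightarrow> jet_sq j U (x, 1) \<le> C)"
      using less.IH m(1) by (metis less_Suc_eq_le)
    then obtain Cf where Cf: "\<And>j (U :: 'n field) x. 3 \<le> j \<Longrightarrow> j \<le> m \<Longrightarrow> MA_flow U \<Longrightarrow> pinched lam Lam U \<Longrightarrow> jet_sq j U (x, 1) \<le> Cf j"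
      by metis
    define K where "K = real CARD('n) / lam + (\<Sum>j\<in>{3..m}. sqrt (\<bar>Cf j\<bar> * 2 ^ (j - 2)))"
    have K: "0 \<le> K" using assms(1) by (auto simp: K_def intro!: add_nonneg_nonneg sum_nonneg)
    have jb: "jet_bounded K m U z" if U: "MA_flow U" "pinched lam Lam U" and z: "1/2 \<le> snd z"
      for U :: "'n field" and z
      unfolding jet_bounded_def
    proof (intro conjI allI impI)
      have zOm: "z \<in> Om" using z by (cases z) auto
      have "0 \<le> (\<Sum>j\<in>{3..m}. sqrt (\<bar>Cf j\<bar> * 2 ^ (j - 2)))" by (intro sum_nonneg) auto
      then show "\<bar>ihess U a b z\<bar> \<le> K" for a b using ihess_le[OF U assms(1) zOm, of a b] unfolding K_def by linarith
      fix js :: "'n list" assume js: "3 \<le> length js" "length js \<le> m"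
      let ?j = "length js"
      obtain x t where xt: "z = (x, t)" "1/2 \<le> t" using z by (cases z) auto
      have "jet_sq ?j U (x, t) \<le> Cf ?j / t ^ (?j - 2)"
        using js xt(2) by (intro jet_sq_scaling[OF Cf U]) auto
      also have "\<dots> \<le> \<bar>Cf ?j\<bar> / (1/2) ^ (?j - 2)"
        using xt(2) by (intro frac_le power_mono) auto
      also have "\<dots> = \<bar>Cf ?j\<bar> * 2 ^ (?j - 2)" by (simp add: power_divide)
      finally have "sqrt (jet_sq ?j U z) \<le> sqrt (\<bar>Cf ?j\<bar> * 2 ^ (?j - 2))" using xt by simp
      also have "\<dots> \<le> (\<Sum>j\<in>{3..m}. sqrt (\<bar>Cf j\<bar> * 2 ^ (j - 2)))"
        using js by (intro member_le_sum[where f = "\<lambda>j. sqrt (\<bar>Cf j\<bar> * 2 ^ (j - 2))"]) auto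
      also have "\<dots> \<le> K" using assms(1) by (simp add: K_def)
      finally show "\<bar>DJ js U z\<bar> \<le> K" using DJ_le_jet_sq[of js ?j U z] by simp
    qed
    obtain k c b where kcb: "1 \<le> k" "0 < c" "0 \<le> b" and heat: "\<And>(U :: 'n field) z.
      MA_flow U \<Longrightarrow> pinched lam Lam U \<Longrightarrow> z \<in> Om \<Longrightarrow> jet_bounded K m U z \<Longrightarrow>
      heat U (\<lambda>y. (k + jet_sq m U y) * jet_sq (Suc m) U y) z \<le> b - c * ((k + jet_sq m U z) * jet_sq (Suc m) U z)\<^sup>2"
      using heat_product_inequality[OF m(2) K assms(1,2), where 'n = 'n] by blast
    have "jet_sq l U (x, 1) \<le> 2 * real CARD('n) / c + sqrt (b / c)" if U: "MA_flow U" "pinched lam Lam U"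
      for U :: "'n field" and x
    proof -
      have sU: "smooth U" using U(1) MA_flow_def by blast
      have "1 * jet_sq l U (x, 1) \<le> (k + jet_sq m U (x, 1)) * jet_sq l U (x, 1)"
        using kcb(1) jet_sq_nonneg[of m U "(x, 1)"] by (intro mult_right_mono jet_sq_nonneg) auto
      also have "\<dots> \<le> 2 * real CARD('n) / c + sqrt (b / c)"
        unfolding m(1)
      proof (rule interior_maximum_bound[OF U(1) assms(1) U(2) _ kcb(2,3)])
        show "smooth (\<lambda>y. (k + jet_sq m U y) * jet_sq (Suc m) U y)"
          by (intro smooth_fun_on_mult smooth_fun_on_add smooth_fun_on_const smooth_jet_sq open_Om sU)
        fix z :: "'n spacetime" assume z: "1/2 \<le> snd z"
        then have "z \<in> Om" by (cases z) auto
        then show "heat U (\<lambda>y. (k + jet_sq m U y) * jet_sq (Suc m) U y) z \<le> b - c * ((k + jet_sq m U z) * jet_sq (Suc m) U z)\<^sup>2"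
          by (rule heat[OF U _ jb[OF U z]])
      qed
      finally show ?thesis by simp
    qed
    then show ?thesis by blast
  qed
qed

section \<open>From solutions on time slices to functions on space-time\<close>

lemma partial_deriv_slice:
  fixes u :: "real^'n \<Rightarrow> real \<Rightarrow> real"
  assumes "smooth (\<lambda>(x, t). u x t)" "0 < t"
  shows "partial_deriv js (\<lambda>y. u y t) x = DJ js (\<lambda>(x, t). u x t) (x, t)"
proof (induction js arbitrary: x)
  case (Cons i js)
  let ?g = "DJ js (\<lambda>(x, t). u x t)"
  have e: "partial_deriv js (\<lambda>y. u y t) = (\<lambda>y. ?g (y, t))" using Cons.IH by (simp add: fun_eq_iff)
  have d: "?g differentiable (at (x, t))"
    by (rule smooth_differentiable[OF smooth_DJ[OF assms(1)]]) (use assms(2) in simp)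
  have "((\<lambda>y. (y, t)) has_derivative (\<lambda>h. (h, 0))) (at x)"
    by (auto intro!: derivative_eq_intros)
  from dd_eq[OF has_derivative_compose[OF this has_derivative_dd[OF d]]]
  have "dd (axis i 1) (\<lambda>y. ?g (y, t)) x = dX i ?g (x, t)" unfolding dX_def .
  then show ?case by (simp only: partial_deriv.simps e dd_def DJ.simps)
qed simp

lemma norm_D_slice:
  fixes u :: "real^'n \<Rightarrow> real \<Rightarrow> real"
  assumes "smooth (\<lambda>(x, t). u x t)" "0 < t"
  shows "(norm_D l (\<lambda>y. u y t) x)\<^sup>2 = jet_sq l (\<lambda>(x, t). u x t) (x, t)"
  unfolding norm_D_def partial_deriv_slice[OF assms] jet_sq_def[symmetric] by (simp add: jet_sq_nonneg)

lemma hessian_slice: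
  fixes u :: "real^'n \<Rightarrow> real \<Rightarrow> real"
  assumes "smooth (\<lambda>(x, t). u x t)" "0 < t"
  shows "hessian (\<lambda>y. u y t) x = hess (\<lambda>(x, t). u x t) (x, t)"
  unfolding hessian_def partial_deriv_slice[OF assms] hess_def ..

lemma deriv_slice:
  fixes u :: "real^'n \<Rightarrow> real \<Rightarrow> real"
  assumes "smooth (\<lambda>(x, t). u x t)" "0 < t"
  shows "deriv (\<lambda>s. u x s) t = dT (\<lambda>(x, t). u x t) (x, t)"
proof -
  have "(\<lambda>(x, t). u x t) differentiable (at ((x, 0) + t *\<^sub>R (0, 1)))"
    by (rule smooth_differentiable[OF assms(1)]) (use assms(2) in simp)
  from DERIV_along_line[OF this]
  have "((\<lambda>s. u x s) has_real_derivative dT (\<lambda>(x, t). u x t) (x, t)) (at t)"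
    unfolding dT_def by simp
  then show ?thesis by (rule DERIV_imp_deriv)
qed

text \<open>
  The bounds of condition A pass to the Hessian on space-time and imply that it is positive definite.
\<close>

lemma MA_flow_of_solution:
  fixes u0 :: "real^'n \<Rightarrow> real"
  assumes sol: "log_MA_flow_solution u0 u" and A: "\<And>t. 0 \<le> t \<Longrightarrow> condition_A lam Lam (\<lambda>x. u x t)" and lam: "0 < lam"
  shows "MA_flow (\<lambda>(x, t). u x t)" "pinched lam Lam (\<lambda>(x, t). u x t)"
proof -
  let ?U = "\<lambda>(x, t). u x t"
  have s: "smooth ?U" using sol unfolding log_MA_flow_solution_def by blast
  have q: "lam * (v \<bullet> v) \<le> v \<bullet> (hess ?U z *v v)" "v \<bullet> (hess ?U z *v v) \<le> Lam * (v \<bullet> v)" if z: "z \<in> Om" for z v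
  proof -
    obtain x t where xt: "z = (x, t)" "0 < t" using z by auto
    have "matrix_le (lam *\<^sub>R mat 1) (hessian (\<lambda>y. u y t) x)" "matrix_le (hessian (\<lambda>y. u y t) x) (Lam *\<^sub>R mat 1)"
      using A[of t] xt(2) unfolding condition_A_def by auto
    then have "matrix_le (lam *\<^sub>R mat 1) (hess ?U z)" "matrix_le (hess ?U z) (Lam *\<^sub>R mat 1)"
      unfolding hessian_slice[OF s xt(2)] xt(1) .
    then show "lam * (v \<bullet> v) \<le> v \<bullet> (hess ?U z *v v)" "v \<bullet> (hess ?U z *v v) \<le> Lam * (v \<bullet> v)"
      unfolding matrix_le_def by (auto simp: scaleR_matrix_vector_assoc[symmetric])
  qed
  show "pinched lam Lam ?U" unfolding pinched_def using q by blast
  have eq: "real CARD('n) * dT ?U z = ln (det (hess ?U z)) + 0 \<and> 0 < det (hess ?U z)" if z: "z \<in> Om" for z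
  proof -
    obtain x t where xt: "z = (x, t)" "0 < t" using z by auto
    have "0 < det (hessian (\<lambda>y. u y t) x)"
      "deriv (\<lambda>s. u x s) t - 1 / real CARD('n) * ln (det (hessian (\<lambda>y. u y t) x)) = 0"
      using sol xt(2) unfolding log_MA_flow_solution_def by blast+
    then show ?thesis unfolding hessian_slice[OF s xt(2)] deriv_slice[OF s xt(2)] xt(1)
      by (simp add: field_simps)
  qed
  have pos: "0 < v \<bullet> (hess ?U z *v v)" if "z \<in> Om" "v \<noteq> 0" for z v
  proof -
    have "0 < lam * (v \<bullet> v)" using lam that(2) by simp
    then show ?thesis using q(1)[OF that(1), of v] by linarith
  qed
  show "MA_flow ?U" unfolding MA_flow_def using s eq pos by blast
qed

lemma sup_norm_D_bound:
  assumes "0 < lam" "0 < Lam" "0 < eps0" "3 \<le> l"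
  shows "\<exists>C>0. \<forall>(u0 :: real^'n \<Rightarrow> real) u.
        C_k_on 2 u0 UNIV \<longrightarrow> log_MA_flow_solution u0 u \<longrightarrow>
        (\<forall>t\<ge>0. condition_A lam Lam (\<lambda>x. u x t)) \<longrightarrow>
        (\<forall>t\<ge>eps0. (SUP x. ereal ((norm_D l (\<lambda>y. u y t) x)\<^sup>2)) \<le> ereal (C / t ^ (l - 2)))"
proof -
  obtain C where C: "\<And>(U :: 'n::finite field) x. MA_flow U \<Longrightarrow> pinched lam Lam U \<Longrightarrow> jet_sq l U (x, 1) \<le> C"
    using derivative_bound_at_1[OF assms(1,2,4), where 'n = 'n] by blast
  show ?thesis
  proof (intro exI[of _ "\<bar>C\<bar> + 1"] conjI allI impI)
    fix u0 :: "real^'n \<Rightarrow> real" and u t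
    assume sol: "log_MA_flow_solution u0 u" and A: "\<forall>t\<ge>0. condition_A lam Lam (\<lambda>x. u x t)" and "eps0 \<le> t"
    then have t: "0 < t" using assms(3) by linarith
    have s: "smooth (\<lambda>(x, t). u x t)" using sol unfolding log_MA_flow_solution_def by blast
    note F = MA_flow_of_solution[OF sol A[rule_format] assms(1)]
    show "(SUP x. ereal ((norm_D l (\<lambda>y. u y t) x)\<^sup>2)) \<le> ereal ((\<bar>C\<bar> + 1) / t ^ (l - 2))"
    proof (rule SUP_least)
      fix x
      have "jet_sq l (\<lambda>(x, t). u x t) (x, t) \<le> C / t ^ (l - 2)"
        using assms(4) by (intro jet_sq_scaling[OF C F t]) auto
      also have "\<dots> \<le> (\<bar>C\<bar> + 1) / t ^ (l - 2)" using t by (intro divide_right_mono) auto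
      finally show "ereal ((norm_D l (\<lambda>y. u y t) x)\<^sup>2) \<le> ereal ((\<bar>C\<bar> + 1) / t ^ (l - 2))"
        unfolding norm_D_slice[OF s t] by simp
    qed
  qed simp
qed

theorem theorem1p3:
  fixes lam Lam eps0 :: real
  assumes "0 < lam" and "lam \<le> Lam" and "0 < eps0"
  shows
    "(\<exists>C>0. \<forall>(u0 :: real^'n \<Rightarrow> real) u.
        C_k_on 2 u0 UNIV \<longrightarrow> log_MA_flow_solution u0 u \<longrightarrow>
        (\<forall>t\<ge>0. condition_A lam Lam (\<lambda>x. u x t)) \<longrightarrow>
        (\<forall>t\<ge>eps0. (SUP x. ereal ((norm_D 3 (\<lambda>y. u y t) x)\<^sup>2)) \<le> ereal (C / t))) \<and>
     (\<forall>l\<ge>3. \<exists>C>0. \<forall>(u0 :: real^'n \<Rightarrow> real) u.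
        C_k_on 2 u0 UNIV \<longrightarrow> log_MA_flow_solution u0 u \<longrightarrow>
        (\<forall>t\<ge>0. condition_A lam Lam (\<lambda>x. u x t)) \<longrightarrow>
        (\<forall>t\<ge>eps0. (SUP x. ereal ((norm_D l (\<lambda>y. u y t) x)\<^sup>2)) \<le> ereal (C / t ^ (l - 2))))"
proof (intro conjI allI impI)
  have Lam: "0 < Lam" using assms by linarith
  note b = sup_norm_D_bound[OF assms(1) Lam assms(3), where 'n = 'n]
  show "\<exists>C>0. \<forall>(u0 :: real^'n \<Rightarrow> real) u.
        C_k_on 2 u0 UNIV \<longrightarrow> log_MA_flow_solution u0 u \<longrightarrow>
        (\<forall>t\<ge>0. condition_A lam Lam (\<lambda>x. u x t)) \<longrightarrow>
        (\<forall>t\<ge>eps0. (SUP x. ereal ((norm_D 3 (\<lambda>y. u y t) x)\<^sup>2)) \<le> ereal (C / t))"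
    using b[of 3] by simp
  fix l :: nat assume "3 \<le> l"
  then show "\<exists>C>0. \<forall>(u0 :: real^'n \<Rightarrow> real) u.
        C_k_on 2 u0 UNIV \<longrightarrow> log_MA_flow_solution u0 u \<longrightarrow>
        (\<forall>t\<ge>0. condition_A lam Lam (\<lambda>x. u x t)) \<longrightarrow>
        (\<forall>t\<ge>eps0. (SUP x. ereal ((norm_D l (\<lambda>y. u y t) x)\<^sup>2)) \<le> ereal (C / t ^ (l - 2)))"
    by (rule b)
qed

end
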